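(* Let $\eta^8(3\tau)=\sum_{n\ge 1}a(n)q^n$ be the Fourier expansion of $\eta^8(3\tau)$, where $q=e^{2\pi i\tau}$. For any integer $n\ge 0$, $$A_{3,4}(n)=\frac{1}{81}\bigl(\sigma_3(3n+4)-a(3n+4)\bigr).$$
   Context: A partition is called $t$-core if none of its hook numbers (hook lengths) is a multiple of $t$ (the empty partition is $t$-core). A partition $k$-tuple of $n$ is an ordered $k$-tuple $(\lambda_1,\ldots,\lambda_k)$ of (possibly empty) partitions such that the sum of all the parts of all the $\lambda_i$ equals $n$. $A_{t,k}(n)$ denotes the number of partition $k$-tuples of $n$ in which each $\lambda_i$ is $t$-core. The Dedekind eta function is $\eta(\tau)=q^{1/24}\prod_{m\ge 1}(1-q^m)$ with $q=e^{2\pi i\tau}$, $\tau$ in the complex upper half plane, and $\eta^r(m\tau)$ means $(\eta(m\tau))^r$. Also $\sigma_3(n)=\sum_{d\mid n}d^3$, the sum being over positive divisors $d$ of $n$. *)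

theory Defs
  imports "HOL-Analysis.Analysis"
begin

text \<open>
  A partition is the list of its parts in weakly decreasing order, all parts positive;
  the empty list is the empty partition. Rows and columns of the Young diagram are
  numbered from 0.
\<close>

definition is_partition :: "nat list \<Rightarrow> bool" where
  "is_partition p \<longleftrightarrow> sorted_wrt (\<ge>) p \<and> 0 \<notin> set p"

definition young_diagram :: "nat list \<Rightarrow> (nat \<times> nat) set" where
  "young_diagram p = {(i, j). i < length p \<and> j < p ! i}"

text \<open>The hook of a cell: the cell itself, the cells to its right in its row,
  and the cells below it in its column.\<close>

definition hook_length :: "nat list \<Rightarrow> nat \<Rightarrow> nat \<Rightarrow> nat" where
  "hook_length p i j =
     card {(k, l) \<in> young_diagram p. (k = i \<and> j \<le> l) \<or> (l = j \<and> i \<le> k)}"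

definition t_core :: "nat \<Rightarrow> nat list \<Rightarrow> bool" where
  "t_core t p \<longleftrightarrow> (\<forall>(i, j) \<in> young_diagram p. \<not> t dvd hook_length p i j)"

definition partition_tuples :: "nat \<Rightarrow> nat \<Rightarrow> nat list list set" where
  "partition_tuples k n =
     {ps. length ps = k \<and> (\<forall>p \<in> set ps. is_partition p) \<and> (\<Sum>p\<leftarrow>ps. sum_list p) = n}"

definition core_tuple_count :: "nat \<Rightarrow> nat \<Rightarrow> nat \<Rightarrow> nat" where
  "core_tuple_count t k n = card {ps \<in> partition_tuples k n. \<forall>p \<in> set ps. t_core t p}"

definition qexp :: "complex \<Rightarrow> complex" where
  "qexp \<tau> = exp (2 * of_real pi * \<i> * \<tau>)"

text \<open>The factor \<open>q\<^sup>1\<^sup>/\<^sup>2\<^sup>4\<close> is \<open>exp (2 \<pi> \<i> \<tau> / 24)\<close>, not a principal root of \<open>q\<close>.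
  The definition is meaningful only for \<open>Im \<tau> > 0\<close>.\<close>

definition dedekind_eta :: "complex \<Rightarrow> complex" where
  "dedekind_eta \<tau> = qexp (\<tau> / 24) * (\<Prod>m. 1 - qexp \<tau> ^ Suc m)"

definition divisor_sigma :: "nat \<Rightarrow> nat \<Rightarrow> nat" where
  "divisor_sigma k n = (\<Sum>d | d dvd n. d ^ k)"

end

theory Submission
  imports Defs "HOL-Complex_Analysis.Laurent_Convergence"
begin

text \<open>
  Let \<open>E = \<Prod>n\<ge>1. 1 - q\<^sup>n\<close> and \<open>P = E(q\<^sup>3)\<^sup>3 / E(q)\<close>. Kronecker's identity says that
  \<open>\<Sum>n. z\<^sup>n / (1 - q\<^sup>3\<^sup>n\<^sup>+\<^sup>1)\<close> is a quotient of theta functions. Differentiating it in \<open>z\<close> at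
  \<open>z = q\<close> and \<open>z = q\<^sup>2\<close> expresses the generating functions of \<open>\<sigma>\<^sub>1(3n+1)\<close>, \<open>\<sigma>\<^sub>1(3n+2)\<close> and \<open>\<sigma>\<^sub>3(3n+1)\<close>
  through \<open>P\<close> and the cubic theta function \<open>a\<close>; the first two are \<open>P a\<close> and \<open>3 P\<^sup>2\<close>. Since
  \<open>E\<^sup>3 = E(q\<^sup>3) (a(q\<^sup>3) - 3 q P(q\<^sup>3))\<close> by Jacobi's identity, and \<open>\<sigma>\<^sub>1\<close> gives the logarithmic derivative
  of \<open>E\<close>, splitting that derivative by residues of exponents modulo 3 gives differential
  equations for \<open>a\<close> and \<open>P\<close>. They imply \<open>a\<^sup>3 = E\<^sup>9 / E(q\<^sup>3)\<^sup>3 + 27 q P\<^sup>3\<close> and turn the formula for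
  \<open>\<sigma>\<^sub>3\<close> into \<open>\<Sum>n. \<sigma>\<^sub>3(3n+1) q\<^sup>n = E\<^sup>8 + 81 q P\<^sup>4\<close>. Finally \<open>P\<close> counts 3-cores: a 3-core is
  determined by the residue counts of its beta set, and the resulting quadratic form is the
  one in the coefficient of \<open>z\<^sup>0\<close> of a product of three theta functions.
\<close>

section \<open>Locally finite families of power series\<close>

text \<open>Apart from the passage to the eta function, every identity is one of formal power series
  in q (the variable \<open>fps_X\<close>). The obstacle is Kronecker's series: it converges only
  for |q^3| < |z| < 1, and as a formal object its terms have infinitely many constant terms 1. Only
  its product with a theta function is therefore formed. A two-term recurrence determines that
  product up to one factor, and a derivative at a zero of a theta function, taken after
  multiplication by 1 - z, identifies the factor. The points z = q and z = q^2 lie inside the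
  annulus, so derivatives exist there directly; the weight 3n + 1 then runs through signed divisors
  of 3N + 1 or 3N + 2. No space of modular forms is used: two products agree once their logarithmic
  derivatives and constant terms do. The constant 81 is 54 + 27: the differential equations reduce
  the generating function of sigma_3 to P (a^3 + 54 q P^3), and the cubic identity contributes
  another 27. The shift from 3n + 1 to 3n + 4 comes from the factor q in front of P^4.\<close>

definition loc_fin :: "('i \<Rightarrow> complex fps) \<Rightarrow> bool" where
  "loc_fin f \<longleftrightarrow> (\<forall>n. finite {i. fps_nth (f i) n \<noteq> 0})"

text \<open>An X-adic sum over an unordered index type, so that reindexing and interchange of sums
  need no limits. In a degree to which infinitely many terms contribute, the coefficient is
  \<open>0\<close>, the value of \<open>sum\<close> on an infinite set.\<close>

definition fsum :: "('i \<Rightarrow> complex fps) \<Rightarrow> complex fps" where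
  "fsum f = Abs_fps (\<lambda>n. \<Sum>i | fps_nth (f i) n \<noteq> 0. fps_nth (f i) n)"

lemma loc_finI: "(\<And>n. finite (A n)) \<Longrightarrow> (\<And>i n. fps_nth (f i) n \<noteq> 0 \<Longrightarrow> i \<in> A n) \<Longrightarrow> loc_fin f"
  unfolding loc_fin_def by (auto intro: finite_subset[of _ "A n" for n])

lemma loc_fin_upto:
  assumes "loc_fin f" shows "finite {i. \<exists>k\<le>n. fps_nth (f i) k \<noteq> 0}"
proof -
  have "{i. \<exists>k\<le>n. fps_nth (f i) k \<noteq> 0} = (\<Union>k\<in>{..n}. {i. fps_nth (f i) k \<noteq> 0})" by auto
  then show ?thesis using assms by (auto simp: loc_fin_def)
qed

lemma fsum_nth:
  assumes "finite A" "\<And>i. fps_nth (f i) n \<noteq> 0 \<Longrightarrow> i \<in> A"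
  shows "fps_nth (fsum f) n = (\<Sum>i\<in>A. fps_nth (f i) n)"
  unfolding fsum_def fps_nth_Abs_fps using assms by (intro sum.mono_neutral_left) auto

lemma fsum_reindex:
  assumes "bij g" shows "fsum (\<lambda>i. f (g i)) = fsum f"
proof (rule fps_ext)
  fix n
  have "g ` {i. fps_nth (f (g i)) n \<noteq> 0} = {i. fps_nth (f i) n \<noteq> 0}"
    using surjD[OF bij_is_surj[OF assms]] by fastforce
  then have "bij_betw g {i. fps_nth (f (g i)) n \<noteq> 0} {i. fps_nth (f i) n \<noteq> 0}"
    using bij_is_inj[OF assms] by (auto simp: bij_betw_def inj_on_def inj_def)
  then show "fps_nth (fsum (\<lambda>i. f (g i))) n = fps_nth (fsum f) n"
    by (simp add: fsum_def sum.reindex_bij_betw[symmetric])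
qed

lemma loc_fin_reindex:
  assumes "inj g" "loc_fin f" shows "loc_fin (\<lambda>i. f (g i))"
  using assms finite_vimageI[of _ g] unfolding loc_fin_def vimage_def by fastforce

lemma fps_mult_nth_nonzero:
  fixes f g :: "complex fps"
  assumes "fps_nth (f * g) n \<noteq> 0"
  obtains k where "k \<le> n" "fps_nth f k \<noteq> 0" "fps_nth g (n - k) \<noteq> 0"
  using assms by (auto simp: fps_mult_nth elim!: sum.not_neutral_contains_not_neutral)

lemma loc_fin_mult_left: "loc_fin f \<Longrightarrow> loc_fin (\<lambda>i. g i * f i)"
proof (rule loc_finI)
  fix n assume *: "loc_fin f"
  show "finite {i. \<exists>k\<le>n. fps_nth (f i) k \<noteq> 0}" by (rule loc_fin_upto[OF *])
next
  fix i n assume "fps_nth (g i * f i) n \<noteq> 0"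
  then show "i \<in> {i. \<exists>k\<le>n. fps_nth (f i) k \<noteq> 0}"
    by (auto elim!: fps_mult_nth_nonzero intro: exI[of _ "n - k" for k])
qed

lemma loc_fin_mult_right: "loc_fin f \<Longrightarrow> loc_fin (\<lambda>i. f i * g i)"
  using loc_fin_mult_left[of f g] by (simp add: mult.commute)

lemma loc_fin_add: "loc_fin f \<Longrightarrow> loc_fin g \<Longrightarrow> loc_fin (\<lambda>i. f i + g i)"
  by (rule loc_finI[of "\<lambda>n. {i. fps_nth (f i) n \<noteq> 0} \<union> {i. fps_nth (g i) n \<noteq> 0}"])
    (auto simp: loc_fin_def)

lemma loc_fin_minus: "loc_fin f \<Longrightarrow> loc_fin (\<lambda>i. - f i)"
  by (simp add: loc_fin_def)

lemma loc_fin_diff: "loc_fin f \<Longrightarrow> loc_fin g \<Longrightarrow> loc_fin (\<lambda>i. f i - g i)"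
  using loc_fin_add[OF _ loc_fin_minus, of f g] by simp

lemma fsum_add:
  assumes "loc_fin f" "loc_fin g" shows "fsum (\<lambda>i. f i + g i) = fsum f + fsum g"
proof (rule fps_ext)
  fix n
  let ?A = "{i. fps_nth (f i) n \<noteq> 0} \<union> {i. fps_nth (g i) n \<noteq> 0}"
  have fin: "finite ?A" using assms by (auto simp: loc_fin_def)
  show "fps_nth (fsum (\<lambda>i. f i + g i)) n = fps_nth (fsum f + fsum g) n"
  proof -
    have "fps_nth (fsum (\<lambda>i. f i + g i)) n = (\<Sum>i\<in>?A. fps_nth (f i + g i) n)"
      by (rule fsum_nth[OF fin]) auto
    moreover have "fps_nth (fsum f) n = (\<Sum>i\<in>?A. fps_nth (f i) n)" by (rule fsum_nth[OF fin]) auto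
    moreover have "fps_nth (fsum g) n = (\<Sum>i\<in>?A. fps_nth (g i) n)" by (rule fsum_nth[OF fin]) auto
    ultimately show ?thesis by (simp add: sum.distrib)
  qed
qed

lemma fsum_uminus: "fsum (\<lambda>i. - f i) = - fsum f"
  by (rule fps_ext) (simp add: fsum_def sum_negf)

lemma fsum_diff:
  assumes "loc_fin f" "loc_fin g" shows "fsum (\<lambda>i. f i - g i) = fsum f - fsum g"
  using fsum_add[OF assms(1) loc_fin_minus[OF assms(2)]] by (simp add: fsum_uminus)

lemma fsum_nth_cutoff:
  assumes "loc_fin f" "finite A" "\<And>i k. k \<le> n \<Longrightarrow> fps_nth (f i) k \<noteq> 0 \<Longrightarrow> i \<in> A" "k \<le> n"
  shows "fps_nth (fsum f) k = fps_nth (sum f A) k"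
  using assms by (simp add: fsum_nth[of A] fps_sum_nth)

lemma fps_mult_nth_cong:
  assumes "\<And>k. k \<le> n \<Longrightarrow> fps_nth f k = fps_nth f' k" "\<And>k. k \<le> n \<Longrightarrow> fps_nth g k = fps_nth g' k"
  shows "fps_nth (f * g) n = fps_nth (f' * g') n"
  using assms by (auto simp: fps_mult_nth intro!: sum.cong)

lemma loc_fin_times:
  assumes "loc_fin f" "loc_fin g" shows "loc_fin (\<lambda>(i, j). f i * g j)"
proof (rule loc_finI)
  fix n
  show "finite ({i. \<exists>k\<le>n. fps_nth (f i) k \<noteq> 0} \<times> {i. \<exists>k\<le>n. fps_nth (g i) k \<noteq> 0})"
    using assms by (intro finite_cartesian_product loc_fin_upto)
next
  fix p n assume a: "fps_nth (case p of (i, j) \<Rightarrow> f i * g j) n \<noteq> 0"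
  obtain i j where p: "p = (i, j)" by fastforce
  from a p obtain k where "k \<le> n" "fps_nth (f i) k \<noteq> 0" "fps_nth (g j) (n - k) \<noteq> 0"
    by (auto elim: fps_mult_nth_nonzero)
  then show "p \<in> {i. \<exists>k\<le>n. fps_nth (f i) k \<noteq> 0} \<times> {i. \<exists>k\<le>n. fps_nth (g i) k \<noteq> 0}"
    using p by (auto intro: exI[of _ k] exI[of _ "n - k"])
qed

lemma fsum_times:
  assumes "loc_fin f" "loc_fin g"
  shows "fsum f * fsum g = fsum (\<lambda>(i, j). f i * g j)"
proof (rule fps_ext)
  fix n
  let ?A = "{i. \<exists>k\<le>n. fps_nth (f i) k \<noteq> 0}" and ?B = "{i. \<exists>k\<le>n. fps_nth (g i) k \<noteq> 0}"
  have fin: "finite ?A" "finite ?B" using assms loc_fin_upto by auto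
  have "fps_nth (fsum f * fsum g) n = fps_nth (sum f ?A * sum g ?B) n"
    using fsum_nth_cutoff[OF assms(1) fin(1), of n] fsum_nth_cutoff[OF assms(2) fin(2), of n]
    by (intro fps_mult_nth_cong) auto
  also have "sum f ?A * sum g ?B = (\<Sum>(i,j)\<in>?A \<times> ?B. f i * g j)"
    by (simp add: sum_product sum.cartesian_product)
  also have "fps_nth \<dots> n = fps_nth (fsum (\<lambda>(i, j). f i * g j)) n"
  proof (subst fsum_nth[of "?A \<times> ?B"])
    show "finite (?A \<times> ?B)" using fin by blast
    fix p assume a: "fps_nth (case p of (i, j) \<Rightarrow> f i * g j) n \<noteq> 0"
    obtain i j where p: "p = (i, j)" by fastforce
    from a p obtain k where "k \<le> n" "fps_nth (f i) k \<noteq> 0" "fps_nth (g j) (n - k) \<noteq> 0"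
      by (auto elim: fps_mult_nth_nonzero)
    then show "p \<in> ?A \<times> ?B" using p by (auto intro: exI[of _ k] exI[of _ "n - k"])
  qed (simp add: fps_sum_nth case_prod_unfold)
  finally show "fps_nth (fsum f * fsum g) n = fps_nth (fsum (\<lambda>(i, j). f i * g j)) n" .
qed

lemma fsum_mult_left:
  assumes "loc_fin f" shows "fsum (\<lambda>i. c * f i) = c * fsum f"
proof (rule fps_ext)
  fix n
  let ?A = "{i. \<exists>k\<le>n. fps_nth (f i) k \<noteq> 0}"
  have fin: "finite ?A" using assms loc_fin_upto by auto
  have "fps_nth (c * fsum f) n = fps_nth (c * sum f ?A) n"
    using fsum_nth_cutoff[OF assms fin, of n] by (intro fps_mult_nth_cong) auto
  also have "c * sum f ?A = (\<Sum>i\<in>?A. c * f i)" by (simp add: sum_distrib_left)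
  also have "fps_nth \<dots> n = fps_nth (fsum (\<lambda>i. c * f i)) n"
  proof (subst fsum_nth[OF fin])
    fix i assume "fps_nth (c * f i) n \<noteq> 0"
    then show "i \<in> ?A"
      by (auto elim!: fps_mult_nth_nonzero intro: exI[of _ "n - k" for k])
  qed (simp add: fps_sum_nth)
  finally show "fps_nth (fsum (\<lambda>i. c * f i)) n = fps_nth (c * fsum f) n" by simp
qed

text \<open>Fubini: in each degree the support of the double family is finite, hence contained in a
  finite rectangle.\<close>

lemma fsum_nested:
  assumes "loc_fin (\<lambda>(i, j). f i j)"
  shows "fsum (\<lambda>i. fsum (f i)) = fsum (\<lambda>(i, j). f i j)" "loc_fin (f i)" "loc_fin (\<lambda>i. fsum (f i))"
proof -
  have fin: "finite {(i, j). fps_nth (f i j) n \<noteq> 0}" for n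
    using assms by (auto simp: loc_fin_def case_prod_unfold)
  have inner: "loc_fin (f i)" for i
    by (rule loc_finI[of "\<lambda>n. snd ` {(i, j). fps_nth (f i j) n \<noteq> 0}"]) (use fin in force)+
  have outer: "fps_nth (fsum (f i)) n \<noteq> 0 \<Longrightarrow> i \<in> fst ` {(i, j). fps_nth (f i j) n \<noteq> 0}" for i n
    by (force simp: fsum_def elim!: sum.not_neutral_contains_not_neutral)
  then show "loc_fin (\<lambda>i. fsum (f i))"
    by (intro loc_finI[of "\<lambda>n. fst ` {(i, j). fps_nth (f i j) n \<noteq> 0}"]) (use fin in force)+
  show "loc_fin (f i)" by (rule inner)
  show "fsum (\<lambda>i. fsum (f i)) = fsum (\<lambda>(i, j). f i j)"
  proof (rule fps_ext)
    fix n
    let ?S = "{(i, j). fps_nth (f i j) n \<noteq> 0}"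
    have "fps_nth (fsum (\<lambda>i. fsum (f i))) n = (\<Sum>i\<in>fst ` ?S. fps_nth (fsum (f i)) n)"
      by (rule fsum_nth) (use fin outer in auto)
    also have "\<dots> = (\<Sum>i\<in>fst ` ?S. \<Sum>j\<in>snd ` ?S. fps_nth (f i j) n)"
      by (intro sum.cong refl fsum_nth) (use fin in force)+
    also have "\<dots> = (\<Sum>p\<in>fst ` ?S \<times> snd ` ?S. fps_nth (case p of (i, j) \<Rightarrow> f i j) n)"
      by (simp add: sum.cartesian_product case_prod_unfold)
    also have "\<dots> = fps_nth (fsum (\<lambda>(i, j). f i j)) n"
      by (rule fsum_nth[symmetric]) (use fin in force)+
    finally show "fps_nth (fsum (\<lambda>i. fsum (f i))) n = fps_nth (fsum (\<lambda>(i, j). f i j)) n" .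
  qed
qed

section \<open>The operator X d/dX and first-order linear differential equations\<close>

definition qderiv :: "complex fps \<Rightarrow> complex fps" where
  "qderiv f = fps_X * fps_deriv f"

lemma qderiv_nth [simp]: "fps_nth (qderiv f) n = of_nat n * fps_nth f n"
  by (cases n) (simp_all add: qderiv_def)

lemma qderiv_mult: "qderiv (f * g) = qderiv f * g + f * qderiv g"
  by (simp add: qderiv_def algebra_simps)

lemma qderiv_diff: "qderiv (f - g) = qderiv f - qderiv g"
  by (simp add: qderiv_def algebra_simps)

lemma qderiv_numeral: "qderiv (numeral k) = 0"
  by (simp add: qderiv_def)

lemma qderiv_X: "qderiv fps_X = fps_X"
  by (simp add: qderiv_def)

lemma qderiv_power: "qderiv (f ^ n) = of_nat n * f ^ (n - 1) * qderiv f"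
  by (simp add: qderiv_def fps_deriv_power algebra_simps fps_of_nat)

lemma qderiv_fsum:
  assumes "loc_fin f" shows "qderiv (fsum f) = fsum (\<lambda>i. qderiv (f i))"
proof (rule fps_ext)
  fix n
  have fin: "finite {i. fps_nth (f i) n \<noteq> 0}" using assms by (simp add: loc_fin_def)
  show "fps_nth (qderiv (fsum f)) n = fps_nth (fsum (\<lambda>i. qderiv (f i))) n"
    using fsum_nth[OF fin, of f n] fsum_nth[OF fin, of "\<lambda>i. qderiv (f i)" n]
    by (auto simp: sum_distrib_left)
qed

text \<open>For the difference h, coefficient n of the equation reads n h_n = sum of g_i h_(n-i).
  Since g_0 = 0, only earlier coefficients occur on the right. Jacobi's identity and the cubic
  identity are both obtained in this way.\<close>

lemma qderiv_unique:
  assumes "qderiv f = g * f" "qderiv f' = g * f'" "fps_nth g 0 = 0" "fps_nth f 0 = fps_nth f' 0"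
  shows "f = f'"
proof -
  define h where "h = f - f'"
  have h: "qderiv h = g * h" "fps_nth h 0 = 0" using assms by (simp_all add: h_def qderiv_diff algebra_simps)
  have "fps_nth h n = 0" for n
  proof (induction n rule: less_induct)
    case (less n)
    show ?case
    proof (cases "n = 0")
      case False
      have "of_nat n * fps_nth h n = (\<Sum>i=0..n. fps_nth g i * fps_nth h (n - i))"
        using arg_cong[OF h(1), of "\<lambda>f. fps_nth f n"] by (simp add: fps_mult_nth)
      also have "\<dots> = 0"
      proof (rule sum.neutral, rule ballI)
        fix i assume "i \<in> {0..n}"
        then show "fps_nth g i * fps_nth h (n - i) = 0"
          using less[of "n - i"] assms(3) False by (cases "i = 0") auto
      qed
      finally show ?thesis using False by simp
    qed (use h in simp)
  qed
  then have "h = 0" by (simp add: fps_eq_iff)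
  then show ?thesis by (simp add: h_def)
qed

section \<open>The substitution of X^3 for X and dissection by exponents modulo 3\<close>

definition expand3 :: "complex fps \<Rightarrow> complex fps" where
  "expand3 f = f oo fps_X ^ 3"

lemma expand3_nth: "fps_nth (expand3 f) n = (if 3 dvd n then fps_nth f (n div 3) else 0)"
proof -
  have "fps_nth (expand3 f) n = (\<Sum>i=0..n. if n = 3 * i then fps_nth f i else 0)"
    unfolding expand3_def fps_compose_nth
    by (intro sum.cong) (auto simp: power_mult[symmetric])
  also have "\<dots> = (\<Sum>i\<in>(if 3 dvd n then {n div 3} else {}). fps_nth f i)"
    by (intro sum.mono_neutral_cong_right) (auto split: if_splits)
  finally show ?thesis by auto
qed

lemma expand3_mult: "expand3 (f * g) = expand3 f * expand3 g"
  by (simp add: expand3_def fps_compose_mult_distrib)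

lemma expand3_power: "expand3 (f ^ n) = expand3 f ^ n"
  by (simp add: expand3_def fps_compose_power)

lemma expand3_add: "expand3 (f + g) = expand3 f + expand3 g"
  by (simp add: expand3_def fps_compose_add_distrib)

lemma expand3_diff: "expand3 (f - g) = expand3 f - expand3 g"
  by (simp add: expand3_def fps_compose_sub_distrib)

lemma triangulareral: "expand3 (numeral k) = numeral k"
  by (simp add: expand3_def)

lemma expand3_X: "expand3 fps_X = fps_X ^ 3"
  by (simp add: expand3_def)

lemma qderiv_expand3: "qderiv (expand3 f) = 3 * expand3 (qderiv f)"
  by (rule fps_ext) (auto simp: expand3_nth numeral_fps_const elim!: dvdE)

lemma fsum_expand3: "fsum (\<lambda>i. expand3 (f i)) = expand3 (fsum f)"
  by (rule fps_ext) (auto simp: fsum_def expand3_nth)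

lemma X_expand3_nth: "fps_nth (fps_X * expand3 f) n = (if n mod 3 = 1 then fps_nth f (n div 3) else 0)"
proof (cases n)
  case (Suc m)
  have "(3 dvd m) = (Suc m mod 3 = 1)" "3 dvd m \<Longrightarrow> m div 3 = Suc m div 3" by presburger+
  with Suc show ?thesis by (simp add: expand3_nth)
qed simp

lemma X2_expand3_nth: "fps_nth (fps_X ^ 2 * expand3 f) n = (if n mod 3 = 2 then fps_nth f (n div 3) else 0)"
proof -
  consider "n < 2" | k where "n = k + 2" by (metis add.commute le_Suc_ex not_le)
  then show ?thesis
  proof cases
    case 2
    have "(3 dvd k) = ((k + 2) mod 3 = 2)" "3 dvd k \<Longrightarrow> k div 3 = (k + 2) div 3" by presburger+
    with 2 show ?thesis by (simp add: expand3_nth fps_X_power_mult_nth)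
  qed (auto simp: fps_X_power_mult_nth)
qed

lemma trisect_eq:
  assumes "expand3 f0 + fps_X * expand3 f1 + fps_X ^ 2 * expand3 f2 = expand3 g0 + fps_X * expand3 g1 + fps_X ^ 2 * expand3 g2"
  shows "f0 = g0" "f1 = g1" "f2 = g2"
proof -
  have *: "fps_nth (expand3 f0) n + fps_nth (fps_X * expand3 f1) n + fps_nth (fps_X ^ 2 * expand3 f2) n =
     fps_nth (expand3 g0) n + fps_nth (fps_X * expand3 g1) n + fps_nth (fps_X ^ 2 * expand3 g2) n" for n
    using arg_cong[OF assms, of "\<lambda>f. fps_nth f n"] by simp
  have "fps_nth f0 n = fps_nth g0 n" "fps_nth f1 n = fps_nth g1 n" "fps_nth f2 n = fps_nth g2 n" for n
  proof -
    have m: "3 * n mod 3 = 0" "(3 * n + 1) mod 3 = 1" "(3 * n + 2) mod 3 = 2"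
       "3 * n div 3 = n" "(3 * n + 1) div 3 = n" "(3 * n + 2) div 3 = n" "\<not> 3 dvd 3 * n + 1" "\<not> 3 dvd 3 * n + 2"
      by presburger+
    show "fps_nth f0 n = fps_nth g0 n"
      using *[of "3 * n"] unfolding expand3_nth X_expand3_nth X2_expand3_nth m by simp
    show "fps_nth f1 n = fps_nth g1 n"
      using *[of "3 * n + 1"] unfolding expand3_nth X_expand3_nth X2_expand3_nth m using m by simp
    show "fps_nth f2 n = fps_nth g2 n"
      using *[of "3 * n + 2"] unfolding expand3_nth X_expand3_nth X2_expand3_nth m using m by simp
  qed
  then show "f0 = g0" "f1 = g1" "f2 = g2" by (simp_all add: fps_eq_iff)
qed

text \<open>Sequences indexed by the integers stand for Laurent series in a second variable \<open>z\<close>;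
  the moments below are the values at \<open>z = 1\<close> of differential operators in \<open>z\<close> applied to them.\<close>

definition convolve :: "(int \<Rightarrow> complex fps) \<Rightarrow> (int \<Rightarrow> complex fps) \<Rightarrow> int \<Rightarrow> complex fps" where
  "convolve f g m = fsum (\<lambda>n. f n * g (m - n))"

definition moment :: "(int \<Rightarrow> complex) \<Rightarrow> (int \<Rightarrow> complex fps) \<Rightarrow> complex fps" where
  "moment w f = fsum (\<lambda>n. fps_const (w n) * f n)"

lemma bij_shear: "bij (\<lambda>(m::int, n). (n, m - n))"
  by (rule bij_betw_byWitness[where f' = "\<lambda>(n, l). (n + l, n)"]) auto

lemma convolve_pair:
  fixes f g :: "int \<Rightarrow> complex fps"
  assumes "loc_fin f" "loc_fin g"
  shows "fsum (\<lambda>(m, n). fps_const (w m) * (f n * g (m - n)))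
       = fsum (\<lambda>(n, l). fps_const (w (n + l)) * (f n * g l))"
    and "loc_fin (\<lambda>(m, n). fps_const (w m) * (f n * g (m - n)))"
proof -
  let ?F = "\<lambda>(n, l). fps_const (w (n + l)) * (f n * g l)"
  have lf: "loc_fin ?F"
    using loc_fin_mult_left[OF loc_fin_times[OF assms], of "\<lambda>(n,l). fps_const (w (n + l))"]
    by (simp add: case_prod_unfold)
  from loc_fin_reindex[of "\<lambda>(m::int, n). (n, m - n)" ?F] bij_is_inj[OF bij_shear] lf fsum_reindex[OF bij_shear, of ?F]
  show "fsum (\<lambda>(m, n). fps_const (w m) * (f n * g (m - n))) = fsum ?F"
    and "loc_fin (\<lambda>(m, n). fps_const (w m) * (f n * g (m - n)))"
    by (simp_all add: case_prod_unfold)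
qed

lemma loc_fin_convolve:
  assumes "loc_fin f" "loc_fin g" shows "loc_fin (convolve f g)"
  using fsum_nested(3)[OF convolve_pair(2)[OF assms, of "\<lambda>_. 1"]] by (simp add: convolve_def[abs_def])

lemma loc_fin_convolve_term: "loc_fin f \<Longrightarrow> loc_fin g \<Longrightarrow> loc_fin (\<lambda>n. f n * g (m - n))"
  by (rule loc_fin_mult_right)

text \<open>A weight of n + l that is a finite sum of products of weights of n and of l makes the
  double sum factor. For powers of an additive weight this is the Leibniz rule for z d/dz at z =
  1.\<close>

lemma moment_convolve:
  assumes f: "loc_fin f" and g: "loc_fin g" and K: "finite K"
    and w: "\<And>n l. w (n + l) = (\<Sum>k\<in>K. u k n * v k l)"
  shows "moment w (convolve f g) = (\<Sum>k\<in>K. moment (u k) f * moment (v k) g)"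
proof -
  have const_sum: "fps_const (sum h K) = (\<Sum>k\<in>K. fps_const (h k))" for h
    by (rule fps_ext) (simp add: fps_sum_nth)
  have "moment w (convolve f g) = fsum (\<lambda>m. fsum (\<lambda>n. fps_const (w m) * (f n * g (m - n))))"
    by (simp add: moment_def convolve_def fsum_mult_left loc_fin_convolve_term[OF f g])
  also have "\<dots> = fsum (\<lambda>(n, l). fps_const (w (n + l)) * (f n * g l))"
    using fsum_nested(1)[OF convolve_pair(2)[OF f g]] convolve_pair(1)[OF f g] by simp
  also have "\<dots> = fsum (\<lambda>p. \<Sum>k\<in>K. (fps_const (u k (fst p)) * f (fst p)) * (fps_const (v k (snd p)) * g (snd p)))"
    by (intro arg_cong[of _ _ fsum] ext)
      (auto simp: w sum_distrib_right sum_distrib_left const_sum fps_const_mult[symmetric] mult_ac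
        simp del: fps_const_mult intro!: sum.cong)
  also have "\<dots> = (\<Sum>k\<in>K. moment (u k) f * moment (v k) g)"
    using K
  proof (induction K)
    case empty
    then show ?case by (simp add: fsum_def fps_eq_iff)
  next
    case (insert k K)
    let ?t = "\<lambda>k p. (fps_const (u k (fst p)) * f (fst p)) * (fps_const (v k (snd p)) * g (snd p))"
    have lf: "loc_fin (?t k)" for k
      using loc_fin_times[OF loc_fin_mult_left[OF f] loc_fin_mult_left[OF g]]
      by (simp add: case_prod_unfold)
    have lfs: "loc_fin (\<lambda>p. \<Sum>k\<in>K. ?t k p)"
      using insert(1)
    proof (induction K)
      case empty
      then show ?case by (simp add: loc_fin_def)
    next
      case (insert k K)
      then show ?case by (simp add: loc_fin_add lf)
    qed
    have "fsum (?t k) = moment (u k) f * moment (v k) g"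
      using fsum_times[OF loc_fin_mult_left[OF f] loc_fin_mult_left[OF g]]
      by (simp add: moment_def case_prod_unfold)
    then show ?case using insert lf lfs by (simp add: fsum_add)
  qed
  finally show ?thesis .
qed

section \<open>Lambert kernels and theta series\<close>

text \<open>Exponents arise from quadratic polynomials in an integer index. A negative exponent
  yields \<open>1\<close>, hence the nonnegativity assumptions in rules such as
  \<open>X_pow_add\<close>.\<close>

definition X_pow :: "int \<Rightarrow> complex fps" where "X_pow k = fps_X ^ nat k"

lemma X_pow_nth: "0 \<le> k \<Longrightarrow> fps_nth (X_pow k) n = (if int n = k then 1 else 0)"
  by (auto simp: X_pow_def)

lemma X_pow_add: "0 \<le> a \<Longrightarrow> 0 \<le> b \<Longrightarrow> X_pow a * X_pow b = X_pow (a + b)"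
  by (simp add: X_pow_def power_add[symmetric] nat_add_distrib)

lemma X_pow_0 [simp]: "X_pow 0 = 1" by (simp add: X_pow_def)

lemma X_pow_nonzero [simp]: "X_pow a \<noteq> 0" by (simp add: X_pow_def)

lemma X_pow_mult_nth: "0 \<le> a \<Longrightarrow> fps_nth (X_pow a * f) n = (if int n < a then 0 else fps_nth f (nat (int n - a)))"
  by (auto simp: X_pow_def fps_X_power_mult_nth nat_diff_distrib intro!: arg_cong[of _ _ "fps_nth f"])

lemma expand3_X_pow: "0 \<le> a \<Longrightarrow> expand3 (X_pow a) = X_pow (3 * a)"
  by (simp add: X_pow_def expand3_power expand3_X power_mult[symmetric] nat_mult_distrib)

lemma qderiv_X_pow: "0 \<le> a \<Longrightarrow> qderiv (X_pow a) = fps_const (of_int a) * X_pow a"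
  by (rule fps_ext) (auto simp: X_pow_nth)

definition sgn_fps :: "int \<Rightarrow> complex fps" where "sgn_fps l = (if even l then 1 else -1)"

lemma sgn_fps_Suc: "sgn_fps (l + 1) = - sgn_fps l" by (simp add: sgn_fps_def)
lemma sgn_fps_minus: "sgn_fps (- l) = sgn_fps l" by (simp add: sgn_fps_def)
lemma sgn_fps_diff: "sgn_fps (k - l) = sgn_fps k * sgn_fps l" by (simp add: sgn_fps_def)
lemma expand3_sgn_fps: "expand3 (sgn_fps l) = sgn_fps l"
  by (rule fps_ext) (auto simp: sgn_fps_def expand3_nth)

text \<open>\<open>geom e d\<close> stands for \<open>X\<^sup>e / (1 - X\<^sup>d)\<close>, which for \<open>d < 0\<close> means \<open>- X\<^sup>e\<^sup>-\<^sup>d / (1 - X\<^sup>-\<^sup>d)\<close>.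
  The junk value at \<open>d = 0\<close> is \<open>0\<close>.\<close>

definition geom :: "int \<Rightarrow> int \<Rightarrow> complex fps" where
  "geom e d = Abs_fps (\<lambda>N. if d > 0 \<and> e \<le> int N \<and> d dvd int N - e then 1
      else if d < 0 \<and> e - d \<le> int N \<and> d dvd int N - e then - 1 else 0)"

text \<open>The disjunction says that the leading exponent, \<open>e\<close> for positive
  \<open>d\<close> and \<open>e - d\<close> for negative \<open>d\<close>, is nonnegative.\<close>

lemma X_pow_geom:
  assumes "0 \<le> a" "d > 0 \<and> 0 \<le> e \<or> d < 0 \<and> d \<le> e"
  shows "X_pow a * geom e d = geom (a + e) d"
  using assms by (intro fps_ext) (auto simp: X_pow_mult_nth geom_def algebra_simps)

lemma dvd_less_imp_eq_0: "d dvd m \<Longrightarrow> 0 \<le> m \<Longrightarrow> m < \<bar>d\<bar> \<Longrightarrow> m = (0::int)"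
  using zdvd_not_zless[of m "\<bar>d\<bar>"] by force

text \<open>Cancellation of the denominator 1 - X^d; the convention for negative \<open>d\<close> is
  the one that makes it hold for both signs.\<close>

lemma geom_diff:
  assumes "d \<noteq> 0" "0 \<le> e"
  shows "geom e d - geom (e + d) d = X_pow e"
proof (rule fps_ext)
  fix N
  have "d dvd int N - (e + d) \<longleftrightarrow> d dvd int N - e"
    using dvd_diff_right_iff[of d d "int N - e"] dvd_minus_iff[of d "int N - e - d"]
      dvd_diff_commute[of d "int N - e" d] by (simp add: diff_diff_eq)
  moreover have "e \<le> int N \<Longrightarrow> int N < e + \<bar>d\<bar> \<Longrightarrow> d dvd int N - e \<Longrightarrow> int N = e"
    using dvd_less_imp_eq_0[of d "int N - e"] by auto
  ultimately show "fps_nth (geom e d - geom (e + d) d) N = fps_nth (X_pow e) N"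
    using assms by (auto simp: geom_def X_pow_nth)
qed

definition triangular :: "int \<Rightarrow> int" where "triangular l = l * (l - 1) div 2"

lemma triangular_2: "2 * triangular l = l * (l - 1)"
  by (simp add: triangular_def)

lemma triangular_Suc: "triangular (l + 1) = triangular l + l"
  using triangular_2[of l] triangular_2[of "l + 1"] by (simp add: algebra_simps)

lemma triangular_1_minus: "triangular (1 - l) = triangular l"
  using triangular_2[of l] triangular_2[of "1 - l"] by (simp add: algebra_simps)

lemma triangular_minus: "triangular (- l) = triangular l + l"
  using triangular_1_minus[of "l + 1"] triangular_Suc[of l] by simp

lemma triangular_nonneg: "0 \<le> triangular l"
proof -
  have "0 \<le> l * (l - 1)" by (cases "l \<ge> 1") (auto simp: mult_nonpos_nonpos)
  then show ?thesis by (simp add: triangular_def)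
qed

lemma triangular_ge: "\<bar>l\<bar> - 1 \<le> triangular l" "\<bar>l\<bar> - 1 \<le> triangular l + l"
proof -
  have "0 \<le> (\<bar>l\<bar> - 1) * (\<bar>l\<bar> - 2)"
    by (cases "\<bar>l\<bar> \<ge> 2") (auto simp: mult_nonpos_nonpos)
  then show "\<bar>l\<bar> - 1 \<le> triangular l" "\<bar>l\<bar> - 1 \<le> triangular l + l"
    using triangular_2[of l] by (auto simp: algebra_simps abs_if split: if_splits)
qed

definition theta_exp :: "int \<Rightarrow> int \<Rightarrow> int \<Rightarrow> int" where "theta_exp b t l = b * triangular l + t * l"

text \<open>The coefficient of z^l in the theta function with base Q = X^b, that is, the sum of
  (-1)^l Q^(l(l-1)/2) z^l, taken at X^t z.\<close>

definition theta :: "int \<Rightarrow> int \<Rightarrow> int \<Rightarrow> complex fps" where "theta b t l = sgn_fps l * X_pow (theta_exp b t l)"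

text \<open>For t between 0 and b the exponent is the nonnegative combination (b - t) T(l) + t T(-l)
  with T = \<open>triangular\<close>, and both T(l) and T(-l) are at least |l| - 1. This linear
  growth is what makes theta series locally finite.\<close>

lemma theta_exp_ge:
  assumes "1 \<le> b" "0 \<le> t" "t \<le> b"
  shows "\<bar>l\<bar> - 1 \<le> theta_exp b t l" "0 \<le> theta_exp b t l"
proof -
  have *: "theta_exp b t l = (b - t) * triangular l + t * (triangular l + l)" by (simp add: theta_exp_def algebra_simps)
  have "(b - t) * (\<bar>l\<bar> - 1) \<le> (b - t) * triangular l" "t * (\<bar>l\<bar> - 1) \<le> t * (triangular l + l)"
    using triangular_ge[of l] assms by (auto intro!: mult_left_mono)
  then have "b * (\<bar>l\<bar> - 1) \<le> theta_exp b t l" unfolding * by (simp add: algebra_simps)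
  moreover have "l \<noteq> 0 \<Longrightarrow> \<bar>l\<bar> - 1 \<le> b * (\<bar>l\<bar> - 1)"
    using mult_right_mono[of 1 b "\<bar>l\<bar> - 1"] assms by auto
  moreover have "l = 0 \<Longrightarrow> theta_exp b t l = 0" by (simp add: theta_exp_def triangular_def)
  ultimately show "\<bar>l\<bar> - 1 \<le> theta_exp b t l" by (cases "l = 0") auto
  show "0 \<le> theta_exp b t l"
  proof (cases "l = 0")
    case True then show ?thesis by (simp add: theta_exp_def triangular_def)
  next
    case False with \<open>\<bar>l\<bar> - 1 \<le> theta_exp b t l\<close> show ?thesis by linarith
  qed
qed

lemma sgn_fps_nth: "fps_nth (sgn_fps l * f) n = (if even l then 1 else - 1) * fps_nth f n"
  by (simp add: sgn_fps_def)

lemma loc_fin_X_pow: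
  assumes "\<And>l. \<bar>l - a\<bar> - k \<le> g l" "\<And>l. 0 \<le> g l"
  shows "loc_fin (\<lambda>l. c l * X_pow (g l))"
proof (rule loc_fin_mult_left, rule loc_finI)
  show "finite {a - k - int n .. a + k + int n}" for n by simp
  show "l \<in> {a - k - int n .. a + k + int n}" if "fps_nth (X_pow (g l)) n \<noteq> 0" for l n
    using that assms(1)[of l] assms(2)[of l] by (auto simp: X_pow_nth split: if_splits)
qed

lemma loc_fin_theta:
  assumes "1 \<le> b" "0 \<le> t" "t \<le> b" shows "loc_fin (theta b t)"
  unfolding theta_def by (rule loc_fin_X_pow[of 0 1]) (use theta_exp_ge[OF assms] in auto)

lemma fsum_antisym:
  assumes "bij g" "\<And>i. f (g i) = - f i" shows "fsum f = 0"
  using fsum_reindex[OF assms(1), of f] assms(2) by (simp add: fsum_uminus)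

lemma bij_refl: "bij (\<lambda>l::int. c - l)"
  by (rule bij_betw_byWitness[where f' = "\<lambda>l. c - l"]) auto

lemma bij_shift: "bij (\<lambda>l::int. l + c)"
  by (rule bij_betw_byWitness[where f' = "\<lambda>l. l - c"]) auto

lemma bij_neg: "bij (\<lambda>l::int. - l)"
  by (rule bij_betw_byWitness[where f' = "\<lambda>l. - l"]) auto

definition geom0 :: "int \<Rightarrow> int \<Rightarrow> int \<Rightarrow> complex fps" where "geom0 b c n = geom 0 (b * n + c)"

lemma loc_fin_geom0_theta: "1 \<le> b \<Longrightarrow> loc_fin (\<lambda>n. geom0 b c n * theta b 0 (m - n))"
  by (rule loc_fin_mult_left, rule loc_fin_reindex[OF bij_is_inj[OF bij_refl], of "theta b 0"], rule loc_fin_theta) auto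

text \<open>The left factor is \<open>\<Sum>n. z\<^sup>n / (1 - w Q\<^sup>n)\<close> with \<open>Q = X\<^sup>b\<close>, \<open>w = X\<^sup>c\<close>, and the recurrence is its
  functional equation under \<open>z \<mapsto> Q z\<close> after multiplication by a theta function. The exponents
  \<open>A\<close> and \<open>B\<close> serve to clear negative powers of \<open>X\<close>.\<close>

lemma convolve_geom0_theta_rec:
  assumes b: "1 \<le> b" and AB: "0 \<le> A" "0 \<le> B" "A - B = b * m + c"
  shows "X_pow B * convolve (geom0 b c) (theta b 0) (m + 1) + X_pow A * convolve (geom0 b c) (theta b 0) m =
     fsum (\<lambda>n. if b * n + c = 0 then sgn_fps (m - n) * X_pow (B + b * triangular (m - n + 1)) else 0)"
proof -
  let ?t = "\<lambda>l. sgn_fps l * X_pow (B + b * triangular (l + 1))"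
  have ge: "0 \<le> B + b * triangular l" for l using AB b triangular_nonneg[of l] by simp
  \<comment> \<open>The two kernel terms with the same denominator differ by the factor X^(b n + c),
    so \<open>geom_diff\<close> cancels the denominator and leaves a monomial. If b n + c = 0, both
    terms are \<open>0\<close> by the junk value of \<open>geom\<close>, and the monomial must be
    compensated.\<close>
  have tm: "X_pow B * (geom0 b c n * theta b 0 (m + 1 - n)) + X_pow A * (geom0 b c n * theta b 0 (m - n)) =
      (if b * n + c = 0 then ?t (m - n) else 0) - ?t (m - n)" for n
  proof (cases "b * n + c = 0")
    case True
    then have "geom0 b c n = 0" by (simp add: geom0_def geom_def fps_eq_iff)
    with True show ?thesis by simp
  next
    case False
    let ?d = "b * n + c" and ?l = "m - n"
    have t0: "0 \<le> b * triangular l" for l using b triangular_nonneg[of l] by simp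
    have 1: "X_pow B * (geom0 b c n * theta b 0 (m + 1 - n)) = - sgn_fps ?l * (X_pow B * (X_pow (b * triangular (?l + 1)) * geom0 b c n))"
      using sgn_fps_Suc[of ?l] by (simp add: theta_def theta_exp_def algebra_simps)
    have 2: "X_pow A * (geom0 b c n * theta b 0 (m - n)) = sgn_fps ?l * (X_pow A * (X_pow (b * triangular ?l) * geom0 b c n))"
      by (simp add: theta_def theta_exp_def algebra_simps)
    have sh: "X_pow a * (X_pow (b * triangular l) * geom0 b c n) = geom (a + b * triangular l) ?d" if "0 \<le> a" for a l
    proof -
      have v: "?d > 0 \<and> 0 \<le> e \<or> ?d < 0 \<and> ?d \<le> e" if "0 \<le> e" for e using False that by auto
      have "X_pow (b * triangular l) * geom0 b c n = geom (b * triangular l) ?d"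
        using X_pow_geom[OF t0[of l] v[of 0]] by (simp add: geom0_def)
      then show ?thesis using X_pow_geom[OF that v[OF t0[of l]]] by simp
    qed
    have e: "A + b * triangular ?l = B + b * triangular (?l + 1) + ?d"
      unfolding triangular_Suc using AB(3) by (simp add: algebra_simps)
    show ?thesis
      unfolding 1 2 sh[OF AB(1)] sh[OF AB(2)] e using geom_diff[OF False ge[of "?l + 1"]] False
      by (simp add: algebra_simps)
  qed
  have lf: "loc_fin ?t"
  proof (rule loc_fin_X_pow[of 0 2])
    fix l :: int
    have "1 * triangular (l + 1) \<le> b * triangular (l + 1)"
      using b triangular_nonneg by (intro mult_right_mono)
    then show "\<bar>l - 0\<bar> - 2 \<le> B + b * triangular (l + 1)"
      using triangular_ge(1)[of "l + 1"] AB(2) by linarith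
  qed (rule ge)
  then have lf': "loc_fin (\<lambda>n. ?t (m - n))" by (rule loc_fin_reindex[OF bij_is_inj[OF bij_refl]])
  then have lf'': "loc_fin (\<lambda>n. if b * n + c = 0 then ?t (m - n) else 0)"
    by (auto simp: loc_fin_def elim!: rev_finite_subset)
  have "fsum (\<lambda>n. ?t (m - n)) = fsum ?t" by (rule fsum_reindex[OF bij_refl])
  \<comment> \<open>The reflection l -> -1 - l preserves \<open>triangular (l + 1)\<close> and
    changes the parity of l: this is the vanishing of the theta function at z = 1.\<close>
  also have "\<dots> = 0"
    by (rule fsum_antisym[OF bij_refl[of "-1"]])
      (simp add: sgn_fps_def triangular_minus triangular_Suc)
  finally have z: "fsum (\<lambda>n. ?t (m - n)) = 0" .
  have "X_pow B * convolve (geom0 b c) (theta b 0) (m + 1) + X_pow A * convolve (geom0 b c) (theta b 0) m =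
     fsum (\<lambda>n. X_pow B * (geom0 b c n * theta b 0 (m + 1 - n)) + X_pow A * (geom0 b c n * theta b 0 (m - n)))"
    using b by (simp add: convolve_def fsum_add fsum_mult_left loc_fin_geom0_theta loc_fin_mult_left)
  also have "\<dots> = fsum (\<lambda>n. if b * n + c = 0 then ?t (m - n) else 0)"
    unfolding tm using fsum_diff[OF lf'' lf'] z by simp
  finally show ?thesis .
qed

text \<open>The recurrence is solved upward from 0 with \<open>B = 0\<close> and downward with
  \<open>A = 0\<close>; the bounds on \<open>c\<close> give b m + c the right sign in each
  direction. Thus \<open>G 0\<close> is the only free parameter.\<close>

lemma theta_rec_unique:
  assumes b: "1 \<le> b" "0 \<le> c" "c \<le> b"
    and rec: "\<And>m A B. 0 \<le> A \<Longrightarrow> 0 \<le> B \<Longrightarrow> A - B = b * m + c \<Longrightarrow> X_pow B * G (m + 1) + X_pow A * G m = 0"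
  shows "G m = G 0 * theta b c m"
proof (induction m rule: int_induct[where k = 0])
  case base
  then show ?case by (simp add: theta_def sgn_fps_def theta_exp_def triangular_def)
next
  case (step1 m)
  have "G (m + 1) = - X_pow (b * m + c) * G m"
    using rec[of "b * m + c" 0 m] step1(1) b by (simp add: add_eq_0_iff)
  also have "\<dots> = G 0 * (- sgn_fps m * (X_pow (b * m + c) * X_pow (theta_exp b c m)))"
    by (simp add: step1(2) theta_def)
  also have "\<dots> = G 0 * theta b c (m + 1)"
  proof -
    have "b * m + c + theta_exp b c m = theta_exp b c (m + 1)"
      unfolding theta_exp_def triangular_Suc by (simp add: algebra_simps)
    then show ?thesis using step1(1) b theta_exp_ge(2)[OF b, of m] by (simp add: X_pow_add theta_def sgn_fps_Suc)
  qed
  finally show ?case .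
next
  case (step2 m)
  define n where "n = m - 1"
  have "b * n + c \<le> 0" using step2(1) b mult_left_mono[of n "-1" b] unfolding n_def by linarith
  then have "G n = - X_pow (- (b * n + c)) * G (n + 1)"
    using rec[of 0 "- (b * n + c)" n] by (simp add: add_eq_0_iff)
  also have "\<dots> = G 0 * (sgn_fps n * (X_pow (- (b * n + c)) * X_pow (theta_exp b c (n + 1))))"
    using step2(2) sgn_fps_Suc[of n] by (simp add: theta_def n_def)
  also have "\<dots> = G 0 * theta b c n"
  proof -
    have "- (b * n + c) + theta_exp b c (n + 1) = theta_exp b c n"
      unfolding theta_exp_def triangular_Suc by (simp add: algebra_simps)
    then show ?thesis using \<open>b * n + c \<le> 0\<close> theta_exp_ge(2)[OF b, of "n + 1"] by (simp add: X_pow_add theta_def)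
  qed
  finally show ?case by (simp add: n_def)
qed

section \<open>Moments of theta series and of Lambert kernels\<close>

lemma moment_add_weight:
  assumes "loc_fin f" shows "moment (\<lambda>n. u n + v n) f = moment u f + moment v f"
  unfolding moment_def fps_const_add[symmetric] distrib_right
  by (intro fsum_add loc_fin_mult_left assms)

lemma moment_cmult_weight:
  assumes "loc_fin f" shows "moment (\<lambda>n. c * u n) f = fps_const c * moment u f"
  unfolding moment_def using fsum_mult_left[OF loc_fin_mult_left[OF assms], of "fps_const c" "\<lambda>n. fps_const (u n)"]
  by (simp add: mult.assoc[symmetric] fps_const_mult[symmetric] del: fps_const_mult)

lemma moment_cmult:
  assumes "loc_fin f" shows "moment u (\<lambda>n. c * f n) = c * moment u f"
  unfolding moment_def using fsum_mult_left[OF loc_fin_mult_left[OF assms], of c "\<lambda>n. fps_const (u n)"]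
  by (simp add: mult_ac)

lemma moment_reindex:
  assumes "bij g" shows "moment (\<lambda>n. u (g n)) (\<lambda>n. f (g n)) = moment u f"
  unfolding moment_def by (rule fsum_reindex[OF assms])

lemma moment_add: "loc_fin f \<Longrightarrow> loc_fin g \<Longrightarrow> moment u (\<lambda>n. f n + g n) = moment u f + moment u g"
  unfolding moment_def distrib_left by (intro fsum_add loc_fin_mult_left)

lemma moment_uminus: "moment u (\<lambda>n. - f n) = - moment u f"
  unfolding moment_def by (simp add: fsum_uminus)

lemma moment_diff: "loc_fin f \<Longrightarrow> loc_fin g \<Longrightarrow> moment u (\<lambda>n. f n - g n) = moment u f - moment u g"
  unfolding moment_def right_diff_distrib by (intro fsum_diff loc_fin_mult_left)

text \<open>Summation by parts; taking differences of coefficients is multiplication by 1 -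
  z.\<close>

lemma moment_difference:
  assumes "loc_fin f" shows "moment w (\<lambda>m. f m - f (m - 1)) = moment (\<lambda>n. w n - w (n + 1)) f"
proof -
  have lf: "loc_fin (\<lambda>m. f (m - 1))"
    using loc_fin_reindex[OF bij_is_inj[OF bij_shift[of "-1"]] assms] by simp
  have "moment w (\<lambda>m. f (m - 1)) = moment (\<lambda>n. w (n + 1)) f"
    using moment_reindex[OF bij_shift[of "-1"], of "\<lambda>n. w (n + 1)" f] by simp
  then have "moment w (\<lambda>m. f m - f (m - 1)) = moment w f - moment (\<lambda>n. w (n + 1)) f"
    by (simp add: moment_diff[OF assms lf])
  also have "\<dots> = moment (\<lambda>n. w n - w (n + 1)) f"
    using moment_add_weight[OF assms, of w "\<lambda>n. - w (n+1)"] moment_cmult_weight[OF assms, of "-1" "\<lambda>n. w (n+1)"]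
    by (simp add: fps_const_neg[symmetric] del: fps_const_neg)
  finally show ?thesis .
qed


text \<open>The reflection l -> 1 - l fixes the exponents and flips the signs, so the theta function
  vanishes at z = 1.\<close>

lemma moment_theta_zero:
  assumes "1 \<le> b" shows "moment (\<lambda>_. 1) (theta b 0) = 0"
  unfolding moment_def by (rule fsum_antisym[OF bij_refl[of 1]])
    (simp add: theta_def theta_exp_def triangular_1_minus sgn_fps_diff, simp add: sgn_fps_def)

lemma const_of_int: "fps_const (of_int k :: complex) = of_int k"
  by (rule fps_ext) (simp add: fps_of_int)

text \<open>Pairing l with 1 - l turns this into the sum over n \<ge> 0 of (-1)^n (2n+1)
  X^(n(n+1)/2), the series in Jacobi's identity for E^3.\<close>

definition jacobi_sum :: "complex fps" where "jacobi_sum = - moment of_int (theta 1 0)"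

lemma expand3_theta: "1 \<le> b \<Longrightarrow> 0 \<le> t \<Longrightarrow> t \<le> b \<Longrightarrow> expand3 (theta b t l) = theta (3 * b) (3 * t) l"
  using theta_exp_ge(2)[of b t l] by (simp add: theta_def expand3_mult expand3_sgn_fps expand3_X_pow) (simp add: theta_exp_def algebra_simps)

lemma expand3_const: "expand3 (fps_const c) = fps_const c"
  by (rule fps_ext) (auto simp: expand3_nth)

lemma expand3_moment: "expand3 (moment w f) = moment w (\<lambda>n. expand3 (f n))"
  by (simp add: moment_def fsum_expand3[symmetric] expand3_mult expand3_const)

lemma expand3_uminus: "expand3 (- f) = - expand3 f"
  by (rule fps_ext) (auto simp: expand3_nth)

lemma moment_id_th30: "moment of_int (theta 3 0) = - expand3 jacobi_sum"
  using expand3_theta[of 1 0] by (simp add: jacobi_sum_def expand3_moment expand3_uminus)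

text \<open>The exponents are the generalized pentagonal numbers l(3l+1)/2. Starting from the series
  makes E the value of a theta function; the product form is recovered in
  \<open>euler_fps_nth_eprod\<close>.\<close>

definition euler_fps :: "complex fps" where "euler_fps = moment (\<lambda>_. 1) (theta 3 2)"

lemma theta_minus: "theta b t (- l) = theta b (b - t) l"
  by (simp add: theta_def theta_exp_def sgn_fps_minus triangular_minus algebra_simps)

lemma moment_th31: "moment (\<lambda>n. u n) (theta 3 1) = moment (\<lambda>n. u (- n)) (theta 3 2)"
  using moment_reindex[OF bij_neg, of u "theta 3 1"] theta_minus[of 3 1] by simp

text \<open>Quasi-periodicity: replacing z by X^b z amounts to an index shift and a sign.\<close>

lemma theta_full: "theta b b l = - theta b 0 (l + 1)"
  unfolding theta_def theta_exp_def triangular_Suc sgn_fps_Suc by (simp add: algebra_simps)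

lemma moment_th33: "moment u (theta 3 3) = - moment (\<lambda>n. u (n - 1)) (theta 3 0)"
  using moment_reindex[OF bij_shift[of 1], of "\<lambda>n. u (n - 1)" "theta 3 0"]
  by (simp add: theta_full[of 3, abs_def] moment_uminus)

lemma moment_const_weight: "loc_fin f \<Longrightarrow> moment (\<lambda>_. c) f = fps_const c * moment (\<lambda>_. 1) f"
  using moment_cmult_weight[of f c "\<lambda>_. 1"] by simp

lemma moment_id_th33: "moment of_int (theta 3 3) = expand3 jacobi_sum"
proof -
  have lf: "loc_fin (theta 3 0)" by (simp add: loc_fin_theta)
  have "moment (\<lambda>n. of_int (n - 1)) (theta 3 0) = moment of_int (theta 3 0) + moment (\<lambda>n. -1) (theta 3 0)"
    using moment_add_weight[OF lf, of of_int "\<lambda>_. -1"] by simp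
  then show ?thesis
    by (simp add: moment_th33 moment_const_weight[OF lf, of "-1"] moment_theta_zero moment_id_th30)
qed

lemma moment_th33_zero: "moment (\<lambda>_. 1) (theta 3 3) = 0"
  by (simp add: moment_th33 moment_theta_zero)

text \<open>With the constant terms removed, the term with denominator index d = b n + c is sgn(d)
  X^|d| / (1 - X^|d|). Such a family is locally finite and has moments.\<close>

definition geom0' :: "int \<Rightarrow> int \<Rightarrow> int \<Rightarrow> complex fps" where
  "geom0' b c n = geom0 b c n - (if b * n + c > 0 then 1 else 0)"

lemma geom0'_nth: "fps_nth (geom0' b c n) N =
  (if 0 < N \<and> b * n + c dvd int N then of_int (sgn (b * n + c)) else 0)"
proof -
  have "0 < N \<Longrightarrow> b * n + c dvd int N \<Longrightarrow> - (b * n + c) \<le> int N"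
    using dvd_imp_le_int[of "int N" "b * n + c"] by linarith
  then show ?thesis by (auto simp: geom0'_def geom0_def geom_def sgn_if)
qed

lemma loc_fin_geom0': "1 \<le> b \<Longrightarrow> loc_fin (geom0' b c)"
proof (rule loc_finI)
  fix N n assume b: "1 \<le> b" and nz: "fps_nth (geom0' b c n) N \<noteq> 0"
  from nz have "0 < N" "b * n + c dvd int N" by (auto simp: geom0'_nth split: if_splits)
  then have "\<bar>b * n + c\<bar> \<le> int N" using dvd_imp_le_int[of "int N" "b * n + c"] by simp
  moreover have "\<bar>n\<bar> \<le> \<bar>b * n\<bar>" using b by (simp add: abs_mult mult_le_cancel_right1)
  ultimately show "n \<in> {- (int N + \<bar>c\<bar>) .. int N + \<bar>c\<bar>}" by auto
qed simp

text \<open>All \<open>geom0 b c n\<close> with large \<open>n\<close> have constant term \<open>1\<close>, so they have no moments; their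
  differences do, which amounts to multiplying by \<open>1 - z\<close>.\<close>

definition geom_step :: "int \<Rightarrow> int \<Rightarrow> int \<Rightarrow> complex fps" where
  "geom_step b c n = geom0 b c n - geom0 b c (n - 1)"

text \<open>The constant terms of \<open>geom0\<close> jump from 0 to 1 at \<open>n0\<close>, so
  their difference is a single 1, the residue of the kernel at z = 1. The remaining part is summed
  by parts.\<close>

lemma geom_step_split:
  assumes b: "1 \<le> b" and n0: "\<And>n. b * n + c > 0 \<longleftrightarrow> n0 \<le> n"
  shows "loc_fin (geom_step b c)"
    and "moment w (geom_step b c) = fps_const (w n0) + moment (\<lambda>n. w n - w (n + 1)) (geom0' b c)"
proof -
  let ?p = "\<lambda>n. if n = n0 then 1 else 0 :: complex fps"
  have lfp: "loc_fin ?p"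
    by (rule loc_finI[of "\<lambda>_. {n0}"]) (auto split: if_splits)
  have lfs: "loc_fin (\<lambda>n. geom0' b c (n - 1))"
    using loc_fin_reindex[OF bij_is_inj[OF bij_shift[of "-1"]] loc_fin_geom0'[OF b]] by simp
  have eq: "geom_step b c = (\<lambda>n. ?p n + (geom0' b c n - geom0' b c (n - 1)))"
    using n0 by (auto simp: geom_step_def geom0'_def fun_eq_iff)
  show "loc_fin (geom_step b c)"
    unfolding eq by (intro loc_fin_add lfp loc_fin_diff loc_fin_geom0' b lfs)
  have "moment w ?p = fps_const (w n0)"
  proof (rule fps_ext)
    fix N show "fps_nth (moment w ?p) N = fps_nth (fps_const (w n0)) N"
      unfolding moment_def by (subst fsum_nth[of "{n0}"]) (auto split: if_splits)
  qed
  then show "moment w (geom_step b c) = fps_const (w n0) + moment (\<lambda>n. w n - w (n + 1)) (geom0' b c)"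
    unfolding eq using moment_difference[OF loc_fin_geom0'[OF b], of w]
    by (subst moment_add[OF lfp loc_fin_diff[OF loc_fin_geom0'[OF b] lfs]]) simp
qed

lemma convolve_geom_step:
  assumes b: "1 \<le> b"
  shows "convolve (geom_step b c) (theta b 0) m = convolve (geom0 b c) (theta b 0) m - convolve (geom0 b c) (theta b 0) (m - 1)"
proof -
  let ?f = "\<lambda>n. geom0 b c n * theta b 0 (m - 1 - n)"
  have lf: "loc_fin (\<lambda>n. ?f (n - 1))"
    using loc_fin_reindex[OF bij_is_inj[OF bij_shift[of "-1"]] loc_fin_geom0_theta[OF b, of c "m - 1"]] by simp
  have "convolve (geom0 b c) (theta b 0) (m - 1) = fsum (\<lambda>n. ?f (n - 1))"
    using fsum_reindex[OF bij_shift[of "-1"], of ?f] by (simp add: convolve_def)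
  then show ?thesis
    using fsum_diff[OF loc_fin_geom0_theta[OF b, of c m] lf]
    by (simp add: convolve_def geom_step_def left_diff_distrib)
qed

section \<open>Jacobi's series\<close>

abbreviation power_moment :: "nat \<Rightarrow> (int \<Rightarrow> complex fps) \<Rightarrow> complex fps" where
  "power_moment i \<equiv> moment (\<lambda>n. of_int n ^ i)"

lemma moment_poly3:
  assumes lf: "loc_fin f"
    and w: "\<And>n. w n = c3 * of_int n ^ 3 + c2 * of_int n ^ 2 + c1 * of_int n + c0"
  shows "moment w f = fps_const c3 * power_moment 3 f + fps_const c2 * power_moment 2 f + fps_const c1 * moment of_int f
    + fps_const c0 * moment (\<lambda>_. 1) f"
proof -
  have "w = (\<lambda>n. ((c3 * of_int n ^ 3 + c2 * of_int n ^ 2) + c1 * of_int n) + c0 * 1)"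
    using w by auto
  then have "moment w f = moment (\<lambda>n. ((c3 * of_int n ^ 3 + c2 * of_int n ^ 2) + c1 * of_int n) + c0 * 1) f"
    by simp
  also have "\<dots> = moment (\<lambda>n. c3 * of_int n ^ 3) f + moment (\<lambda>n. c2 * of_int n ^ 2) f
     + moment (\<lambda>n. c1 * of_int n) f + moment (\<lambda>n. c0 * 1) f"
    by (simp only: moment_add_weight[OF lf])
  finally show ?thesis by (simp only: moment_cmult_weight[OF lf])
qed

lemma moment_convolve_binomial:
  assumes f: "loc_fin f" and g: "loc_fin g" and w: "\<And>n l. w (n + l) = a n + c l"
  shows "moment (\<lambda>n. w n ^ i) (convolve f g) =
    (\<Sum>k\<le>i. of_nat (i choose k) * (moment (\<lambda>n. a n ^ k) f * moment (\<lambda>n. c n ^ (i - k)) g))"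
proof -
  have "moment (\<lambda>n. w n ^ i) (convolve f g) =
    (\<Sum>k\<le>i. moment (\<lambda>n. of_nat (i choose k) * a n ^ k) f * moment (\<lambda>n. c n ^ (i - k)) g)"
    by (rule moment_convolve[OF f g]) (simp_all add: w binomial_ring)
  then show ?thesis
    by (simp add: moment_cmult_weight[OF f] fps_of_nat mult.assoc)
qed

lemma sum_atMost_2: "(\<Sum>k\<le>2::nat. f k) = f 0 + f 1 + (f 2 :: 'a::comm_monoid_add)"
  by (simp add: numeral_2_eq_2)

lemma sum_atMost_3: "(\<Sum>k\<le>3::nat. f k) = f 0 + f 1 + f 2 + (f 3 :: 'a::comm_monoid_add)"
  by (simp add: numeral_2_eq_2 numeral_3_eq_3)

lemma fps_const_lits: "fps_const (- c) = - fps_const (c :: complex)" "fps_const (numeral k :: complex) = numeral k"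
  by (simp_all add: numeral_fps_const)

lemma choose_3_2: "3 choose 2 = 3" by (simp add: numeral_2_eq_2 numeral_3_eq_3)

lemma qderiv_uminus: "qderiv (- f) = - qderiv f"
  by (simp add: qderiv_def)

lemma qderiv_const_mult: "qderiv (fps_const c * f) = fps_const c * qderiv f"
  by (simp add: qderiv_def)

lemma qderiv_moment_theta:
  assumes "1 \<le> b" "0 \<le> t" "t \<le> b"
  shows "qderiv (moment w (theta b t)) = moment (\<lambda>n. w n * of_int (theta_exp b t n)) (theta b t)"
proof -
  have "qderiv (sgn_fps n * f) = sgn_fps n * qderiv f" for n f by (simp add: sgn_fps_def qderiv_def)
  then have "qderiv (theta b t n) = fps_const (of_int (theta_exp b t n)) * theta b t n" for n
    using theta_exp_ge(2)[OF assms, of n] by (simp add: theta_def qderiv_X_pow)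
  then show ?thesis
    using qderiv_fsum[OF loc_fin_mult_left[OF loc_fin_theta[OF assms]], of "\<lambda>n. fps_const (w n)"]
    by (simp add: moment_def qderiv_const_mult mult.assoc[symmetric])
qed

definition sigma_fps :: "complex fps" where "sigma_fps = Abs_fps (\<lambda>n. of_nat (divisor_sigma 1 n))"

lemma sum_int_divisors:
  assumes "0 < N"
  shows "(\<Sum>n | n dvd int N. of_int (sgn n) * of_int n :: complex) = 2 * of_nat (divisor_sigma 1 N)"
proof -
  let ?D = "{d. d dvd N}"
  have fin: "finite ?D" using assms by simp
  have eq: "{n. n dvd int N} = int ` ?D \<union> (\<lambda>d. - int d) ` ?D"
  proof (intro equalityI subsetI)
    fix n assume "n \<in> {n. n dvd int N}"
    then have "nat \<bar>n\<bar> dvd N" by (simp add: nat_abs_dvd_iff)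
    moreover have "n = int (nat \<bar>n\<bar>) \<or> n = - int (nat \<bar>n\<bar>)" by auto
    ultimately show "n \<in> int ` ?D \<union> (\<lambda>d. - int d) ` ?D" by blast
  qed auto
  have "(\<Sum>n | n dvd int N. of_int (sgn n) * of_int n :: complex) =
      (\<Sum>n\<in>int ` ?D. of_int (sgn n) * of_int n) + (\<Sum>n\<in>(\<lambda>d. - int d) ` ?D. of_int (sgn n) * of_int n)"
    unfolding eq
  proof (rule sum.union_disjoint)
    have "d \<noteq> 0" if "d dvd N" for d using that assms by auto
    then show "int ` ?D \<inter> (\<lambda>d. - int d) ` ?D = {}" by (auto, force)
  qed (use fin in auto)
  also have "(\<Sum>n\<in>int ` ?D. of_int (sgn n) * of_int n :: complex) = (\<Sum>d\<in>?D. of_nat d)"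
    by (subst sum.reindex) (auto simp: inj_on_def sgn_if intro!: sum.cong)
  also have "(\<Sum>n\<in>(\<lambda>d. - int d) ` ?D. of_int (sgn n) * of_int n :: complex) = (\<Sum>d\<in>?D. of_nat d)"
    by (subst sum.reindex) (auto simp: inj_on_def sgn_if intro!: sum.cong)
  finally show ?thesis by (simp add: divisor_sigma_def)
qed

lemma moment_geom0'_0: "moment (\<lambda>_. 1) (geom0' 1 0) = 0"
  unfolding moment_def
  by (rule fsum_antisym[OF bij_neg]) (auto simp: fps_eq_iff geom0'_nth)

text \<open>The divisors n and -n of N contribute |n| each, hence the factor 2.\<close>

lemma moment_geom0'_1: "moment of_int (geom0' 1 0) = 2 * sigma_fps"
proof (rule fps_ext)
  fix N
  show "fps_nth (moment of_int (geom0' 1 0)) N = fps_nth (2 * sigma_fps) N"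
  proof (cases "N = 0")
    case True
    then show ?thesis
      by (simp add: moment_def fsum_def geom0'_nth sigma_fps_def divisor_sigma_def)
  next
    case False
    have "fps_nth (moment of_int (geom0' 1 0)) N = (\<Sum>n | n dvd int N. of_int n * fps_nth (geom0' 1 0 n) N)"
      unfolding moment_def
    proof (subst fsum_nth[of "{n. n dvd int N}"])
      show "finite {n. n dvd int N}" using False by simp
    qed (auto simp: geom0'_nth split: if_splits)
    also have "\<dots> = (\<Sum>n | n dvd int N. of_int (sgn n) * of_int n)"
      using False by (intro sum.cong) (auto simp: geom0'_nth)
    finally show ?thesis using False sum_int_divisors[of N] by (simp add: sigma_fps_def numeral_fps_const)
  qed
qed

lemma jacobi_sum_0: "fps_nth jacobi_sum 0 = 1"
proof -
  have "fps_nth (moment of_int (theta 1 0)) 0 = (\<Sum>l\<in>{0,1}. fps_nth (fps_const (of_int l) * theta 1 0 l) 0)"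
    unfolding moment_def
  proof (rule fsum_nth)
    fix l assume "fps_nth (fps_const (of_int l) * theta 1 0 l) 0 \<noteq> 0"
    then have "triangular l = 0"
      using triangular_nonneg[of l] by (auto simp: theta_def sgn_fps_nth theta_exp_def X_pow_nth split: if_splits)
    then show "l \<in> {0, 1}" using triangular_2[of l] by auto
  qed simp
  then show ?thesis by (simp add: jacobi_sum_def theta_def sgn_fps_def theta_exp_def triangular_def)
qed

text \<open>For c = 0 the term n = 0 drops out of the kernel, and the recurrence becomes
  inhomogeneous. Minus z d/dz of the theta function is a particular solution, so adding
  \<open>of_int m * theta 1 0 m\<close> restores the homogeneous recurrence.\<close>

lemma convolve_geom0_10:
  obtains g where "convolve (geom0 1 0) (theta 1 0) = (\<lambda>m. g * theta 1 0 m - of_int m * theta 1 0 m)"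
proof
  let ?G = "convolve (geom0 1 0) (theta 1 0)" and ?t = "theta 1 0"
  define G' where "G' = (\<lambda>m. ?G m + of_int m * ?t m)"
  have G': "G' m = G' 0 * ?t m" for m
  proof (rule theta_rec_unique)
    fix m A B :: int assume AB: "0 \<le> A" "0 \<le> B" "A - B = 1 * m + 0"
    have th1: "sgn_fps m * X_pow (B + triangular (m + 1)) = - X_pow B * ?t (m + 1)"
      using AB(2) triangular_nonneg by (simp add: theta_def theta_exp_def sgn_fps_Suc X_pow_add[symmetric])
    have th2: "X_pow A * ?t m = - X_pow B * ?t (m + 1)"
    proof -
      have "A + triangular m = B + triangular (m + 1)" unfolding triangular_Suc using AB(3) by simp
      then show ?thesis using AB triangular_nonneg by (simp add: theta_def theta_exp_def sgn_fps_Suc X_pow_add)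
    qed
    have "fsum (\<lambda>n. if 1 * n + 0 = 0 then sgn_fps (m - n) * X_pow (B + 1 * triangular (m - n + 1)) else 0)
        = sgn_fps m * X_pow (B + triangular (m + 1))"
      by (rule fps_ext, subst fsum_nth[of "{0}"]) (auto split: if_splits)
    with convolve_geom0_theta_rec[of 1 A B m 0] AB
    have rec: "X_pow B * ?G (m + 1) + X_pow A * ?G m = - X_pow B * ?t (m + 1)"
      by (simp add: th1)
    have "X_pow B * G' (m + 1) + X_pow A * G' m = (X_pow B * ?G (m + 1) + X_pow A * ?G m)
        + of_int (m + 1) * (X_pow B * ?t (m + 1)) + of_int m * (X_pow A * ?t m)"
      unfolding G'_def by (simp only: algebra_simps)
    also have "\<dots> = 0"
      unfolding rec th2 by (simp add: algebra_simps)
    finally show "X_pow B * G' (m + 1) + X_pow A * G' m = 0" .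
  qed auto
  then show "?G = (\<lambda>m. G' 0 * ?t m - of_int m * ?t m)"
  proof (intro ext)
    fix m
    have "?G m = G' m - of_int m * ?t m" by (simp add: G'_def)
    with G'[of m] show "?G m = G' 0 * ?t m - of_int m * ?t m" by metis
  qed
qed

text \<open>The second moment of the differences fixes the constant \<open>g\<close> in the convolution formula, and
  the third one yields the claim through the heat equation for the theta function.\<close>

lemma qderiv_jacobi_sum: "qderiv jacobi_sum = - 3 * sigma_fps * jacobi_sum"
proof -
  define t where "t = theta 1 0"
  define D where "D = convolve (geom_step 1 0) t"
  obtain g where g: "convolve (geom0 1 0) t = (\<lambda>m. g * t m - of_int m * t m)"
    using convolve_geom0_10 unfolding t_def by metis
  have lft: "loc_fin t" by (simp add: t_def loc_fin_theta)
  have lfl: "loc_fin (geom0' 1 0)" by (simp add: loc_fin_geom0')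
  have lfd: "loc_fin (geom_step 1 0)" by (rule geom_step_split(1)[of 1 0 1]) auto
  have lfg: "loc_fin (convolve (geom0 1 0) t)"
    unfolding g by (intro loc_fin_diff loc_fin_mult_left lft)
  have D: "D = (\<lambda>m. convolve (geom0 1 0) t m - convolve (geom0 1 0) t (m - 1))"
    unfolding D_def t_def by (rule ext, rule convolve_geom_step) simp
  have mD: "moment w D = g * moment (\<lambda>n. w n - w (n + 1)) t - moment (\<lambda>n. (w n - w (n + 1)) * of_int n) t" for w
  proof -
    have "moment w D = moment (\<lambda>n. w n - w (n + 1)) (\<lambda>m. g * t m - of_int m * t m)"
      unfolding D moment_difference[OF lfg] unfolding g ..
    also have "\<dots> = g * moment (\<lambda>n. w n - w (n + 1)) t - moment (\<lambda>n. w n - w (n + 1)) (\<lambda>m. of_int m * t m)"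
      by (simp add: moment_diff loc_fin_mult_left lft moment_cmult)
    also have "moment (\<lambda>n. w n - w (n + 1)) (\<lambda>m. of_int m * t m) = moment (\<lambda>n. (w n - w (n + 1)) * of_int n) t"
      unfolding moment_def by (intro arg_cong[of _ _ fsum] ext)
        (simp only: const_of_int[symmetric] fps_const_mult[symmetric] mult.assoc)
    finally show ?thesis .
  qed
  have dm: "moment w (geom_step 1 0) = fps_const (w 1) + moment (\<lambda>n. w n - w (n + 1)) (geom0' 1 0)" for w
    by (rule geom_step_split(2)) auto
  have d0: "moment (\<lambda>_. 1) (geom_step 1 0) = 1" using dm[of "\<lambda>_. 1"] by (simp add: moment_def fsum_def fps_eq_iff)
  have d1: "moment of_int (geom_step 1 0) = 1"
    using dm[of of_int] moment_poly3[OF lfl, of "\<lambda>n. of_int n - of_int (n+1)" 0 0 0 "-1"]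
    by (simp add: moment_geom0'_0)
  have d2: "power_moment 2 (geom_step 1 0) = 1 - 4 * sigma_fps"
  proof -
    have w: "of_int n ^ 2 - of_int (n+1) ^ 2 = 0 * of_int n ^ 3 + 0 * of_int n ^ 2 + (-2) * of_int n + (-1 :: complex)" for n
      by (simp add: power2_eq_square algebra_simps)
    show ?thesis
      unfolding dm moment_poly3[OF lfl w] moment_geom0'_0 moment_geom0'_1
      by (simp add: fps_const_lits del: fps_const_neg)
  qed
  have t0: "moment (\<lambda>_. 1) t = 0" by (simp add: t_def moment_theta_zero)
  define t1 t3 where "t1 = moment of_int t" and "t3 = power_moment 3 t"
  \<comment> \<open>Under l -> 1 - l the theta coefficients change sign while l^2 becomes 1 - 2l +
    l^2; as the zeroth moment vanishes, the second moment equals the first.\<close>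
  have t2: "power_moment 2 t = t1"
  proof -
    have "power_moment 2 t = moment (\<lambda>n. of_int (1 - n) ^ 2) (\<lambda>n. t (1 - n))"
      using moment_reindex[OF bij_refl[of 1], of "\<lambda>n. of_int n ^ 2" t] by simp
    also have "(\<lambda>n. t (1 - n)) = (\<lambda>n. - t n)"
      unfolding t_def theta_def theta_exp_def triangular_1_minus by (auto simp: sgn_fps_diff fun_eq_iff) (auto simp: sgn_fps_def)
    also have "moment (\<lambda>n. of_int (1 - n) ^ 2) (\<lambda>n. - t n) = - (power_moment 2 t - 2 * t1)"
    proof -
      have w: "of_int (1 - n) ^ 2 = 0 * of_int n ^ 3 + 1 * of_int n ^ 2 + (-2) * of_int n + (1 :: complex)" for n
        by (simp add: power2_eq_square algebra_simps)
      show ?thesis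
        unfolding moment_uminus moment_poly3[OF lft w] t0 t1_def
        by (simp add: fps_const_lits del: fps_const_neg)
    qed
    finally have "2 * power_moment 2 t = 2 * t1" by (simp add: algebra_simps)
    then show ?thesis by simp
  qed
  have t1nz: "t1 \<noteq> 0" using jacobi_sum_0 by (auto simp: t1_def t_def jacobi_sum_def)
  \<comment> \<open>The second moment of \<open>D\<close> is computed twice, by the Leibniz rule and
    from the closed form of the convolution. The results differ by \<open>- 2 * g * t1\<close>, and
    \<open>t1\<close> is nonzero.\<close>
  have "power_moment 2 D = 2 * t1 + t1"
    unfolding D_def using moment_convolve_binomial[OF lfd lft, of of_int of_int of_int 2]
    unfolding sum_atMost_2 by (simp add: t0 d0 d1 t2 t1_def[symmetric])
  moreover have "power_moment 2 D = - 2 * g * t1 + 2 * t1 + t1"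
  proof -
    have w1: "of_int n ^ 2 - of_int (n+1) ^ 2 = 0 * of_int n ^ 3 + 0 * of_int n ^ 2 + (-2) * of_int n + (-1 :: complex)"
     and w2: "(of_int n ^ 2 - of_int (n+1) ^ 2) * of_int n = 0 * of_int n ^ 3 + (-2) * of_int n ^ 2 + (-1) * of_int n + (0 :: complex)" for n
      by (simp_all add: power2_eq_square algebra_simps)
    show ?thesis
      unfolding mD moment_poly3[OF lft w1] moment_poly3[OF lft w2] t2 t0 t1_def[symmetric]
      by (simp add: fps_const_lits del: fps_const_neg)
  qed
  ultimately have "g = 0" using t1nz by simp
  have "power_moment 3 D = 3 * (1 - 4 * sigma_fps) * t1 + 3 * t1 + t3"
    unfolding D_def using moment_convolve_binomial[OF lfd lft, of of_int of_int of_int 3]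
    unfolding sum_atMost_3 by (simp add: choose_3_2 t0 d0 d1 d2 t2 t1_def[symmetric] t3_def[symmetric])
  moreover have "power_moment 3 D = 3 * t3 + 3 * t1 + t1"
  proof -
    have w: "(of_int n ^ 3 - of_int (n+1) ^ 3) * of_int n = (-3) * of_int n ^ 3 + (-3) * of_int n ^ 2 + (-1) * of_int n + (0 :: complex)" for n
      by (simp add: power2_eq_square power3_eq_cube algebra_simps)
    show ?thesis
      unfolding mD moment_poly3[OF lft w] t2 t0 t1_def[symmetric] t3_def[symmetric] \<open>g = 0\<close>
      by (simp add: fps_const_lits del: fps_const_neg)
  qed
  ultimately have *: "2 * t3 = 2 * t1 - 12 * sigma_fps * t1"
    by (simp add: algebra_simps)
  have w: "of_int n * of_int (triangular n) = (1/2) * of_int n ^ 3 + (-1/2) * of_int n ^ 2 + 0 * of_int n + (0::complex)" for n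
  proof -
    have "2 * of_int (triangular n) = (of_int n * (of_int n - 1) :: complex)"
      using arg_cong[OF triangular_2[of n], of "of_int :: int \<Rightarrow> complex"] by simp
    then have tn: "of_int (triangular n) = (of_int n * (of_int n - 1) / 2 :: complex)"
      by (simp add: field_simps)
    show ?thesis unfolding tn by (simp add: power2_eq_square power3_eq_cube diff_divide_distrib algebra_simps)
  qed
  have "qderiv t1 = moment (\<lambda>n. of_int n * of_int (triangular n)) t"
    unfolding t1_def t_def by (subst qderiv_moment_theta) (simp_all add: theta_exp_def)
  also have "\<dots> = fps_const (1/2) * t3 + fps_const (-1/2) * t1"
    using moment_poly3[OF lft w] by (simp add: t2 t3_def)
  also have "\<dots> = fps_const (1/2) * (t3 - t1)"
    by (simp add: algebra_simps fps_const_neg[symmetric] del: fps_const_neg)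
  finally have q: "qderiv t1 = fps_const (1/2) * (t3 - t1)" .
  have "2 * qderiv t1 = t3 - t1"
    unfolding q mult.assoc[symmetric] by (simp add: numeral_fps_const)
  then have "2 * (2 * qderiv t1) = 2 * t3 - 2 * t1" by (simp only: right_diff_distrib)
  then have "4 * qderiv t1 = 2 * t3 - 2 * t1" by (simp only: mult.assoc[symmetric]) simp
  also have "\<dots> = 4 * (- 3 * sigma_fps * t1)" unfolding * by simp
  finally have "4 * qderiv t1 = 4 * (- 3 * sigma_fps * t1)" .
  then have "qderiv t1 = - 3 * sigma_fps * t1" unfolding mult_cancel_left by simp
  moreover have J: "jacobi_sum = - t1" by (simp add: jacobi_sum_def t1_def t_def)
  ultimately show ?thesis unfolding J qderiv_uminus by simp
qed

section \<open>The pentagonal number theorem\<close>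

text \<open>The summand in Shanks's finite form of the pentagonal number theorem.\<close>

definition shanks :: "'a::comm_ring_1 \<Rightarrow> nat \<Rightarrow> nat \<Rightarrow> 'a" where
  "shanks q n k = (-1) ^ k * (\<Prod>i=k+1..n. 1 - q ^ i) * q ^ (n * k + \<Sum>{..k})"

text \<open>\<open>U\<close> is a telescoping certificate for the passage from n to n + 1. Setting
  it to 0 at k = 0 agrees with the general formula, whose factor 1 - q^0 vanishes there.\<close>

lemma shanks_step:
  fixes q :: "'a::comm_ring_1"
  assumes "k \<le> n"
  defines "U \<equiv> \<lambda>k. (if k = 0 then 0 else (-1) ^ k * (\<Prod>i=k..n. 1 - q ^ i) * q ^ (n * k + \<Sum>{..k}))"
  shows "shanks q (Suc n) k - shanks q n k = U (Suc k) - U k"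
proof -
  define p where "p = (\<Prod>i=k+1..n. 1 - q ^ i)"
  define r where "r = q ^ (n * k + \<Sum>{..k})"
  have p1: "(\<Prod>i=k+1..Suc n. 1 - q ^ i) = p * (1 - q ^ Suc n)"
    using assms(1) by (simp add: p_def)
  have p0: "(\<Prod>i=k..n. 1 - q ^ i) = (1 - q ^ k) * p"
    using assms(1) by (simp add: p_def prod.atLeast_Suc_atMost)
  have e1: "q ^ (Suc n * k + \<Sum>{..k}) = r * q ^ k" by (simp add: r_def power_add)
  have e2: "q ^ (n * Suc k + \<Sum>{..Suc k}) = r * q ^ k * q ^ Suc n"
    by (simp add: r_def power_add)
  have U: "U k = (-1) ^ k * ((1 - q ^ k) * p) * r"
    by (cases "k = 0") (simp_all add: U_def p0 r_def)
  have U': "U (Suc k) = - ((-1) ^ k * p * (r * q ^ k * q ^ Suc n))"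
    using e2 by (simp add: U_def p_def)
  show ?thesis
    unfolding shanks_def p1 U U' e1 p_def[symmetric] r_def[symmetric] by (simp add: algebra_simps)
qed

definition euler_fps_partial :: "'a::comm_ring_1 \<Rightarrow> nat \<Rightarrow> 'a" where
  "euler_fps_partial q n = (\<Sum>k\<in>{- int n..int n}. (if even k then 1 else -1) * q ^ nat (theta_exp 3 2 k))"

lemma theta_exp_pos: "theta_exp 3 2 (int (Suc n)) = int ((Suc n) * (Suc n) + \<Sum>{..Suc n})"
  and theta_exp_neg: "theta_exp 3 2 (- int (Suc n)) = int (n * Suc n + \<Sum>{..Suc n})"
proof -
  have g: "2 * int (\<Sum>{..k}) = int k * (int k + 1)" for k
    by (induction k) (auto simp: algebra_simps)
  show "theta_exp 3 2 (int (Suc n)) = int ((Suc n) * (Suc n) + \<Sum>{..Suc n})"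
    using g[of "Suc n"] triangular_2[of "int (Suc n)"] unfolding theta_exp_def of_nat_add of_nat_mult
    by (simp add: algebra_simps)
  show "theta_exp 3 2 (- int (Suc n)) = int (n * Suc n + \<Sum>{..Suc n})"
    using g[of "Suc n"] triangular_2[of "- int (Suc n)"] unfolding theta_exp_def of_nat_add of_nat_mult
    by (simp add: algebra_simps)
qed

text \<open>Passing to n + 1, the telescoped differences leave the pentagonal term of index -(n+1),
  and the new last summand is the one of index n + 1.\<close>

lemma shanks_identity: "(\<Sum>k\<le>n. shanks q n k) = euler_fps_partial q n"
proof (induction n)
  case 0
  then show ?case by (simp add: shanks_def euler_fps_partial_def theta_exp_def triangular_def)
next
  case (Suc n)
  define U where "U = (\<lambda>k. (if k = 0 then 0 else (-1) ^ k * (\<Prod>i=k..n. 1 - q ^ i) * q ^ (n * k + \<Sum>{..k})))"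
  have "(\<Sum>k\<le>Suc n. shanks q (Suc n) k) =
      (\<Sum>k\<le>n. shanks q (Suc n) k - shanks q n k) + (\<Sum>k\<le>n. shanks q n k) + shanks q (Suc n) (Suc n)"
    by (simp add: sum_subtractf)
  also have "(\<Sum>k\<le>n. shanks q (Suc n) k - shanks q n k) = (\<Sum>k\<le>n. U (Suc k) - U k)"
    by (rule sum.cong) (auto simp: shanks_step U_def simp del: sum.atMost_Suc)
  also have "\<dots> = U (Suc n) - U 0"
    using sum_lessThan_telescope[of U "Suc n"] by (simp add: lessThan_Suc_atMost)
  also have "\<dots> = (-1) ^ Suc n * q ^ nat (theta_exp 3 2 (- int (Suc n)))"
    unfolding theta_exp_neg nat_int by (simp add: U_def del: sum.atMost_Suc)
  also have "shanks q (Suc n) (Suc n) = (-1) ^ Suc n * q ^ nat (theta_exp 3 2 (int (Suc n)))"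
    unfolding theta_exp_pos nat_int by (simp add: shanks_def del: sum.atMost_Suc)
  also have "(\<Sum>k\<le>n. shanks q n k) = euler_fps_partial q n" by (rule Suc)
  finally have *: "(\<Sum>k\<le>Suc n. shanks q (Suc n) k) = (-1) ^ Suc n * q ^ nat (theta_exp 3 2 (- int (Suc n)))
     + euler_fps_partial q n + (-1) ^ Suc n * q ^ nat (theta_exp 3 2 (int (Suc n)))" .
  have s: "{- int (Suc n)..int (Suc n)} = insert (int (Suc n)) (insert (- int (Suc n)) {- int n..int n})"
    by auto
  have pm: "(-1) ^ Suc n = (if even (int (Suc n)) then 1 else -1 :: 'a)" by simp
  show ?case
    unfolding * unfolding euler_fps_partial_def s pm by (subst sum.insert, simp, simp, subst sum.insert) (simp_all add: algebra_simps)
qed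

definition eprod :: "'a::comm_ring_1 \<Rightarrow> nat \<Rightarrow> 'a" where "eprod q n = (\<Prod>i=1..n. 1 - q ^ i)"

text \<open>The summand k = 0 is the finite product; the others are divisible by q^n. The identity
  holds in any commutative ring and is used twice: X-adically in \<open>shanks_nth_0\<close>, and
  for small complex q in \<open>shanks_tail\<close>.\<close>

lemma eprod_shanks: "eprod q n = euler_fps_partial q n - (\<Sum>k=1..n. shanks q n k)"
proof -
  have "(\<Sum>k\<le>n. shanks q n k) = shanks q n 0 + (\<Sum>k=1..n. shanks q n k)"
    by (simp add: atMost_atLeast0 sum.atLeast_Suc_atMost)
  moreover have "shanks q n 0 = eprod q n" by (simp add: shanks_def eprod_def)
  ultimately show ?thesis using shanks_identity[of q n] by (simp add: algebra_simps)
qed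

lemma fps_nth_mult_X_power_0: "N < k \<Longrightarrow> fps_nth (f * fps_X ^ k) N = (0 :: complex)"
  by (simp add: fps_X_power_mult_right_nth)

lemma shanks_nth_0:
  assumes "1 \<le> k" "N \<le> n" shows "fps_nth (shanks (fps_X :: complex fps) n k) N = 0"
proof -
  have "n * 1 \<le> n * k" "1 \<le> \<Sum>{..k}"
    using assms by (auto simp: mult_le_mono2 intro!: order.trans[OF assms(1)] member_le_sum)
  then have "N < n * k + \<Sum>{..k}" using assms by linarith
  then show ?thesis unfolding shanks_def by (rule fps_nth_mult_X_power_0)
qed

lemma euler_fps_nth:
  assumes "finite A" "\<And>k. theta_exp 3 2 k = int N \<Longrightarrow> k \<in> A"
  shows "fps_nth euler_fps N = (\<Sum>k\<in>A. (if even k then 1 else -1) * (if theta_exp 3 2 k = int N then 1 else 0))"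
  unfolding euler_fps_def moment_def using assms theta_exp_ge(2)[of 3 2]
  by (subst fsum_nth[of A]) (auto simp: theta_def sgn_fps_nth X_pow_nth intro!: sum.cong split: if_splits)

lemma euler_fps_partial_nth:
  "fps_nth (euler_fps_partial (fps_X :: complex fps) n) N =
     (\<Sum>k\<in>{- int n..int n}. (if even k then 1 else -1) * (if theta_exp 3 2 k = int N then 1 else 0))"
proof -
  have "fps_nth ((if even k then 1 else -1) * f) N = (if even k then 1 else -1) * fps_nth f N"
    for k :: int and f :: "complex fps" by simp
  moreover have "N = nat (theta_exp 3 2 k) \<longleftrightarrow> theta_exp 3 2 k = int N" for k
    using theta_exp_ge(2)[of 3 2 k] by auto
  ultimately show ?thesis
    unfolding euler_fps_partial_def fps_sum_nth by (intro sum.cong refl) (simp only: fps_X_power_nth)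
qed

lemma theta_exp_abs_le: "theta_exp 3 2 k = int N \<Longrightarrow> \<bar>k\<bar> \<le> int N + 1"
  using theta_exp_ge(1)[of 3 2 k] by simp

lemma euler_fps_nth_partial: "N < n \<Longrightarrow> fps_nth euler_fps N = fps_nth (euler_fps_partial fps_X n) N"
  unfolding euler_fps_partial_nth by (rule euler_fps_nth) (auto dest: theta_exp_abs_le)

lemma euler_fps_nth_eprod: "N < n \<Longrightarrow> fps_nth euler_fps N = fps_nth (eprod fps_X n) N"
  unfolding eprod_shanks by (simp add: euler_fps_nth_partial fps_sum_nth shanks_nth_0)

lemma euler_fps_0: "fps_nth euler_fps 0 = 1"
  by (subst euler_fps_nth_eprod[of 0 1]) (simp_all add: eprod_def)

lemma qderiv_eprod:
  "qderiv (eprod fps_X n) = - eprod fps_X n * (\<Sum>i=1..n. of_nat i * Abs_fps (\<lambda>N. if N > 0 \<and> i dvd N then 1 else 0))"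
proof (induction n)
  case 0
  then show ?case by (simp add: eprod_def qderiv_def)
next
  case (Suc n)
  let ?g = "\<lambda>i. Abs_fps (\<lambda>N. if N > 0 \<and> i dvd N then 1 else 0) :: complex fps"
  have g: "(1 - fps_X ^ Suc n) * ?g (Suc n) = fps_X ^ Suc n"
  proof (rule fps_ext)
    fix N
    have "Suc n \<le> N \<Longrightarrow> Suc n dvd N - Suc n \<longleftrightarrow> Suc n dvd N"
      by (metis dvd_minus_self not_less)
    moreover have "N < Suc n \<Longrightarrow> 0 < N \<Longrightarrow> \<not> Suc n dvd N" by (auto dest: dvd_imp_le)
    ultimately show "fps_nth ((1 - fps_X ^ Suc n) * ?g (Suc n)) N = fps_nth (fps_X ^ Suc n) N"
      by (cases "N = Suc n") (auto simp: left_diff_distrib fps_X_power_mult_nth simp del: power_Suc)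
  qed
  have e: "eprod fps_X (Suc n) = eprod fps_X n * (1 - fps_X ^ Suc n)" for n by (simp add: eprod_def)
  have "qderiv (fps_X ^ Suc n) = of_nat (Suc n) * fps_X ^ Suc n"
    by (rule fps_ext) (simp add: fps_of_nat[symmetric] del: power_Suc of_nat_Suc)
  then have q: "qderiv (1 - fps_X ^ Suc n) = - (of_nat (Suc n) * ((1 - fps_X ^ Suc n) * ?g (Suc n)))"
    unfolding g by (simp add: qderiv_diff) (simp add: qderiv_def)
  show ?case
    unfolding e qderiv_mult Suc q by (simp add: algebra_simps del: power_Suc of_nat_Suc)
qed

text \<open>Coefficients up to N depend only on the first N + 1 factors of the product, whose
  logarithmic derivative is minus a truncated Lambert series for sigma_1.\<close>

lemma qderiv_euler_fps: "qderiv euler_fps = - sigma_fps * euler_fps"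
proof (rule fps_ext)
  fix N
  let ?n = "Suc N"
  let ?s = "\<Sum>i=1..?n. of_nat i * (Abs_fps (\<lambda>N. if N > 0 \<and> i dvd N then 1 else 0) :: complex fps)"
  have s: "fps_nth sigma_fps k = fps_nth ?s k" if "k \<le> N" for k
  proof (cases "k = 0")
    case True
    then show ?thesis by (simp add: sigma_fps_def divisor_sigma_def fps_sum_nth fps_of_nat[symmetric] del: sum.cl_ivl_Suc)
  next
    case False
    have "fps_nth ?s k = (\<Sum>i=1..?n. if i dvd k then of_nat i else 0)"
      using False by (simp add: fps_sum_nth fps_of_nat[symmetric] if_distrib cong: if_cong del: sum.cl_ivl_Suc)
    also have "\<dots> = (\<Sum>i | i dvd k. of_nat i)"
    proof (rule sum.mono_neutral_cong_right)
      show "{i. i dvd k} \<subseteq> {1..?n}"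
      proof
        fix i assume "i \<in> {i. i dvd k}"
        then have "i \<le> k" "i \<noteq> 0" using False by (auto dest: dvd_imp_le)
        then show "i \<in> {1..?n}" using that by simp
      qed
    qed auto
    finally show ?thesis by (simp add: sigma_fps_def divisor_sigma_def)
  qed
  have "fps_nth (qderiv euler_fps) N = fps_nth (qderiv (eprod fps_X ?n)) N"
    by (simp add: euler_fps_nth_eprod[of N ?n])
  also have "\<dots> = - fps_nth (eprod fps_X ?n * ?s) N"
    unfolding qderiv_eprod by simp
  also have "fps_nth (eprod fps_X ?n * ?s) N = fps_nth (euler_fps * sigma_fps) N"
    by (rule fps_mult_nth_cong) (simp_all add: euler_fps_nth_eprod[of _ ?n] s del: sum.cl_ivl_Suc)
  finally show "fps_nth (qderiv euler_fps) N = fps_nth (- sigma_fps * euler_fps) N" by (simp add: mult.commute)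
qed

text \<open>Both sides have constant term 1 and logarithmic derivative -3 times the series of
  sigma_1.\<close>

lemma jacobi_sum_eq: "jacobi_sum = euler_fps ^ 3"
proof (rule qderiv_unique)
  show "qderiv jacobi_sum = (- 3 * sigma_fps) * jacobi_sum" by (simp add: qderiv_jacobi_sum)
  show "qderiv (euler_fps ^ 3) = (- 3 * sigma_fps) * euler_fps ^ 3"
  proof -
    have "qderiv (euler_fps ^ 3) = 3 * euler_fps ^ 2 * qderiv euler_fps" by (simp add: qderiv_power)
    then show ?thesis unfolding qderiv_euler_fps by (simp add: power3_eq_cube power2_eq_square)
  qed
  show "fps_nth (- 3 * sigma_fps) 0 = 0" by (simp add: sigma_fps_def divisor_sigma_def numeral_fps_const fps_mult_nth)
  show "fps_nth jacobi_sum 0 = fps_nth (euler_fps ^ 3) 0" by (simp add: jacobi_sum_0 euler_fps_0 fps_power_zeroth)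
qed

section \<open>Kronecker's identity and divisor sums modulo 3\<close>

text \<open>The constant of proportionality in Kronecker's identity. It turns out to be the generating
  function of 3-cores.\<close>

definition core_fps :: "complex fps" where "core_fps = convolve (geom0 3 1) (theta 3 0) 0"

lemma three_n_one_nonzero: "3 * n + 1 \<noteq> (0::int)"
  by presburger

text \<open>No integer n makes 3n + 1 zero, so the recurrence is homogeneous and theta functions at
  X z are its only solutions up to a factor.\<close>

lemma convolve_geom0_31: "convolve (geom0 3 1) (theta 3 0) m = core_fps * theta 3 1 m"
  unfolding core_fps_def
proof (rule theta_rec_unique)
  fix m A B :: int assume AB: "0 \<le> A" "0 \<le> B" "A - B = 3 * m + 1"
  have z: "fsum (\<lambda>n. 0 :: complex fps) = 0" by (simp add: fsum_def fps_eq_iff)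
  show "X_pow B * convolve (geom0 3 1) (theta 3 0) (m + 1) + X_pow A * convolve (geom0 3 1) (theta 3 0) m = 0"
    using convolve_geom0_theta_rec[of 3 A B m 1] AB by (simp add: three_n_one_nonzero z)
qed auto

lemma moment_1_th31: "moment (\<lambda>_. 1) (theta 3 1) = euler_fps"
  by (simp add: moment_th31 euler_fps_def)

text \<open>Multiply Kronecker's identity by 1 - z and differentiate at z = 1. On the left the
  kernel has value 1 and the theta function a simple zero with derivative given by Jacobi's series
  in X^3; on the right only the derivative of 1 - z survives, which leaves -P E.\<close>

lemma core_fps_euler_fps: "core_fps * euler_fps = expand3 jacobi_sum"
proof -
  let ?G = "convolve (geom0 3 1) (theta 3 0)"
  define D where "D = convolve (geom_step 3 1) (theta 3 0)"
  have n0: "3 * n + 1 > 0 \<longleftrightarrow> 0 \<le> n" for n :: int by presburger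
  have lf: "loc_fin ?G" unfolding convolve_geom0_31 by (intro loc_fin_mult_left loc_fin_theta) auto
  have lfd: "loc_fin (geom_step 3 1)" by (rule geom_step_split(1)[OF _ n0]) simp
  have lft: "loc_fin (theta 3 0)" "loc_fin (theta 3 1)" by (simp_all add: loc_fin_theta)
  have D: "D = (\<lambda>m. ?G m - ?G (m - 1))"
    unfolding D_def by (rule ext, rule convolve_geom_step) simp
  have "moment of_int D = moment (\<lambda>n. -1) (\<lambda>m. core_fps * theta 3 1 m)"
    unfolding D moment_difference[OF lf] unfolding convolve_geom0_31 by simp
  also have "\<dots> = - (core_fps * euler_fps)"
    using moment_const_weight[OF lft(2), of "-1"]
    by (simp add: moment_cmult[OF lft(2)] moment_1_th31 fps_const_lits del: fps_const_neg)
  finally have 1: "moment of_int D = - (core_fps * euler_fps)" .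
  have z: "moment (\<lambda>n. 0) f = 0" for f by (simp add: moment_def fsum_def fps_eq_iff)
  have "moment (\<lambda>_. 1) (geom_step 3 1) = fps_const 1 + moment (\<lambda>n. 1 - 1) (geom0' 3 1)"
    by (rule geom_step_split(2)[OF _ n0]) simp
  then have d0: "moment (\<lambda>_. 1) (geom_step 3 1) = 1" by (simp add: z)
  have "moment of_int D = - expand3 jacobi_sum"
    unfolding D_def using moment_convolve_binomial[OF lfd lft(1), of of_int of_int of_int 1]
    by (simp add: d0 moment_theta_zero moment_id_th30)
  with 1 show ?thesis by simp
qed

text \<open>Kronecker's identity after the substitution \<open>z \<mapsto> X\<^sup>t z\<close>.\<close>

definition geom_twist :: "int \<Rightarrow> int \<Rightarrow> complex fps" where "geom_twist t n = geom (t * n) (3 * n + 1)"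

text \<open>Up to sign, X^(tn) / (1 - X^(3n+1)) has the exponents N = tn + (3n+1) j, and 3N + t =
  (3n+1)(3j+t). Thus the terms that reach degree N correspond to divisors 3n + 1 of 3N + t.\<close>

lemma geom_twist_nth:
  assumes t: "t = 1 \<or> t = 2"
  shows "fps_nth (geom_twist t n) N = (if 3 * n + 1 dvd 3 * int N + t then of_int (sgn (3 * n + 1)) else 0)"
proof -
  let ?d = "3 * n + 1"
  have "coprime ?d 3" by (rule coprimeI) (metis dvd_add_right_iff dvd_mult2 dvd_refl)
  then have "?d dvd int N - t * n \<longleftrightarrow> ?d dvd 3 * (int N - t * n)"
    using coprime_dvd_mult_right_iff[of ?d 3 "int N - t * n"] by blast
  also have "3 * (int N - t * n) = 3 * int N + t - t * ?d" by (simp add: algebra_simps)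
  also have "?d dvd \<dots> \<longleftrightarrow> ?d dvd 3 * int N + t" by (simp add: dvd_diff_left_iff)
  finally have dvd: "?d dvd int N - t * n \<longleftrightarrow> ?d dvd 3 * int N + t" .
  \<comment> \<open>The cofactor k of 3n + 1 is positive and congruent to t modulo 3, so it is at
    least t; this gives the order condition in \<open>geom\<close>. For a negative divisor the
    cofactor is at most t - 3.\<close>
  have bound: "t * n \<le> int N" if "?d > 0" and "?d dvd 3 * int N + t"
  proof -
    from that(2) obtain k where k: "3 * int N + t = ?d * k" by (elim dvdE)
    then have "k > 0" using that(1) t by (smt (verit) mult_nonneg_nonpos of_nat_0_le_iff)
    have "k = t + 3 * (int N - n * k)" using k by (simp add: algebra_simps)
    then have "t \<le> k" using \<open>k > 0\<close> t by presburger
    then have "?d * t \<le> 3 * int N + t" unfolding k using that(1) by (intro mult_left_mono) auto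
    then show ?thesis by (simp add: algebra_simps)
  qed
  have bound': "t * n - ?d \<le> int N" if "?d < 0" and "?d dvd 3 * int N + t"
  proof -
    from that(2) obtain k where k: "3 * int N + t = ?d * k" by (elim dvdE)
    then have "k < 0" using that(1) t by (smt (verit) mult_nonpos_nonneg of_nat_0_le_iff)
    have "k = t + 3 * (int N - n * k)" using k by (simp add: algebra_simps)
    then have "k \<le> t - 3" using \<open>k < 0\<close> t by presburger
    then have "?d * (t - 3) \<le> 3 * int N + t" unfolding k using that(1) by (intro mult_left_mono_neg) auto
    then show ?thesis by (simp add: algebra_simps)
  qed
  show ?thesis
    unfolding geom_twist_def geom_def using dvd bound bound' three_n_one_nonzero[of n] by (auto simp: sgn_if)
qed

text \<open>X and X^2 lie strictly between the poles at 1 and X^3, so the kernel has moments there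
  without a factor 1 - z. Formally, 3N + t is never 0 and has only finitely many divisors.\<close>

lemma loc_fin_geom_twist: "t = 1 \<or> t = 2 \<Longrightarrow> loc_fin (geom_twist t)"
proof (rule loc_finI)
  fix N n assume t: "t = 1 \<or> t = 2" and nz: "fps_nth (geom_twist t n) N \<noteq> 0"
  from nz have "3 * n + 1 dvd 3 * int N + t" by (auto simp: geom_twist_nth[OF t] split: if_splits)
  then have "\<bar>3 * n + 1\<bar> \<le> 3 * int N + t" using t dvd_imp_le_int[of "3 * int N + t" "3 * n + 1"] by auto
  then show "n \<in> {- (int N + 2) .. int N + 2}" using t by auto
qed simp

lemma convolve_geom_twist:
  assumes t: "t = 1 \<or> t = 2"
  shows "convolve (geom_twist t) (theta 3 t) m = core_fps * theta 3 (1 + t) m"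
proof -
  \<comment> \<open>Substituting X^t z multiplies coefficient m by X^(tm). Splitting tm into
    positive and negative part puts one power on each side and avoids negative exponents.\<close>
  define A B where "A = max 0 (t * m)" and "B = max 0 (- (t * m))"
  have AB: "0 \<le> A" "0 \<le> B" "A = B + t * m" by (auto simp: A_def B_def)
  have ge: "0 \<le> theta_exp 3 u l" if "0 \<le> u" "u \<le> 3" for u l using theta_exp_ge(2)[of 3 u l] that by simp
  have tm: "X_pow B * (geom_twist t n * theta 3 t (m - n)) = X_pow A * (geom0 3 1 n * theta 3 0 (m - n))" for n
  proof -
    let ?d = "3 * n + 1" and ?l = "m - n"
    have v: "?d > 0 \<and> 0 \<le> e \<or> ?d < 0 \<and> ?d \<le> e" if "0 \<le> e" for e
      using three_n_one_nonzero[of n] that by linarith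
    have v': "?d > 0 \<and> 0 \<le> a + t * n \<or> ?d < 0 \<and> ?d \<le> a + t * n" if "0 \<le> a" for a
      using three_n_one_nonzero[of n] that t by auto
    have "X_pow B * (geom_twist t n * theta 3 t ?l) = sgn_fps ?l * (X_pow B * (X_pow (theta_exp 3 t ?l) * geom_twist t n))"
      by (simp add: theta_def mult_ac)
    also have "\<dots> = sgn_fps ?l * geom (B + (theta_exp 3 t ?l + t * n)) ?d"
      using ge[of t ?l] v'[of 0] v'[of "theta_exp 3 t ?l"] AB t by (auto simp: geom_twist_def X_pow_geom)
    also have "B + (theta_exp 3 t ?l + t * n) = A + (theta_exp 3 0 ?l + 0)"
      using AB(3) by (simp add: theta_exp_def algebra_simps)
    also have "sgn_fps ?l * geom (A + (theta_exp 3 0 ?l + 0)) ?d = sgn_fps ?l * (X_pow A * (X_pow (theta_exp 3 0 ?l) * geom0 3 1 n))"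
      using ge[of 0 ?l] v[of 0] v[of "theta_exp 3 0 ?l"] AB by (simp add: geom0_def X_pow_geom)
    also have "\<dots> = X_pow A * (geom0 3 1 n * theta 3 0 ?l)"
      by (simp add: theta_def mult_ac)
    finally show ?thesis .
  qed
  have lf: "loc_fin (\<lambda>n. geom_twist t n * theta 3 t (m - n))"
    using t by (intro loc_fin_mult_right loc_fin_geom_twist)
  have "X_pow B * convolve (geom_twist t) (theta 3 t) m = X_pow A * convolve (geom0 3 1) (theta 3 0) m"
    unfolding convolve_def fsum_mult_left[OF lf, symmetric] tm
    by (rule fsum_mult_left) (simp add: loc_fin_geom0_theta)
  also have "\<dots> = core_fps * (sgn_fps m * (X_pow A * X_pow (theta_exp 3 1 m)))"
    by (simp add: convolve_geom0_31 theta_def mult_ac)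
  also have "X_pow A * X_pow (theta_exp 3 1 m) = X_pow B * X_pow (theta_exp 3 (1 + t) m)"
  proof -
    have "A + theta_exp 3 1 m = B + theta_exp 3 (1 + t) m" using AB(3) by (simp add: theta_exp_def algebra_simps)
    moreover have "0 \<le> theta_exp 3 1 m" "0 \<le> theta_exp 3 (1 + t) m" using ge t by auto
    ultimately show ?thesis using X_pow_add[OF AB(1)] X_pow_add[OF AB(2)] by presburger
  qed
  also have "core_fps * (sgn_fps m * (X_pow B * X_pow (theta_exp 3 (1 + t) m))) = X_pow B * (core_fps * theta 3 (1 + t) m)"
    by (simp add: theta_def mult_ac)
  finally show ?thesis by simp
qed

lemma moment_convolve_geom_twist:
  assumes t: "t = 1 \<or> t = 2" and w: "\<And>n l. w (n + l) = a n + c l"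
  shows "(\<Sum>k\<le>i. of_nat (i choose k) * (moment (\<lambda>n. a n ^ k) (geom_twist t) * moment (\<lambda>n. c n ^ (i - k)) (theta 3 t)))
     = core_fps * moment (\<lambda>n. w n ^ i) (theta 3 (1 + t))"
proof -
  have lf: "loc_fin (theta 3 t)" "loc_fin (theta 3 (1 + t))" using t by (auto intro!: loc_fin_theta)
  have "moment (\<lambda>n. w n ^ i) (convolve (geom_twist t) (theta 3 t)) = core_fps * moment (\<lambda>n. w n ^ i) (theta 3 (1 + t))"
    using moment_cmult[OF lf(2)] by (simp add: convolve_geom_twist[OF t, abs_def])
  then show ?thesis using moment_convolve_binomial[where w = w and a = a and c = c, OF loc_fin_geom_twist[OF t] lf(1) w] by simp
qed

definition twist_moment :: "nat \<Rightarrow> complex fps" where "twist_moment i = moment (\<lambda>n. of_int (3 * n + 1) ^ i) (geom_twist 1)"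

definition sigma_res :: "nat \<Rightarrow> nat \<Rightarrow> complex fps" where
  "sigma_res i r = Abs_fps (\<lambda>N. of_nat (divisor_sigma i (3 * N + r)))"

text \<open>Each divisor d prime to 3 is |3n + 1| for exactly one integer n, whose sign depends on d
  modulo 3. For odd i the sign carried by the kernel cancels that of (3n+1)^i.\<close>

lemma sum_divisors_mod_3:
  assumes "\<not> 3 dvd M" "odd i"
  shows "(\<Sum>n | 3 * n + 1 dvd int M. of_int (sgn (3 * n + 1)) * of_int (3 * n + 1) ^ i :: complex)
    = of_nat (divisor_sigma i M)"
  unfolding divisor_sigma_def of_nat_sum
proof (rule sum.reindex_bij_witness[where
      j = "\<lambda>n. nat \<bar>3 * n + 1\<bar>" and i = "\<lambda>d. if d mod 3 = 1 then (int d - 1) div 3 else - ((int d + 1) div 3)"])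
  fix n :: int
  show "(if nat \<bar>3 * n + 1\<bar> mod 3 = 1 then (int (nat \<bar>3 * n + 1\<bar>) - 1) div 3
      else - ((int (nat \<bar>3 * n + 1\<bar>) + 1) div 3)) = n"
  proof (cases "n \<ge> 0")
    case True
    then obtain k where k: "n = int k" by (metis nonneg_int_cases)
    have 1: "nat \<bar>3 * n + 1\<bar> = 3 * k + 1" using k by simp
    have 2: "(3 * k + 1) mod 3 = 1" by presburger
    show ?thesis unfolding 1 2 using k by simp
  next
    case False
    then obtain k where k: "n = - int (Suc k)" by (metis not_le neg_int_cases of_nat_0_less_iff gr0_conv_Suc)
    have 1: "nat \<bar>3 * n + 1\<bar> = 3 * k + 2" using k by simp
    have 2: "(3 * k + 2) mod 3 = 2" by presburger
    show ?thesis unfolding 1 2 using k by simp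
  qed
next
  fix n assume "n \<in> {n. 3 * n + 1 dvd int M}"
  then show "nat \<bar>3 * n + 1\<bar> \<in> {d. d dvd M}" by (simp add: nat_abs_dvd_iff)
next
  fix d assume d: "d \<in> {d. d dvd M}"
  then have "\<not> 3 dvd d" using assms(1) by (auto intro: dvd_trans)
  then have m: "d mod 3 = 1 \<or> d mod 3 = 2" by presburger
  let ?n = "if d mod 3 = 1 then (int d - 1) div 3 else - ((int d + 1) div 3)"
  have e: "3 * ?n + 1 = int d \<or> 3 * ?n + 1 = - int d" using m by presburger
  have "nat \<bar>x\<bar> = d" "x dvd int M" if "x = int d \<or> x = - int d" for x
    using that d by auto
  from this[OF e] show "nat \<bar>3 * ?n + 1\<bar> = d" "?n \<in> {n. 3 * n + 1 dvd int M}"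
    by (simp_all only: mem_Collect_eq)
next
  fix n :: int
  have "of_nat (nat \<bar>x\<bar> ^ i) = (of_int (sgn x) * of_int x ^ i :: complex)" if "x \<noteq> 0" for x
  proof -
    have "(- y) ^ i = - (y ^ i)" for y :: int using assms(2) by (rule power_minus_odd)
    then have "sgn x * x ^ i = \<bar>x\<bar> ^ i" using that by (cases "x > 0") (auto simp: abs_if)
    also have "\<dots> = int (nat \<bar>x\<bar> ^ i)" by simp
    finally have "(of_int (sgn x * x ^ i) :: complex) = of_int (int (nat \<bar>x\<bar> ^ i))" by simp
    then show ?thesis unfolding of_int_of_nat_eq of_int_mult of_int_power by simp
  qed
  then show "of_nat (nat \<bar>3 * n + 1\<bar> ^ i) = (of_int (sgn (3 * n + 1)) * of_int (3 * n + 1) ^ i :: complex)"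
    using three_n_one_nonzero .
qed

lemma moment_geom_twist_sigma:
  assumes t: "t = 1 \<or> t = 2" and i: "odd i"
  shows "moment (\<lambda>n. of_int (3 * n + 1) ^ i) (geom_twist (int t)) = sigma_res i t"
proof (rule fps_ext)
  fix N
  have t': "int t = 1 \<or> int t = 2" using t by auto
  have eq: "3 * int N + int t = int (3 * N + t)" by simp
  have fin: "finite {n. 3 * n + 1 dvd int (3 * N + t)}"
  proof (rule finite_subset[of _ "(\<lambda>d. (d - 1) div 3) ` {d. d dvd int (3 * N + t)}"])
    show "finite ((\<lambda>d. (d - 1) div 3) ` {d. d dvd int (3 * N + t)})"
      using t by (intro finite_imageI finite_divisors_int) auto
    show "{n. 3 * n + 1 dvd int (3 * N + t)} \<subseteq> (\<lambda>d. (d - 1) div 3) ` {d. d dvd int (3 * N + t)}"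
      by (auto intro!: image_eqI[of _ _ "3 * n + 1" for n])
  qed
  have "fps_nth (moment (\<lambda>n. of_int (3 * n + 1) ^ i) (geom_twist (int t))) N =
     (\<Sum>n | 3 * n + 1 dvd int (3 * N + t). fps_nth (fps_const (of_int (3 * n + 1) ^ i) * geom_twist (int t) n) N)"
    unfolding moment_def by (rule fsum_nth[OF fin]) (auto simp: geom_twist_nth[OF t'] split: if_splits)
  also have "\<dots> = (\<Sum>n | 3 * n + 1 dvd int (3 * N + t). of_int (sgn (3 * n + 1)) * of_int (3 * n + 1) ^ i)"
    by (intro sum.cong refl) (simp add: geom_twist_nth[OF t'])
  also have "\<dots> = of_nat (divisor_sigma i (3 * N + t))"
    using t i by (intro sum_divisors_mod_3) presburger+
  finally show "fps_nth (moment (\<lambda>n. of_int (3 * n + 1) ^ i) (geom_twist (int t))) N = fps_nth (sigma_res i t) N"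
    by (simp add: sigma_res_def)
qed

text \<open>The sum of (-1)^l (6l+1) X^(l(3l+1)/2). Its quotient by E, introduced below as
  \<open>cubic_a\<close>, is the cubic theta function.\<close>

definition cubic_num :: "complex fps" where "cubic_num = 6 * moment of_int (theta 3 2) + euler_fps"

context begin

private definition "e1 = moment of_int (theta 3 2)"
private definition "e2 = power_moment 2 (theta 3 2)"
private definition "e3 = power_moment 3 (theta 3 2)"

private lemma lf: "loc_fin (theta 3 2)" "loc_fin (theta 3 1)" by (simp_all add: loc_fin_theta)

private lemma M:
  "moment (\<lambda>l. of_int (3 * l) ^ 0) (theta 3 1) = euler_fps"
  "moment (\<lambda>l. of_int (3 * l) ^ 1) (theta 3 1) = - 3 * e1"
  "moment (\<lambda>l. of_int (3 * l) ^ 2) (theta 3 1) = 9 * e2"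
  "moment (\<lambda>l. of_int (3 * l) ^ 3) (theta 3 1) = - 27 * e3"
proof -
  have w1: "of_int (3 * - n) = 0 * of_int n ^ 3 + 0 * of_int n ^ 2 + (-3) * of_int n + (0 :: complex)"
   and w2: "of_int (3 * - n) ^ 2 = 0 * of_int n ^ 3 + 9 * of_int n ^ 2 + 0 * of_int n + (0 :: complex)"
   and w3: "of_int (3 * - n) ^ 3 = (-27) * of_int n ^ 3 + 0 * of_int n ^ 2 + 0 * of_int n + (0 :: complex)" for n
    by (simp_all add: power2_eq_square power3_eq_cube)
  show "moment (\<lambda>l. of_int (3 * l) ^ 0) (theta 3 1) = euler_fps" by (simp add: moment_1_th31)
  show "moment (\<lambda>l. of_int (3 * l) ^ 1) (theta 3 1) = - 3 * e1"
    unfolding moment_th31 power_one_right moment_poly3[OF lf(1) w1]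
    by (simp add: e1_def fps_const_lits del: fps_const_neg)
  show "moment (\<lambda>l. of_int (3 * l) ^ 2) (theta 3 1) = 9 * e2"
    unfolding moment_th31 moment_poly3[OF lf(1) w2]
    by (simp add: e2_def fps_const_lits del: fps_const_neg)
  show "moment (\<lambda>l. of_int (3 * l) ^ 3) (theta 3 1) = - 27 * e3"
    unfolding moment_th31 moment_poly3[OF lf(1) w3]
    by (simp add: e3_def fps_const_lits del: fps_const_neg)
qed

private lemma N:
  "moment (\<lambda>l. of_int (3 * l + 1) ^ 0) (theta 3 2) = euler_fps"
  "moment (\<lambda>l. of_int (3 * l + 1) ^ 1) (theta 3 2) = 3 * e1 + euler_fps"
  "moment (\<lambda>l. of_int (3 * l + 1) ^ 2) (theta 3 2) = 9 * e2 + 6 * e1 + euler_fps"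
  "moment (\<lambda>l. of_int (3 * l + 1) ^ 3) (theta 3 2) = 27 * e3 + 27 * e2 + 9 * e1 + euler_fps"
proof -
  have w1: "of_int (3 * n + 1) = 0 * of_int n ^ 3 + 0 * of_int n ^ 2 + 3 * of_int n + (1 :: complex)"
   and w2: "of_int (3 * n + 1) ^ 2 = 0 * of_int n ^ 3 + 9 * of_int n ^ 2 + 6 * of_int n + (1 :: complex)"
   and w3: "of_int (3 * n + 1) ^ 3 = 27 * of_int n ^ 3 + 27 * of_int n ^ 2 + 9 * of_int n + (1 :: complex)" for n
    by (simp_all add: power2_eq_square power3_eq_cube algebra_simps)
  show "moment (\<lambda>l. of_int (3 * l + 1) ^ 0) (theta 3 2) = euler_fps" by (simp add: euler_fps_def)
  show "moment (\<lambda>l. of_int (3 * l + 1) ^ 1) (theta 3 2) = 3 * e1 + euler_fps"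
    unfolding power_one_right moment_poly3[OF lf(1) w1]
    by (simp add: e1_def euler_fps_def fps_const_lits del: fps_const_neg)
  show "moment (\<lambda>l. of_int (3 * l + 1) ^ 2) (theta 3 2) = 9 * e2 + 6 * e1 + euler_fps"
    unfolding moment_poly3[OF lf(1) w2]
    by (simp add: e2_def e1_def euler_fps_def fps_const_lits del: fps_const_neg)
  show "moment (\<lambda>l. of_int (3 * l + 1) ^ 3) (theta 3 2) = 27 * e3 + 27 * e2 + 9 * e1 + euler_fps"
    unfolding moment_poly3[OF lf(1) w3]
    by (simp add: e3_def e2_def e1_def euler_fps_def fps_const_lits del: fps_const_neg)
qed

text \<open>The exponent (3l^2 + l)/2 is quadratic in the index, so X d/dX raises the order of a
  moment by two. This expresses \<open>e2\<close> and \<open>e3\<close> through E, \<open>e1\<close>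
  and their derivatives.\<close>

private lemma heat:
  "2 * qderiv euler_fps = 3 * e2 + e1" "2 * qderiv e1 = 3 * e3 + e2"
proof -
  have t: "2 * of_int (theta_exp 3 2 n) = (3 * of_int n ^ 2 + of_int n :: complex)" for n
  proof -
    have "2 * of_int (theta_exp 3 2 n) = (3 * (2 * of_int (triangular n)) + 4 * of_int n :: complex)"
      by (simp add: theta_exp_def)
    also have "2 * of_int (triangular n) = (of_int n * (of_int n - 1) :: complex)"
      using arg_cong[OF triangular_2[of n], of "of_int :: int \<Rightarrow> complex"] by simp
    finally show ?thesis by (simp add: power2_eq_square algebra_simps)
  qed
  then have t: "of_int (theta_exp 3 2 n) = ((3 * of_int n ^ 2 + of_int n) / 2 :: complex)" for n
    using t[of n] by (simp add: field_simps)
  have w1: "1 * of_int (theta_exp 3 2 n) = 0 * of_int n ^ 3 + (3/2) * of_int n ^ 2 + (1/2) * of_int n + (0 :: complex)"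
   and w2: "of_int n * of_int (theta_exp 3 2 n) = (3/2) * of_int n ^ 3 + (1/2) * of_int n ^ 2 + 0 * of_int n + (0 :: complex)" for n
    unfolding t by (simp_all add: power2_eq_square power3_eq_cube add_divide_distrib algebra_simps)
  have c: "2 * (fps_const (c / 2) * f) = fps_const c * f" for c :: complex and f
    by (simp add: mult.assoc[symmetric] numeral_fps_const)
  have "qderiv euler_fps = fps_const (3/2) * e2 + fps_const (1/2) * e1"
    unfolding euler_fps_def using qderiv_moment_theta[of 3 2 "\<lambda>_. 1"] moment_poly3[OF lf(1) w1] by (simp add: e2_def e1_def)
  then show "2 * qderiv euler_fps = 3 * e2 + e1"
    by (simp only: distrib_left c) (simp add: fps_const_lits del: fps_const_neg)
  have "qderiv e1 = fps_const (3/2) * e3 + fps_const (1/2) * e2"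
    unfolding e1_def using qderiv_moment_theta[of 3 2 of_int] moment_poly3[OF lf(1) w2] by (simp add: e2_def e3_def)
  then show "2 * qderiv e1 = 3 * e3 + e2"
    by (simp only: distrib_left c) (simp add: fps_const_lits del: fps_const_neg)
qed

lemma euler_fps_nonzero: "euler_fps \<noteq> 0"
  using euler_fps_0 by auto

text \<open>Derivatives of order 0 to 3 of Kronecker's identity at z = X, with the weight written as
  (3n+1) + 3l so that the kernel sees exactly its denominator index. The moment of order 2 is no
  divisor sum and serves for elimination.\<close>

private lemma E:
  "twist_moment 0 = core_fps"
  "twist_moment 1 * euler_fps - 3 * core_fps * e1 = core_fps * (3 * e1 + euler_fps)"
  "twist_moment 2 * euler_fps - 6 * twist_moment 1 * e1 + 9 * core_fps * e2 = core_fps * (9 * e2 + 6 * e1 + euler_fps)"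
  "twist_moment 3 * euler_fps - 9 * twist_moment 2 * e1 + 27 * twist_moment 1 * e2 - 27 * core_fps * e3 = core_fps * (27 * e3 + 27 * e2 + 9 * e1 + euler_fps)"
proof -
  have *: "(\<Sum>k\<le>i. of_nat (i choose k) * (twist_moment k * moment (\<lambda>l. of_int (3 * l) ^ (i - k)) (theta 3 1)))
     = core_fps * moment (\<lambda>n. of_int (3 * n + 1) ^ i) (theta 3 2)" for i
    using moment_convolve_geom_twist[of 1 "\<lambda>n. of_int (3 * n + 1)" "\<lambda>n. of_int (3 * n + 1)" "\<lambda>l. of_int (3 * l)" i]
    by (simp add: twist_moment_def)
  have "twist_moment 0 * euler_fps = core_fps * euler_fps"
    using *[of 0] unfolding atMost_0 by (simp add: M[unfolded power_0] N[unfolded power_0] euler_fps_def[symmetric] moment_1_th31)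
  then show k0: "twist_moment 0 = core_fps" using euler_fps_nonzero by simp
  have s1: "(\<Sum>k\<le>1::nat. f k) = f 0 + (f 1 :: complex fps)" for f by simp
  show "twist_moment 1 * euler_fps - 3 * core_fps * e1 = core_fps * (3 * e1 + euler_fps)"
    using *[of 1] unfolding s1 N diff_self_eq_0 diff_zero M k0 by (simp add: algebra_simps)
  have d: "2 - 1 = (1::nat)" "3 - 1 = (2::nat)" "3 - 2 = (1::nat)" by simp_all
  show "twist_moment 2 * euler_fps - 6 * twist_moment 1 * e1 + 9 * core_fps * e2 = core_fps * (9 * e2 + 6 * e1 + euler_fps)"
    using *[of 2] unfolding sum_atMost_2 N diff_self_eq_0 diff_zero d M k0 by (simp add: algebra_simps)
  show "twist_moment 3 * euler_fps - 9 * twist_moment 2 * e1 + 27 * twist_moment 1 * e2 - 27 * core_fps * e3 = core_fps * (27 * e3 + 27 * e2 + 9 * e1 + euler_fps)"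
    using *[of 3] unfolding sum_atMost_3 N diff_self_eq_0 diff_zero d M k0 by (simp add: choose_3_2 algebra_simps)
qed

definition cubic_a :: "complex fps" where "cubic_a = cubic_num * inverse euler_fps"

lemma cubic_num_eq: "cubic_num = cubic_a * euler_fps"
  using inverse_mult_eq_1[of euler_fps] euler_fps_0 by (simp add: cubic_a_def mult.assoc)

lemma twist_moment_1: "twist_moment 1 = core_fps * cubic_a"
proof -
  have "twist_moment 1 * euler_fps = (core_fps * cubic_a) * euler_fps"
  proof -
    have "twist_moment 1 * euler_fps = core_fps * cubic_num" using E(2) by (simp add: cubic_num_def e1_def[symmetric] algebra_simps)
    then show ?thesis unfolding cubic_num_eq by (simp only: mult.assoc)
  qed
  then show ?thesis using euler_fps_nonzero by simp
qed

text \<open>Dividing the theta moments by E makes the equations of \<open>E\<close> and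
  \<open>heat\<close> polynomial in \<open>cubic_a\<close>, its derivative and sigma_1; the
  normalized moments \<open>f1\<close>, \<open>f2\<close>, \<open>f3\<close> and
  \<open>twist_moment 2\<close> are then eliminated.\<close>

lemma twist_moment_3: "2 * twist_moment 3 = core_fps * (3 * cubic_a ^ 3 + 12 * qderiv cubic_a + 24 * cubic_a * sigma_fps - cubic_a)"
proof -
  define r where "r = inverse euler_fps"
  have r: "r * euler_fps = 1" using inverse_mult_eq_1[of euler_fps] euler_fps_0 by (simp add: r_def)
  define f1 f2 f3 where "f1 = e1 * r" and "f2 = e2 * r" and "f3 = e3 * r"
  have e: "e1 = f1 * euler_fps" "e2 = f2 * euler_fps" "e3 = f3 * euler_fps"
    unfolding f1_def f2_def f3_def mult.assoc r by simp_all
  have c: "u = v" if "u * euler_fps = v * euler_fps" for u v using that euler_fps_nonzero by simp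
  have f1: "6 * f1 = cubic_a - 1"
    by (rule c) (use cubic_num_eq in \<open>simp add: cubic_num_def e1_def[symmetric] e algebra_simps\<close>)
  have f2: "3 * f2 = - 2 * sigma_fps - f1"
    by (rule c) (use heat(1) in \<open>simp add: qderiv_euler_fps e algebra_simps\<close>)
  have q1: "qderiv e1 = qderiv f1 * euler_fps - f1 * sigma_fps * euler_fps"
    by (simp add: e qderiv_mult qderiv_euler_fps algebra_simps)
  have q1': "6 * qderiv f1 = qderiv cubic_a"
    using arg_cong[OF f1, of qderiv] by (simp add: qderiv_mult qderiv_numeral qderiv_diff) (simp add: qderiv_def)
  have f3: "3 * f3 = 2 * (qderiv f1 - f1 * sigma_fps) - f2"
    by (rule c) (use heat(2)[unfolded q1 e(2) e(3)] in \<open>simp add: algebra_simps\<close>)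
  have k2: "twist_moment 2 = core_fps * (6 * f1 + 1) + 6 * twist_moment 1 * f1"
    by (rule c) (use E(3) in \<open>simp add: e algebra_simps\<close>)
  have k3: "twist_moment 3 = core_fps * (54 * f3 + 27 * f2 + 9 * f1 + 1) + 9 * twist_moment 2 * f1 - 27 * twist_moment 1 * f2"
    by (rule c) (use E(4) in \<open>simp add: e algebra_simps\<close>)
  show ?thesis using f1 f2 q1' f3 k2 k3 twist_moment_1 by algebra
qed

end

lemma sigma_res_1: "sigma_res 1 1 = core_fps * cubic_a"
  using moment_geom_twist_sigma[of 1 1] twist_moment_1 by (simp add: twist_moment_def)

lemma sigma_res_3: "sigma_res 3 1 = twist_moment 3"
  using moment_geom_twist_sigma[of 1 3] by (simp add: twist_moment_def)

text \<open>At z = X^2 the theta function on the right is taken at X^3, where it vanishes. Hence the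
  zeroth moment of the kernel is 0, and the first is P times a theta derivative which is again
  E(q^3)^3 = P E; this is the origin of the square.\<close>

lemma sigma_res_2: "sigma_res 1 2 = 3 * core_fps ^ 2"
proof -
  let ?a = "\<lambda>n. of_int (3 * n + 1) :: complex" and ?c = "\<lambda>l. of_int (3 * l) :: complex"
  have lf: "loc_fin (theta 3 3)" by (simp add: loc_fin_theta)
  have *: "(\<Sum>k\<le>i. of_nat (i choose k) * (moment (\<lambda>n. ?a n ^ k) (geom_twist 2) * moment (\<lambda>n. ?c n ^ (i - k)) (theta 3 2)))
     = core_fps * moment (\<lambda>n. ?a n ^ i) (theta 3 3)" for i
    using moment_convolve_geom_twist[of 2 ?a ?a ?c i] by simp
  have "moment (\<lambda>n. 1) (geom_twist 2) * euler_fps = 0"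
    using *[of 0] by (simp add: euler_fps_def[symmetric] moment_th33_zero)
  then have k0: "moment (\<lambda>n. 1) (geom_twist 2) = 0" using euler_fps_nonzero by simp
  have w: "?a n = 0 * of_int n ^ 3 + 0 * of_int n ^ 2 + 3 * of_int n + (1 :: complex)" for n by simp
  have "moment ?a (theta 3 3) = 3 * expand3 jacobi_sum"
    unfolding moment_poly3[OF lf w] by (simp add: moment_th33_zero moment_id_th33 fps_const_lits del: fps_const_neg)
  moreover have "(\<Sum>k\<le>1::nat. f k) = f 0 + (f 1 :: complex fps)" for f by simp
  ultimately have "moment ?a (geom_twist 2) * euler_fps = core_fps * (3 * expand3 jacobi_sum)"
    using *[of 1] k0 by (simp add: euler_fps_def[symmetric])
  also have "\<dots> = (3 * core_fps ^ 2) * euler_fps"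
    unfolding core_fps_euler_fps[symmetric] by (simp add: power2_eq_square)
  finally have "moment ?a (geom_twist 2) = 3 * core_fps ^ 2" using euler_fps_nonzero by simp
  then show ?thesis using moment_geom_twist_sigma[of 2 1] by simp
qed

section \<open>The cubic theta function\<close>

lemma fsum_mod_3:
  assumes "loc_fin (f :: int \<Rightarrow> complex fps)"
  shows "fsum f = fsum (\<lambda>k. f (3 * k)) + fsum (\<lambda>k. f (3 * k + 1)) + fsum (\<lambda>k. f (3 * k + 2))"
proof (rule fps_ext)
  fix n
  define A where "A = {i. fps_nth (f i) n \<noteq> 0}"
  define S where "S = (\<lambda>r. {k. 3 * k + r \<in> A})"
  have fin: "finite A" using assms by (simp add: A_def loc_fin_def)
  have finS: "finite (S r)" for r
    unfolding S_def using finite_vimageI[OF fin, of "\<lambda>k. 3 * k + r"] by (simp add: vimage_def inj_def)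
  have fs: "fps_nth (fsum (\<lambda>k. f (3 * k + r))) n = (\<Sum>i\<in>(\<lambda>k. 3 * k + r) ` S r. fps_nth (f i) n)" for r
    by (subst sum.reindex) (auto simp: inj_on_def fsum_nth[OF finS] S_def A_def)
  have "A = (\<lambda>k. 3 * k + 0) ` S 0 \<union> ((\<lambda>k. 3 * k + 1) ` S 1 \<union> (\<lambda>k. 3 * k + 2) ` S 2)"
  proof (intro equalityI subsetI)
    fix i assume i: "i \<in> A"
    have "i \<in> (\<lambda>k. 3 * k + r) ` S r" if "i = 3 * (i div 3) + r" for r
      by (rule image_eqI[of _ _ "i div 3"]) (use that i in \<open>simp_all add: S_def\<close>)
    moreover have "i = 3 * (i div 3) + 0 \<or> i = 3 * (i div 3) + 1 \<or> i = 3 * (i div 3) + 2" by presburger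
    ultimately show "i \<in> (\<lambda>k. 3 * k + 0) ` S 0 \<union> ((\<lambda>k. 3 * k + 1) ` S 1 \<union> (\<lambda>k. 3 * k + 2) ` S 2)"
      by blast
  qed (auto simp: S_def)
  moreover have "(\<lambda>k. 3 * k + 1) ` S 1 \<inter> (\<lambda>k. 3 * k + 2) ` S 2 = {}"
    "(\<lambda>k. 3 * k + 0) ` S 0 \<inter> ((\<lambda>k. 3 * k + 1) ` S 1 \<union> (\<lambda>k. 3 * k + 2) ` S 2) = {}"
    by (auto, presburger+)
  ultimately have "(\<Sum>i\<in>A. fps_nth (f i) n) = fps_nth (fsum (\<lambda>k. f (3 * k + 0))) n
    + (fps_nth (fsum (\<lambda>k. f (3 * k + 1))) n + fps_nth (fsum (\<lambda>k. f (3 * k + 2))) n)"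
    unfolding fs using finS by (simp add: sum.union_disjoint)
  moreover have "fps_nth (fsum f) n = (\<Sum>i\<in>A. fps_nth (f i) n)"
    by (rule fsum_nth[OF fin]) (simp add: A_def)
  ultimately show "fps_nth (fsum f) n = fps_nth (fsum (\<lambda>k. f (3 * k)) + fsum (\<lambda>k. f (3 * k + 1)) + fsum (\<lambda>k. f (3 * k + 2))) n"
    by simp
qed

lemma triangular_3: "triangular (3 * k) = 9 * triangular k + 3 * k"
  "triangular (3 * k + 1) = 9 * triangular k + 6 * k" "triangular (3 * k + 2) = 9 * triangular k + 9 * k + 1"
  using triangular_2[of k] triangular_2[of "3 * k"] triangular_2[of "3 * k + 1"] triangular_2[of "3 * k + 2"]
  by (simp_all add: algebra_simps)

text \<open>Split the index l modulo 3. For l congruent to 0 or 1 the exponents l(l-1)/2 are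
  divisible by 3 and the two parts combine to \<open>cubic_num\<close>; for l congruent to 2 they
  are 1 modulo 9 and reproduce Jacobi's series in X^9.\<close>

lemma jacobi_sum_trisection: "jacobi_sum = expand3 cubic_num - 3 * fps_X * expand3 (expand3 jacobi_sum)"
proof -
  have lf1: "loc_fin (theta 1 0)" by (simp add: loc_fin_theta)
  have lf: "loc_fin (theta 9 t)" "loc_fin (theta 3 t)" if "0 \<le> t" "t \<le> 3" for t using that by (simp_all add: loc_fin_theta)
  have lf9: "loc_fin (theta 9 t)" if "0 \<le> t" "t \<le> 9" for t using that by (simp_all add: loc_fin_theta)
  have "moment of_int (theta 1 0) = moment (\<lambda>k. of_int (3 * k)) (\<lambda>k. theta 1 0 (3 * k))
     + moment (\<lambda>k. of_int (3 * k + 1)) (\<lambda>k. theta 1 0 (3 * k + 1))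
     + moment (\<lambda>k. of_int (3 * k + 2)) (\<lambda>k. theta 1 0 (3 * k + 2))"
    unfolding moment_def by (rule fsum_mod_3[OF loc_fin_mult_left[OF lf1]])
  also have "(\<lambda>k. theta 1 0 (3 * k)) = theta 9 3"
    by (rule ext) (simp add: theta_def theta_exp_def triangular_3 sgn_fps_def)
  also have "(\<lambda>k. theta 1 0 (3 * k + 1)) = (\<lambda>k. - theta 9 6 k)"
    by (rule ext) (simp add: theta_def theta_exp_def triangular_3 sgn_fps_def)
  also have "(\<lambda>k. theta 1 0 (3 * k + 2)) = (\<lambda>k. fps_X * theta 9 9 k)"
  proof (rule ext)
    fix k
    have "0 \<le> 9 * triangular k + 9 * k" using theta_exp_ge(2)[of 9 9 k] by (simp add: theta_exp_def)
    then have "X_pow (9 * triangular k + 9 * k + 1) = fps_X * X_pow (9 * triangular k + 9 * k)"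
      by (simp add: X_pow_def nat_add_distrib)
    then show "theta 1 0 (3 * k + 2) = fps_X * theta 9 9 k"
      by (simp add: theta_def theta_exp_def triangular_3 sgn_fps_def)
  qed
  also have "moment (\<lambda>k. of_int (3 * k)) (theta 9 3) = - 3 * moment of_int (theta 9 6)"
  proof -
    have w: "of_int (3 * - n) = 0 * of_int n ^ 3 + 0 * of_int n ^ 2 + (-3) * of_int n + (0 :: complex)" for n by simp
    show ?thesis
      using moment_reindex[OF bij_neg, of "\<lambda>k. of_int (3 * k)" "theta 9 3"] theta_minus[of 9 3]
        moment_poly3[OF lf9[of 6] w] by (simp add: fps_const_lits del: fps_const_neg)
  qed
  also have "moment (\<lambda>k. of_int (3 * k + 1)) (\<lambda>k. - theta 9 6 k) = - (3 * moment of_int (theta 9 6) + moment (\<lambda>_. 1) (theta 9 6))"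
  proof -
    have w: "of_int (3 * n + 1) = 0 * of_int n ^ 3 + 0 * of_int n ^ 2 + 3 * of_int n + (1 :: complex)" for n by simp
    show ?thesis
      unfolding moment_uminus using moment_poly3[OF lf9[of 6] w] by (simp add: fps_const_lits del: fps_const_neg)
  qed
  also have "moment (\<lambda>k. of_int (3 * k + 2)) (\<lambda>k. fps_X * theta 9 9 k) = fps_X * (3 * moment of_int (theta 9 9) + 2 * moment (\<lambda>_. 1) (theta 9 9))"
  proof -
    have w: "of_int (3 * n + 2) = 0 * of_int n ^ 3 + 0 * of_int n ^ 2 + 3 * of_int n + (2 :: complex)" for n by simp
    show ?thesis
      using moment_cmult[OF lf9[of 9]] moment_poly3[OF lf9[of 9] w] by (simp add: fps_const_lits del: fps_const_neg)
  qed
  finally have J: "moment of_int (theta 1 0) = - 3 * moment of_int (theta 9 6) + - (3 * moment of_int (theta 9 6) + moment (\<lambda>_. 1) (theta 9 6))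
     + fps_X * (3 * moment of_int (theta 9 9) + 2 * moment (\<lambda>_. 1) (theta 9 9))" .
  have t96: "moment w (theta 9 6) = expand3 (moment w (theta 3 2))" and t99: "moment w (theta 9 9) = expand3 (moment w (theta 3 3))" for w
    using expand3_theta[of 3 2] expand3_theta[of 3 3] by (simp_all add: expand3_moment)
  have "moment of_int (theta 1 0) = - 3 * expand3 (moment of_int (theta 3 2)) - (3 * expand3 (moment of_int (theta 3 2)) + expand3 euler_fps)
     + fps_X * (3 * expand3 (expand3 jacobi_sum) + 2 * expand3 0)"
    unfolding J t96 t99 by (simp add: moment_th33_zero moment_id_th33 euler_fps_def)
  moreover have "expand3 0 = 0" by (simp add: expand3_def)
  ultimately show ?thesis
    by (simp add: jacobi_sum_def cubic_num_def expand3_add expand3_mult triangulareral algebra_simps)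
qed

text \<open>Divisors of 3m are either prime to 3, and these are the same for m, 3m and 9m, or three
  times a divisor of m.\<close>

lemma sigma_1_triple: "divisor_sigma 1 (9 * m) + 3 * divisor_sigma 1 m = 4 * divisor_sigma 1 (3 * m)"
  and sigma_1_triple': "\<not> 3 dvd m \<Longrightarrow> divisor_sigma 1 (3 * m) = 4 * divisor_sigma 1 m"
proof -
  have split: "divisor_sigma 1 (3 * m) = (\<Sum>d | d dvd 3 * m \<and> \<not> 3 dvd d. d) + 3 * divisor_sigma 1 m" for m
  proof (cases "m = 0")
    case False
    have fin: "finite {d. d dvd 3 * m}" using False by simp
    have "{d. d dvd 3 * m} = {d. d dvd 3 * m \<and> \<not> 3 dvd d} \<union> (*) 3 ` {d. d dvd m}" by auto
    then have "divisor_sigma 1 (3 * m) = sum id ({d. d dvd 3 * m \<and> \<not> 3 dvd d} \<union> (*) 3 ` {d. d dvd m})"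
      by (simp add: divisor_sigma_def)
    also have "\<dots> = sum id {d. d dvd 3 * m \<and> \<not> 3 dvd d} + sum id ((*) 3 ` {d. d dvd m})"
      using fin False by (intro sum.union_disjoint) auto
    also have "sum id ((*) 3 ` {d. d dvd m}) = 3 * divisor_sigma 1 m"
      by (subst sum.reindex) (auto simp: inj_on_def divisor_sigma_def sum_distrib_left)
    finally show ?thesis by simp
  next
    case True
    \<comment> \<open>At m = 0 both divisor sums range over all naturals and are 0 by convention;
      the remaining sum must be over an infinite set as well to be 0.\<close>
    have "{d::nat. \<not> 3 dvd d} \<supseteq> range (\<lambda>k. 3 * k + 1)" by (auto, presburger)
    moreover have "infinite (range (\<lambda>k::nat. 3 * k + 1))" by (rule range_inj_infinite) (simp add: inj_def)
    ultimately have "infinite {d::nat. \<not> 3 dvd d}" using infinite_super by blast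
    with True show ?thesis by (simp add: divisor_sigma_def)
  qed
  have eq: "{d. d dvd 9 * m \<and> \<not> 3 dvd d} = {d. d dvd 3 * m \<and> \<not> 3 dvd (d::nat)}"
       "{d. d dvd 3 * m \<and> \<not> 3 dvd d} = {d. d dvd m \<and> \<not> 3 dvd (d::nat)}" for m
  proof -
    have "d dvd 3 * k \<longleftrightarrow> d dvd k" if "\<not> 3 dvd d" for d k :: nat
    proof -
      have "coprime 3 d" using that by (simp add: prime_imp_coprime)
      then show ?thesis by (simp add: coprime_commute coprime_dvd_mult_right_iff)
    qed
    from this[of _ "3 * m"] this[of _ m] show "{d. d dvd 9 * m \<and> \<not> 3 dvd d} = {d. d dvd 3 * m \<and> \<not> 3 dvd (d::nat)}"
       "{d. d dvd 3 * m \<and> \<not> 3 dvd d} = {d. d dvd m \<and> \<not> 3 dvd (d::nat)}" by auto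
  qed
  show "divisor_sigma 1 (9 * m) + 3 * divisor_sigma 1 m = 4 * divisor_sigma 1 (3 * m)"
    using split[of "3 * m"] split[of m] by (simp add: eq)
  assume m: "\<not> 3 dvd m"
  have "{d. d dvd m \<and> \<not> 3 dvd d} = {d. d dvd m}" using m by (auto dest: dvd_trans)
  then show "divisor_sigma 1 (3 * m) = 4 * divisor_sigma 1 m"
    using split[of m] eq(2)[of m] by (simp add: divisor_sigma_def)
qed

lemma sigma_fps_trisection:
  "sigma_fps = expand3 (4 * sigma_fps - 3 * expand3 sigma_fps) + fps_X * expand3 (sigma_res 1 1) + fps_X ^ 2 * expand3 (sigma_res 1 2)"
proof (rule fps_ext)
  fix n :: nat
  have 0: "fps_nth (4 * sigma_fps - 3 * expand3 sigma_fps) k = of_nat (divisor_sigma 1 (3 * k))" for k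
  proof (cases "3 dvd k")
    case True
    then obtain m where m: "k = 3 * m" by (elim dvdE)
    have "of_nat (divisor_sigma 1 (9 * m) + 3 * divisor_sigma 1 m) = (of_nat (4 * divisor_sigma 1 (3 * m)) :: complex)"
      using sigma_1_triple by presburger
    then show ?thesis by (simp add: m expand3_nth sigma_fps_def numeral_fps_const algebra_simps)
  next
    case False
    then show ?thesis
      using arg_cong[OF sigma_1_triple'[OF False], of "of_nat :: nat \<Rightarrow> complex"]
      by (simp add: expand3_nth sigma_fps_def numeral_fps_const)
  qed
  consider k where "n = 3 * k" | k where "n = 3 * k + 1" | k where "n = 3 * k + 2"
  proof -
    have "n = 3 * (n div 3) \<or> n = 3 * (n div 3) + 1 \<or> n = 3 * (n div 3) + 2" by presburger
    then show thesis using that by blast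
  qed
  then show "fps_nth sigma_fps n = fps_nth (expand3 (4 * sigma_fps - 3 * expand3 sigma_fps) + fps_X * expand3 (sigma_res 1 1) + fps_X ^ 2 * expand3 (sigma_res 1 2)) n"
  proof cases
    case 1
    have "3 * k mod 3 = 0" "3 * k div 3 = k" "3 dvd 3 * k" by simp_all
    then show ?thesis unfolding 1 fps_add_nth expand3_nth[of "4 * sigma_fps - 3 * expand3 sigma_fps"] X_expand3_nth X2_expand3_nth
      by (simp add: 0 del: fps_sub_nth) (simp add: sigma_fps_def)
  next
    case 2
    have "(3 * k + 1) mod 3 = 1" "(3 * k + 1) div 3 = k" "\<not> 3 dvd 3 * k + 1" by presburger+
    then show ?thesis unfolding 2 fps_add_nth expand3_nth[of "4 * sigma_fps - 3 * expand3 sigma_fps"] X_expand3_nth X2_expand3_nth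
      by (simp add: sigma_fps_def sigma_res_def)
  next
    case 3
    have "(3 * k + 2) mod 3 = 2" "(3 * k + 2) div 3 = k" "\<not> 3 dvd 3 * k + 2" by presburger+
    then show ?thesis unfolding 3 fps_add_nth expand3_nth[of "4 * sigma_fps - 3 * expand3 sigma_fps"] X_expand3_nth X2_expand3_nth
      by (simp add: sigma_fps_def sigma_res_def)
  qed
qed

lemma core_fps_pent3: "core_fps * euler_fps = expand3 euler_fps ^ 3"
  by (simp add: core_fps_euler_fps jacobi_sum_eq expand3_power)

text \<open>After X -> X^3, \<open>core_fps_euler_fps\<close> rewrites the Jacobi series in X^9 as
  P(q^3) E(q^3), so both parts of the trisection share the factor E(q^3).\<close>

lemma pent3: "euler_fps ^ 3 = expand3 euler_fps * (expand3 cubic_a - 3 * fps_X * expand3 core_fps)"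
proof -
  have "euler_fps ^ 3 = expand3 cubic_num - 3 * fps_X * expand3 (core_fps * euler_fps)"
    using jacobi_sum_trisection by (simp add: jacobi_sum_eq core_fps_euler_fps)
  then show ?thesis by (simp add: cubic_num_eq expand3_mult algebra_simps)
qed

lemma expand3_euler_fps_nonzero: "expand3 euler_fps \<noteq> 0"
proof -
  have "fps_nth (expand3 euler_fps) 0 = 1" by (simp add: expand3_nth euler_fps_0)
  then show ?thesis by auto
qed

lemma qderiv_expand3_euler_fps: "qderiv (expand3 euler_fps) = - 3 * expand3 sigma_fps * expand3 euler_fps"
  using qderiv_expand3[of euler_fps] by (simp add: qderiv_euler_fps expand3_mult expand3_uminus)

lemma qderiv_pent3: "qderiv (euler_fps ^ 3) = - 3 * sigma_fps * euler_fps ^ 3"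
  using qderiv_jacobi_sum by (simp add: jacobi_sum_eq)

text \<open>Compare the parts of the logarithmic derivative of \<open>euler_fps ^ 3 / expand3 euler_fps\<close> in the
  residue classes \<open>0\<close> and \<open>1\<close> of the exponents modulo \<open>3\<close>.\<close>

lemma derivative_relations:
  "3 * qderiv cubic_a = (- 9 * sigma_fps + 9 * expand3 sigma_fps) * cubic_a + 27 * fps_X * core_fps ^ 3"
  "9 * qderiv core_fps + 3 * core_fps = 3 * core_fps * cubic_a ^ 2 + core_fps * (27 * expand3 sigma_fps - 27 * sigma_fps)"
proof -
  define b where "b = expand3 cubic_a - 3 * fps_X * expand3 core_fps"
  have pb: "euler_fps ^ 3 = expand3 euler_fps * b" by (simp add: pent3 b_def)
  have "expand3 euler_fps * qderiv b = qderiv (euler_fps ^ 3) - qderiv (expand3 euler_fps) * b"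
    unfolding pb qderiv_mult by simp
  also have "\<dots> = expand3 euler_fps * ((3 * expand3 sigma_fps - 3 * sigma_fps) * b)"
    unfolding qderiv_pent3 qderiv_expand3_euler_fps unfolding pb by (simp add: algebra_simps)
  finally have "qderiv b = (3 * expand3 sigma_fps - 3 * sigma_fps) * b"
    using expand3_euler_fps_nonzero by simp
  moreover have "qderiv b = 3 * expand3 (qderiv cubic_a) - 3 * fps_X * expand3 core_fps - 9 * fps_X * expand3 (qderiv core_fps)"
    by (simp add: b_def qderiv_diff qderiv_mult qderiv_X qderiv_numeral qderiv_expand3 algebra_simps)
  ultimately have *: "3 * expand3 (qderiv cubic_a) - 3 * fps_X * expand3 core_fps - 9 * fps_X * expand3 (qderiv core_fps) =
      (3 * expand3 sigma_fps - 3 * sigma_fps) * (expand3 cubic_a - 3 * fps_X * expand3 core_fps)"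
    by (simp add: b_def)
  have sigma_fps: "sigma_fps = expand3 (4 * sigma_fps - 3 * expand3 sigma_fps) + fps_X * expand3 (core_fps * cubic_a) + fps_X ^ 2 * expand3 (3 * core_fps ^ 2)"
    using sigma_fps_trisection unfolding sigma_res_1 sigma_res_2 .
  define s0 where "s0 = 4 * sigma_fps - 3 * expand3 sigma_fps"
  define U V A H S W Z where "U = expand3 (qderiv cubic_a)" and "V = expand3 (qderiv core_fps)" and "A = expand3 cubic_a" and "H = expand3 core_fps"
     and "S = expand3 sigma_fps" and "W = expand3 s0" and "Z = (fps_X :: complex fps)"
  have sig': "sigma_fps = W + Z * (H * A) + Z ^ 2 * (3 * H ^ 2)"
    using sigma_fps by (simp add: W_def s0_def H_def A_def Z_def expand3_mult expand3_power triangulareral)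
  have star: "3 * U - 3 * Z * H - 9 * Z * V = (3 * S - 3 * sigma_fps) * (A - 3 * Z * H)"
    using * by (simp add: U_def V_def A_def H_def S_def Z_def)
  \<comment> \<open>The two contributions with \<open>Z ^ 2\<close> cancel, and the one with
    \<open>Z ^ 3\<close> is a series in X^3 that joins residue class 0; it yields the term 27 X
    P^3.\<close>
  have poly: "3 * U + Z * (- 3 * H - 9 * V) + Z ^ 2 * 0 =
     ((3 * S - 3 * W) * A + 27 * Z ^ 3 * H ^ 3) + Z * (- 3 * H * A ^ 2 - 3 * H * (3 * S - 3 * W)) + Z ^ 2 * 0"
  proof -
    have "3 * U + Z * (- 3 * H - 9 * V) + Z ^ 2 * 0 = (3 * S - 3 * sigma_fps) * (A - 3 * Z * H)"
      unfolding star[symmetric] by (simp add: algebra_simps)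
    also have "\<dots> = (3 * S - 3 * (W + Z * (H * A) + Z ^ 2 * (3 * H ^ 2))) * (A - 3 * Z * H)"
      using sig' by (rule arg_cong)
    also have "\<dots> = ((3 * S - 3 * W) * A + 27 * Z ^ 3 * H ^ 3)
        + Z * (- 3 * H * A ^ 2 - 3 * H * (3 * S - 3 * W)) + Z ^ 2 * 0"
      by (simp add: algebra_simps power2_eq_square power3_eq_cube)
    finally show ?thesis .
  qed
  have t0: "expand3 0 = 0" by (simp add: expand3_def)
  have "expand3 (3 * qderiv cubic_a) + fps_X * expand3 (- 3 * core_fps - 9 * qderiv core_fps) + fps_X ^ 2 * expand3 0 =
     expand3 ((3 * sigma_fps - 3 * s0) * cubic_a + 27 * fps_X * core_fps ^ 3)
     + fps_X * expand3 (- 3 * core_fps * cubic_a ^ 2 - 3 * core_fps * (3 * sigma_fps - 3 * s0)) + fps_X ^ 2 * expand3 0"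
    unfolding expand3_mult expand3_power triangulareral expand3_add expand3_diff expand3_uminus expand3_X t0
    unfolding U_def[symmetric] V_def[symmetric] A_def[symmetric] H_def[symmetric] S_def[symmetric]
      W_def[symmetric] Z_def[symmetric] by (rule poly)
  from trisect_eq(1,2)[OF this]
  have "3 * qderiv cubic_a = (3 * sigma_fps - 3 * s0) * cubic_a + 27 * fps_X * core_fps ^ 3"
    "- 3 * core_fps - 9 * qderiv core_fps = - 3 * core_fps * cubic_a ^ 2 - 3 * core_fps * (3 * sigma_fps - 3 * s0)" by simp_all
  note rel = this
  show "3 * qderiv cubic_a = (- 9 * sigma_fps + 9 * expand3 sigma_fps) * cubic_a + 27 * fps_X * core_fps ^ 3"
    unfolding rel(1) s0_def by (simp add: algebra_simps)
  have "9 * qderiv core_fps + 3 * core_fps = - (- 3 * core_fps - 9 * qderiv core_fps)" by simp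
  also have "\<dots> = 3 * core_fps * cubic_a ^ 2 + core_fps * (27 * expand3 sigma_fps - 27 * sigma_fps)"
    unfolding rel(2) s0_def by (simp add: algebra_simps)
  finally show "9 * qderiv core_fps + 3 * core_fps = 3 * core_fps * cubic_a ^ 2 + core_fps * (27 * expand3 sigma_fps - 27 * sigma_fps)" .
qed

lemma qderiv_core_fps: "qderiv core_fps = core_fps * (sigma_fps - 9 * expand3 sigma_fps)"
proof -
  have "qderiv (expand3 euler_fps ^ 3) = - 9 * expand3 sigma_fps * expand3 euler_fps ^ 3"
  proof -
    have "qderiv (expand3 euler_fps ^ 3) = 3 * expand3 euler_fps ^ 2 * qderiv (expand3 euler_fps)" by (simp add: qderiv_power)
    then show ?thesis unfolding qderiv_expand3_euler_fps by (simp add: power3_eq_cube power2_eq_square)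
  qed
  then have "qderiv (core_fps * euler_fps) = - 9 * expand3 sigma_fps * (core_fps * euler_fps)" by (simp add: core_fps_pent3)
  then have "qderiv core_fps * euler_fps = (core_fps * (sigma_fps - 9 * expand3 sigma_fps)) * euler_fps"
    by (simp add: qderiv_mult qderiv_euler_fps algebra_simps)
  then show ?thesis using euler_fps_nonzero by simp
qed

lemma core_fps_nonzero: "core_fps \<noteq> 0"
  using core_fps_pent3 expand3_euler_fps_nonzero by auto

text \<open>Two expressions for the derivative of P are equated: the one from residue class 1 and
  the logarithmic derivative of E(q^3)^3 / E. Then 3 P is cancelled.\<close>

lemma cubic_a_square: "cubic_a ^ 2 = 1 + 12 * sigma_fps - 36 * expand3 sigma_fps"
proof -
  have "(3 * core_fps) * cubic_a ^ 2 = (3 * core_fps) * (1 + 12 * sigma_fps - 36 * expand3 sigma_fps)"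
  proof -
    have "(3 * core_fps) * cubic_a ^ 2 = (9 * qderiv core_fps + 3 * core_fps) - core_fps * (27 * expand3 sigma_fps - 27 * sigma_fps)"
      unfolding derivative_relations(2) by simp
    then show ?thesis unfolding qderiv_core_fps by (simp add: algebra_simps)
  qed
  then show ?thesis unfolding mult_cancel_left using core_fps_nonzero by simp
qed

lemma qderiv_cubic_a: "qderiv cubic_a = (3 * expand3 sigma_fps - 3 * sigma_fps) * cubic_a + 9 * fps_X * core_fps ^ 3"
proof -
  have "3 * qderiv cubic_a = 3 * ((3 * expand3 sigma_fps - 3 * sigma_fps) * cubic_a + 9 * fps_X * core_fps ^ 3)"
    unfolding derivative_relations(1) by (simp add: algebra_simps)
  then show ?thesis unfolding mult_cancel_left by simp
qed

lemma cubic_a_0: "fps_nth cubic_a 0 = 1"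
proof -
  have "fps_nth (moment of_int (theta 3 2)) 0 = (\<Sum>l\<in>{-1..1}. fps_nth (fps_const (of_int l) * theta 3 2 l) 0)"
    unfolding moment_def
  proof (rule fsum_nth)
    fix l assume "fps_nth (fps_const (of_int l) * theta 3 2 l) 0 \<noteq> 0"
    then have "theta_exp 3 2 l = 0" using theta_exp_ge(2)[of 3 2 l] by (auto simp: theta_def sgn_fps_nth X_pow_nth split: if_splits)
    then show "l \<in> {-1..1}" using theta_exp_ge(1)[of 3 2 l] by auto
  qed simp
  also have "{-1..1::int} = {-1, 0, 1}" by auto
  also have "(\<Sum>l\<in>{-1,0,1}. fps_nth (fps_const (of_int l) * theta 3 2 l) 0) = 0"
    by (simp add: theta_def sgn_fps_nth theta_exp_def triangular_def X_pow_def)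
  finally have "fps_nth cubic_num 0 = 1" by (simp add: cubic_num_def euler_fps_0 numeral_fps_const)
  moreover have "fps_nth cubic_num 0 = fps_nth cubic_a 0 * fps_nth euler_fps 0" by (subst cubic_num_eq) simp
  ultimately show ?thesis by (simp add: euler_fps_0)
qed

text \<open>The cubic identity \<open>a\<^sup>3 = b\<^sup>3 + c\<^sup>3\<close> of the Borweins: both sides solve the same differential
  equation.\<close>

lemma cubic_identity: "(cubic_a ^ 3 - 27 * fps_X * core_fps ^ 3) * expand3 euler_fps ^ 3 = euler_fps ^ 9"
proof (rule qderiv_unique)
  let ?v = "cubic_a ^ 3 - 27 * fps_X * core_fps ^ 3"
  have 1: "qderiv (cubic_a ^ 3) = 3 * cubic_a ^ 2 * qderiv cubic_a" "qderiv (core_fps ^ 3) = 3 * core_fps ^ 2 * qderiv core_fps"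
    "qderiv (expand3 euler_fps ^ 3) = 3 * expand3 euler_fps ^ 2 * qderiv (expand3 euler_fps)" "qderiv (euler_fps ^ 9) = 9 * euler_fps ^ 8 * qderiv euler_fps"
    by (simp_all add: qderiv_power)
  have 2: "qderiv (?v * expand3 euler_fps ^ 3) = (3 * cubic_a ^ 2 * qderiv cubic_a - 27 * (fps_X * core_fps ^ 3 + fps_X * (3 * core_fps ^ 2 * qderiv core_fps))) * expand3 euler_fps ^ 3
      + ?v * (3 * expand3 euler_fps ^ 2 * qderiv (expand3 euler_fps))"
    by (simp add: qderiv_mult qderiv_diff 1 qderiv_X qderiv_numeral algebra_simps)
  show "qderiv (?v * expand3 euler_fps ^ 3) = (- 9 * sigma_fps) * (?v * expand3 euler_fps ^ 3)"
  proof -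
    \<comment> \<open>Once the derivatives are substituted, the defect in the differential equation
      is a multiple of a^2 - (1 + 12 s - 36 S), which is zero by
      \<open>cubic_a_square\<close>.\<close>
    have "(3 * a ^ 2 * ((3 * S - 3 * s) * a + 9 * x * h ^ 3) - 27 * (x * h ^ 3 + x * (3 * h ^ 2 * (h * (s - 9 * S))))) * t ^ 3
      + (a ^ 3 - 27 * x * h ^ 3) * (3 * t ^ 2 * (- 3 * S * t))
      = - 9 * s * ((a ^ 3 - 27 * x * h ^ 3) * t ^ 3) + 27 * x * h ^ 3 * t ^ 3 * (a ^ 2 - (1 + 12 * s - 36 * S))"
      for a h s S t x :: "complex fps"
      by (simp add: algebra_simps power2_eq_square power3_eq_cube)
    note poly = this
    show ?thesis unfolding 2 qderiv_cubic_a qderiv_core_fps qderiv_expand3_euler_fps unfolding poly unfolding cubic_a_square by simp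
  qed
  show "qderiv (euler_fps ^ 9) = (- 9 * sigma_fps) * euler_fps ^ 9"
  proof -
    have "euler_fps ^ 9 = euler_fps ^ 8 * euler_fps" using power_add[of euler_fps 8 1] by simp
    then show ?thesis unfolding 1 qderiv_euler_fps by (simp add: mult_ac)
  qed
  show "fps_nth (- 9 * sigma_fps) 0 = 0" by (simp add: sigma_fps_def divisor_sigma_def fps_mult_nth)
  show "fps_nth (?v * expand3 euler_fps ^ 3) 0 = fps_nth (euler_fps ^ 9) 0"
    by (simp add: fps_power_zeroth euler_fps_0 cubic_a_0 expand3_nth numeral_fps_const)
qed

text \<open>\<open>qderiv_cubic_a\<close> and \<open>cubic_a_square\<close> remove the derivative
  and sigma_1 from \<open>twist_moment_3\<close>. Multiplying by E turns P E into E(q^3)^3, the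
  factor that the cubic identity needs.\<close>

lemma sigma_3_identity: "sigma_res 3 1 = euler_fps ^ 8 + 81 * fps_X * core_fps ^ 4"
proof -
  have "2 * twist_moment 3 = core_fps * (3 * cubic_a ^ 3 + 12 * qderiv cubic_a + 24 * cubic_a * sigma_fps - cubic_a)" by (rule twist_moment_3)
  also have "\<dots> = core_fps * (3 * cubic_a ^ 3 + 108 * fps_X * core_fps ^ 3 - cubic_a * (1 + 12 * sigma_fps - 36 * expand3 sigma_fps))"
    unfolding qderiv_cubic_a by (simp add: algebra_simps)
  also have "\<dots> = 2 * (core_fps * (cubic_a ^ 3 + 54 * fps_X * core_fps ^ 3))"
    unfolding cubic_a_square[symmetric] by (simp add: algebra_simps power2_eq_square power3_eq_cube)
  finally have k: "twist_moment 3 = core_fps * (cubic_a ^ 3 + 54 * fps_X * core_fps ^ 3)"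
    unfolding mult_cancel_left by simp
  have "twist_moment 3 * euler_fps = (cubic_a ^ 3 - 27 * fps_X * core_fps ^ 3) * (core_fps * euler_fps) + 81 * fps_X * core_fps ^ 3 * (core_fps * euler_fps)"
    unfolding k by (simp add: algebra_simps)
  also have "(cubic_a ^ 3 - 27 * fps_X * core_fps ^ 3) * (core_fps * euler_fps) = euler_fps ^ 8 * euler_fps"
    unfolding core_fps_pent3 cubic_identity using power_add[of euler_fps 8 1] by simp
  also have "euler_fps ^ 8 * euler_fps + 81 * fps_X * core_fps ^ 3 * (core_fps * euler_fps) = (euler_fps ^ 8 + 81 * fps_X * (core_fps ^ 3 * core_fps)) * euler_fps"
    by (simp add: algebra_simps)
  also have "core_fps ^ 3 * core_fps = core_fps ^ 4" using power_add[of core_fps 3 1] by simp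
  finally have "twist_moment 3 * euler_fps = (euler_fps ^ 8 + 81 * fps_X * core_fps ^ 4) * euler_fps" .
  then show ?thesis unfolding sigma_res_3 using euler_fps_nonzero by simp
qed

section \<open>The lattice of 3-cores\<close>

text \<open>The exponents of the coefficient of \<open>z\<^sup>0\<close> in the product of the theta functions of base \<open>X\<^sup>3\<close> at
  \<open>z\<close>, \<open>X z\<close> and \<open>X\<^sup>2 z\<close>.\<close>

definition core_exp :: "int \<times> int \<Rightarrow> int" where
  "core_exp = (\<lambda>(i, j). theta_exp 3 0 i + theta_exp 3 1 j + theta_exp 3 2 (- i - j))"

lemma core_exp_nonneg: "0 \<le> core_exp p"
  using theta_exp_ge(2)[of 3 0] theta_exp_ge(2)[of 3 1] theta_exp_ge(2)[of 3 2] by (auto simp: core_exp_def case_prod_unfold)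

text \<open>Replacing z by X z permutes the three theta factors cyclically, up to quasi-periodicity,
  so their product is a multiple of the theta function with base X. Derivatives at z = 1, where only
  the factor at z vanishes, identify the multiple as E(q^3)^3 E^2 / E^3 = P. For total index 0 the
  signs cancel.\<close>

lemma core_exp_series: "loc_fin (\<lambda>p. X_pow (core_exp p))" "fsum (\<lambda>p. X_pow (core_exp p)) = core_fps"
proof -
  define D where "D = convolve (theta 3 1) (theta 3 2)"
  define G where "G = convolve (theta 3 0) D"
  have lf: "loc_fin (theta 3 0)" "loc_fin (theta 3 1)" "loc_fin (theta 3 2)" by (simp_all add: loc_fin_theta)
  have lfD: "loc_fin D" unfolding D_def by (intro loc_fin_convolve lf)
  define T where "T = (\<lambda>m (i, j). theta 3 0 i * (theta 3 1 j * theta 3 2 (m - i - j)))"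
  have lfT: "loc_fin (T m)" for m
  proof -
    have "T m = (\<lambda>p. (case p of (i, j) \<Rightarrow> theta 3 0 i * theta 3 1 j) * theta 3 2 (m - fst p - snd p))"
      by (auto simp: T_def mult.assoc)
    then show ?thesis using loc_fin_mult_right[OF loc_fin_times[OF lf(1,2)]] by simp
  qed
  have G: "G m = fsum (T m)" for m
  proof -
    have lfi: "loc_fin (\<lambda>j. theta 3 1 j * theta 3 2 (m - i - j))" for i by (intro loc_fin_mult_right lf)
    have "G m = fsum (\<lambda>i. fsum (\<lambda>j. theta 3 0 i * (theta 3 1 j * theta 3 2 (m - i - j))))"
      unfolding G_def convolve_def D_def fsum_mult_left[OF lfi] ..
    also have "\<dots> = fsum (T m)"
      unfolding T_def by (rule fsum_nested(1)) (use lfT[of m] in \<open>simp add: T_def\<close>)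
    finally show ?thesis .
  qed
  have "G m = G 0 * theta 1 0 m" for m
  proof (rule theta_rec_unique)
    fix m A B :: int assume AB: "0 \<le> A" "0 \<le> B" "A - B = 1 * m + 0"
    \<comment> \<open>The index k = m - i - j of the factor at X^2 z moves to the factor at z and is
      raised by 1 by quasi-periodicity; i and j move to the next factors.\<close>
    let ?g = "\<lambda>(i, j). (m - i - j + 1, i)"
    have bij: "bij ?g"
      by (rule bij_betw_byWitness[where f' = "\<lambda>(k, i). (i, m - i - k + 1)"]) auto
    have "X_pow B * T (m + 1) (?g p) = - (X_pow A * T m p)" for p
    proof -
      obtain i j where p: "p = (i, j)" by fastforce
      define k where "k = m - i - j"
      have ge: "0 \<le> theta_exp 3 t l" if "0 \<le> t" "t \<le> 3" for t l using theta_exp_ge(2)[of 3 t l] that by simp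
      have "X_pow B * T (m + 1) (?g p) = sgn_fps (k + 1) * sgn_fps i * sgn_fps j * (X_pow B * (X_pow (theta_exp 3 0 (k + 1)) * (X_pow (theta_exp 3 1 i) * X_pow (theta_exp 3 2 j))))"
        by (simp add: T_def p theta_def k_def mult_ac)
      also have "\<dots> = - (sgn_fps k * sgn_fps i * sgn_fps j) * X_pow (B + (theta_exp 3 0 (k + 1) + (theta_exp 3 1 i + theta_exp 3 2 j)))"
        using AB ge by (simp add: X_pow_add sgn_fps_Suc)
      also have "B + (theta_exp 3 0 (k + 1) + (theta_exp 3 1 i + theta_exp 3 2 j)) = A + (theta_exp 3 0 i + (theta_exp 3 1 j + theta_exp 3 2 k))"
        unfolding theta_exp_def triangular_Suc using AB(3) by (simp add: k_def algebra_simps)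
      also have "- (sgn_fps k * sgn_fps i * sgn_fps j) * X_pow (A + (theta_exp 3 0 i + (theta_exp 3 1 j + theta_exp 3 2 k))) =
          - (sgn_fps k * sgn_fps i * sgn_fps j * (X_pow A * (X_pow (theta_exp 3 0 i) * (X_pow (theta_exp 3 1 j) * X_pow (theta_exp 3 2 k)))))"
        using AB ge by (simp add: X_pow_add)
      also have "\<dots> = - (X_pow A * T m p)"
        by (simp add: T_def p theta_def k_def mult_ac)
      finally show ?thesis .
    qed
    then have "fsum (\<lambda>p. X_pow B * T (m + 1) (?g p)) = - fsum (\<lambda>p. X_pow A * T m p)"
      by (simp only: fsum_uminus)
    moreover have "fsum (\<lambda>p. X_pow B * T (m + 1) (?g p)) = X_pow B * G (m + 1)"
      using fsum_reindex[OF bij, of "\<lambda>p. X_pow B * T (m + 1) p"] by (simp only: G fsum_mult_left[OF lfT])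
    moreover have "fsum (\<lambda>p. X_pow A * T m p) = X_pow A * G m"
      by (simp only: G fsum_mult_left[OF lfT])
    ultimately show "X_pow B * G (m + 1) + X_pow A * G m = 0" by simp
  qed auto
  then have Gm: "G = (\<lambda>m. G 0 * theta 1 0 m)" by blast
  have "moment of_int G = - (G 0 * jacobi_sum)"
  proof -
    have "moment of_int G = moment of_int (\<lambda>m. G 0 * theta 1 0 m)" using Gm by simp
    then show ?thesis by (simp add: moment_cmult loc_fin_theta jacobi_sum_def)
  qed
  moreover have "moment of_int G = - (expand3 jacobi_sum * (euler_fps * euler_fps))"
  proof -
    have "moment (\<lambda>_. 1) D = euler_fps * euler_fps"
      unfolding D_def using moment_convolve_binomial[OF lf(2,3), of of_int of_int of_int 0]
      by (simp add: moment_1_th31 euler_fps_def)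
    then show ?thesis
      unfolding G_def using moment_convolve_binomial[OF lf(1) lfD, of of_int of_int of_int 1]
      by (simp add: moment_theta_zero moment_id_th30)
  qed
  ultimately have GJ: "G 0 * jacobi_sum = expand3 jacobi_sum * (euler_fps * euler_fps)" by simp
  have "G 0 * euler_fps ^ 3 = expand3 jacobi_sum * (euler_fps * euler_fps)" using GJ by (simp only: jacobi_sum_eq)
  also have "\<dots> = core_fps * euler_fps ^ 3"
    unfolding core_fps_euler_fps[symmetric] by (simp add: power3_eq_cube mult.assoc)
  finally have "G 0 * euler_fps ^ 3 = core_fps * euler_fps ^ 3" .
  then have "G 0 = core_fps" using euler_fps_nonzero by simp
  moreover have "T 0 = (\<lambda>p. X_pow (core_exp p))"
  proof
    fix p :: "int \<times> int"
    obtain i j where p: "p = (i, j)" by fastforce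
    have ge: "0 \<le> theta_exp 3 t l" if "0 \<le> t" "t \<le> 3" for t l using theta_exp_ge(2)[of 3 t l] that by simp
    have "sgn_fps i * (sgn_fps j * sgn_fps (- i - j)) = 1" by (simp add: sgn_fps_def)
    then have "T 0 p = 1 * (X_pow (theta_exp 3 0 i) * (X_pow (theta_exp 3 1 j) * X_pow (theta_exp 3 2 (- i - j))))"
      by (simp add: T_def p theta_def mult_ac)
    then show "T 0 p = X_pow (core_exp p)"
      using ge by (simp add: X_pow_add p core_exp_def add.assoc)
  qed
  ultimately show "loc_fin (\<lambda>p. X_pow (core_exp p))" "fsum (\<lambda>p. X_pow (core_exp p)) = core_fps"
    using G[of 0] lfT[of 0] by simp_all
qed

lemma finite_core_exp: "finite {p. core_exp p = int N}"
  and core_fps_nth: "fps_nth core_fps N = of_nat (card {p. core_exp p = int N})"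
proof -
  have eq: "{p. fps_nth (X_pow (core_exp p)) N \<noteq> 0} = {p. core_exp p = int N}"
    using core_exp_nonneg by (auto simp: X_pow_nth)
  show "finite {p. core_exp p = int N}"
    using core_exp_series(1) unfolding loc_fin_def eq[symmetric] by blast
  have "fps_nth core_fps N = (\<Sum>p | core_exp p = int N. fps_nth (X_pow (core_exp p)) N)"
    unfolding core_exp_series(2)[symmetric] by (simp add: fsum_def eq)
  also have "\<dots> = of_nat (card {p. core_exp p = int N})"
    using core_exp_nonneg by (simp add: X_pow_nth)
  finally show "fps_nth core_fps N = of_nat (card {p. core_exp p = int N})" .
qed

text \<open>A \<open>3\<close>-core with residue counts \<open>(0, c, d)\<close> is padded with zero parts until the number of
  parts is a multiple \<open>3 m\<close>; the padding rotates the counts, and subtracting \<open>m\<close> makes them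
  sum to \<open>0\<close>.\<close>

definition pad :: "nat \<times> nat \<Rightarrow> int \<times> int" where
  "pad = (\<lambda>(c, d). let m = (int c + int d) div 3; r = (int c + int d) mod 3 in
     if r = 0 then (- m, int c - m) else if r = 1 then (int c - m, int d - m) else (int d - m, - m - 1))"

text \<open>The least of the three counts, the earliest one in a tie, belongs to the residue class
  that was empty before padding. Rotating it to the front removes 1 from each count that wraps
  around.\<close>

definition unpad :: "int \<times> int \<Rightarrow> nat \<times> nat" where
  "unpad = (\<lambda>(i, j). let k = - i - j in
     if i \<le> j \<and> i \<le> k then (nat (j - i), nat (k - i))
     else if j < i \<and> j \<le> k then (nat (k - j), nat (i - j - 1))
     else (nat (i - k - 1), nat (j - k - 1)))"

lemma pad_eq:
  "int c + int d = 3 * m \<Longrightarrow> pad (c, d) = (- m, int c - m)"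
  "int c + int d = 3 * m + 1 \<Longrightarrow> pad (c, d) = (int c - m, int d - m)"
  "int c + int d = 3 * m + 2 \<Longrightarrow> pad (c, d) = (int d - m, - m - 1)"
  by (simp_all add: pad_def Let_def)

lemma bij_pad: "bij pad"
proof (rule bij_betw_byWitness[where f' = unpad])
  have *: "unpad (pad (c, d)) = (c, d)" for c d
  proof -
    define m where "m = (int c + int d) div 3"
    have "int c + int d = 3 * m \<or> int c + int d = 3 * m + 1 \<or> int c + int d = 3 * m + 2"
      unfolding m_def by presburger
    then consider "int c + int d = 3 * m" | "int c + int d = 3 * m + 1" | "int c + int d = 3 * m + 2" by blast
    then show ?thesis
    proof cases
      case 1
      then have p: "pad (c, d) = (- m, int c - m)" by (rule pad_eq)
      have k: "- (- m) - (int c - m) = int d - m" using 1 by simp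
      show ?thesis unfolding p unpad_def Let_def prod.case k by simp
    next
      case 2
      then have p: "pad (c, d) = (int c - m, int d - m)" by (rule pad_eq)
      have k: "- (int c - m) - (int d - m) = - m - 1" using 2 by simp
      show ?thesis unfolding p unpad_def Let_def prod.case k by simp
    next
      case 3
      then have p: "pad (c, d) = (int d - m, - m - 1)" by (rule pad_eq)
      have k: "- (int d - m) - (- m - 1) = int c - m - 1" using 3 by simp
      show ?thesis unfolding p unpad_def Let_def prod.case k by simp
    qed
  qed
  then show "\<forall>p\<in>UNIV. unpad (pad p) = p" by auto
  have "pad (unpad (i, j)) = (i, j)" for i j
  proof -
    define k where "k = - i - j"
    consider "i \<le> j" "i \<le> k" | "j < i" "j \<le> k" | "k < i" "k < j" by linarith
    then show ?thesis
    proof cases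
      case 1
      then have "int (nat (j - i)) + int (nat (k - i)) = 3 * (- i)" unfolding k_def by simp
      from pad_eq(1)[OF this] have "pad (nat (j - i), nat (k - i)) = (i, j)" using 1 by simp
      with 1 show ?thesis by (simp add: unpad_def k_def Let_def)
    next
      case 2
      then have "int (nat (k - j)) + int (nat (i - j - 1)) = 3 * (- j - 1) + 2" unfolding k_def by simp
      from pad_eq(3)[OF this] have "pad (nat (k - j), nat (i - j - 1)) = (i, j)" using 2 by simp
      with 2 show ?thesis by (simp add: unpad_def k_def Let_def)
    next
      case 3
      then have "int (nat (i - k - 1)) + int (nat (j - k - 1)) = 3 * (- k - 1) + 1" unfolding k_def by simp
      from pad_eq(2)[OF this] have "pad (nat (i - k - 1), nat (j - k - 1)) = (i, j)" using 3 by simp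
      with 3 show ?thesis by (simp add: unpad_def k_def Let_def)
    qed
  qed
  then show "\<forall>p\<in>UNIV. pad (unpad p) = p" by auto
qed auto

lemma core_exp_pad: "core_exp (pad (c, d)) = int c ^ 2 - int c * int d + int d ^ 2 + int d"
proof -
  define m where "m = (int c + int d) div 3"
  have E: "2 * core_exp (i, j) = 3 * i * (i - 1) + 3 * j * (j - 1) + 2 * j
      + 3 * (- i - j) * (- i - j - 1) + 4 * (- i - j)" for i j
    using triangular_2[of i] triangular_2[of j] triangular_2[of "- i - j"]
    by (simp add: core_exp_def theta_exp_def algebra_simps)
  have "int c + int d = 3 * m \<or> int c + int d = 3 * m + 1 \<or> int c + int d = 3 * m + 2"
    unfolding m_def by presburger
  then consider "int c + int d = 3 * m" | "int c + int d = 3 * m + 1" | "int c + int d = 3 * m + 2" by blast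
  then have "2 * core_exp (pad (c, d)) = 2 * (int c ^ 2 - int c * int d + int d ^ 2 + int d)"
  proof cases
    case 1
    then have "pad (c, d) = (- m, int c - m)" by (rule pad_eq)
    moreover have "int d = 3 * m - int c" using 1 by simp
    ultimately show ?thesis by (simp only: E) (simp add: algebra_simps power2_eq_square)
  next
    case 2
    then have "pad (c, d) = (int c - m, int d - m)" by (rule pad_eq)
    moreover have "int d = 3 * m + 1 - int c" using 2 by simp
    ultimately show ?thesis by (simp only: E) (simp add: algebra_simps power2_eq_square)
  next
    case 3
    then have "pad (c, d) = (int d - m, - m - 1)" by (rule pad_eq)
    moreover have "int d = 3 * m + 2 - int c" using 3 by simp
    ultimately show ?thesis by (simp only: E) (simp add: algebra_simps power2_eq_square)
  qed
  then show ?thesis by simp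
qed

text \<open>The form c^2 - c d + d^2 + d will be the size of the 3-core with counts (0, c, d); its
  negative term is moved across to stay in the naturals.\<close>

lemma core_fps_nth_pairs:
  "finite {(c, d). c * c + d * d + d = N + c * (d :: nat)}"
  "fps_nth core_fps N = of_nat (card {(c, d). c * c + d * d + d = N + c * (d :: nat)})"
proof -
  let ?T = "{(c, d). c * c + d * d + d = N + c * (d :: nat)}"
  have "core_exp (pad (c, d)) = int N \<longleftrightarrow> c * c + d * d + d = N + c * d" for c d
  proof -
    have "core_exp (pad (c, d)) = int N \<longleftrightarrow> int (c * c + d * d + d) = int (N + c * d)"
      unfolding core_exp_pad by (auto simp: power2_eq_square)
    then show ?thesis by (simp only: of_nat_eq_iff)
  qed
  then have T: "?T = {p. core_exp (pad p) = int N}" by auto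
  have "bij_betw pad ?T {p. core_exp p = int N}"
    unfolding T bij_betw_def
  proof
    show "inj_on pad {p. core_exp (pad p) = int N}"
      using bij_is_inj[OF bij_pad] by (rule inj_on_subset) simp
    show "pad ` {p. core_exp (pad p) = int N} = {p. core_exp p = int N}"
    proof (intro equalityI subsetI)
      fix q assume q: "q \<in> {p. core_exp p = int N}"
      obtain p where "q = pad p" using surjD[OF bij_is_surj[OF bij_pad]] by blast
      with q show "q \<in> pad ` {p. core_exp (pad p) = int N}" by blast
    qed auto
  qed
  note bij = this
  show "finite ?T" using bij_betw_finite[OF bij] finite_core_exp by blast
  show "fps_nth core_fps N = of_nat (card ?T)" using bij_betw_same_card[OF bij] core_fps_nth by simp
qed

section \<open>Beta sets\<close>

text \<open>For a partition this is the hook length of the cell (i, 0), so \<open>beta\<close> is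
  the set of first-column hook lengths.\<close>

definition bead :: "nat list \<Rightarrow> nat \<Rightarrow> nat" where
  "bead p i = p ! i + (length p - 1 - i)"

definition beta :: "nat list \<Rightarrow> nat set" where
  "beta p = bead p ` {..<length p}"

lemma partition_antimono: "is_partition p \<Longrightarrow> i \<le> j \<Longrightarrow> j < length p \<Longrightarrow> p ! j \<le> p ! i"
  by (cases "i = j") (auto simp: is_partition_def sorted_wrt_iff_nth_less)

lemma bead_less: "is_partition p \<Longrightarrow> i < j \<Longrightarrow> j < length p \<Longrightarrow> bead p j < bead p i"
  using partition_antimono[of p i j] by (simp add: bead_def)

lemma bead_inj: "is_partition p \<Longrightarrow> inj_on (bead p) {..<length p}"
proof (rule inj_onI)
  fix i j assume p: "is_partition p" and ij: "i \<in> {..<length p}" "j \<in> {..<length p}" "bead p i = bead p j"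
  consider "i < j" | "j < i" | "i = j" by linarith
  then show "i = j"
    using bead_less[OF p, of i j] bead_less[OF p, of j i] ij by cases auto
qed

definition col_len :: "nat list \<Rightarrow> nat \<Rightarrow> nat" where
  "col_len p j = card {k. k < length p \<and> j < p ! k}"

lemma col_len_eq:
  assumes "is_partition p"
  shows "{k. k < length p \<and> j < p ! k} = {..<col_len p j}"
proof -
  let ?S = "{k. k < length p \<and> j < p ! k}"
  have fin: "finite ?S" by simp
  have down: "k \<in> ?S" if "k' \<in> ?S" "k \<le> k'" for k k'
    using that partition_antimono[OF assms, of k k'] by auto
  show ?thesis
  proof (cases "?S = {}")
    case True
    then show ?thesis unfolding col_len_def by (simp only: True card.empty lessThan_0)
  next
    case False
    define M where "M = Suc (Max ?S)"
    have S: "?S = {..<M}"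
    proof (rule set_eqI)
      fix k
      have "k \<in> ?S \<longleftrightarrow> k \<le> Max ?S"
        using down[OF Max_in[OF fin False], of k] Max_ge[OF fin, of k] by metis
      then show "k \<in> ?S \<longleftrightarrow> k \<in> {..<M}"
        unfolding M_def lessThan_iff less_Suc_eq_le .
    qed
    show ?thesis unfolding col_len_def S card_lessThan ..
  qed
qed

lemma col_len_iff: "is_partition p \<Longrightarrow> k < col_len p j \<longleftrightarrow> k < length p \<and> j < p ! k"
  using col_len_eq[of p j] by blast

text \<open>The gaps enumerate the complement of the beta set, and the hook lengths of row \<open>i\<close> are the
  differences between the \<open>i\<close>-th bead and the gaps below it.\<close>

definition gap :: "nat list \<Rightarrow> nat \<Rightarrow> nat" where
  "gap p j = j + length p - col_len p j"

lemma col_len_le: "is_partition p \<Longrightarrow> col_len p j \<le> length p"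
  using col_len_iff[of p "length p" j] by auto

lemma hook_length_eq:
  assumes p: "is_partition p" and i: "i < length p" and j: "j < p ! i"
  shows "hook_length p i j = bead p i - gap p j" "gap p j < bead p i"
proof -
  let ?A = "(\<lambda>l. (i, l)) ` {j..<p ! i}" and ?B = "(\<lambda>k. (k, j)) ` {i<..<col_len p j}"
  have ic: "i < col_len p j" using col_len_iff[OF p] i j by simp
  have "{(k, l) \<in> young_diagram p. (k = i \<and> j \<le> l) \<or> (l = j \<and> i \<le> k)} = ?A \<union> ?B"
    using i j col_len_iff[OF p] by (auto simp: young_diagram_def image_iff)
  then have "hook_length p i j = card (?A \<union> ?B)" by (simp add: hook_length_def)
  also have "\<dots> = card ?A + card ?B" by (rule card_Un_disjoint) auto
  also have "card ?A = p ! i - j" by (subst card_image) (auto simp: inj_on_def)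
  also have "card ?B = col_len p j - 1 - i" by (subst card_image) (auto simp: inj_on_def)
  finally show "hook_length p i j = bead p i - gap p j" "gap p j < bead p i"
    using ic i j col_len_le[OF p, of j] by (simp_all add: bead_def gap_def)
qed

text \<open>The bead of row k lies above the gap of column j if the row reaches that column, and
  below it otherwise.\<close>

lemma gap_notin_beta:
  assumes p: "is_partition p" shows "gap p j \<notin> beta p"
proof
  assume "gap p j \<in> beta p"
  then obtain k where k: "k < length p" "gap p j = bead p k" by (auto simp: beta_def)
  show False
    using k col_len_iff[OF p, of k j] col_len_le[OF p, of j]
    by (cases "k < col_len p j") (auto simp: gap_def bead_def)
qed

lemma gap_mono:
  assumes p: "is_partition p" and "j < j'" shows "gap p j < gap p j'"
proof -
  have "{k. k < length p \<and> j' < p ! k} \<subseteq> {k. k < length p \<and> j < p ! k}" using assms(2) by auto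
  then have "col_len p j' \<le> col_len p j" unfolding col_len_def by (intro card_mono) auto
  then show ?thesis using assms(2) col_len_le[OF p, of j] by (simp add: gap_def)
qed

text \<open>Inclusion and equality of cardinalities: exactly \<open>length p - 1 - i\<close> beads
  lie below bead i, which leaves \<open>p ! i\<close> other numbers, as many as the row has
  cells.\<close>

lemma gaps_below_bead:
  assumes p: "is_partition p" and i: "i < length p"
  shows "gap p ` {..<p ! i} = {..<bead p i} - beta p"
proof (rule card_subset_eq)
  show "finite ({..<bead p i} - beta p)" by simp
  show "gap p ` {..<p ! i} \<subseteq> {..<bead p i} - beta p"
    using gap_notin_beta[OF p] hook_length_eq(2)[OF p i] by auto
  have "inj (gap p)" using gap_mono[OF p] by (simp add: strict_mono_def strict_mono_imp_inj_on)
  then have "card (gap p ` {..<p ! i}) = p ! i"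
    by (subst card_image) (auto intro: inj_on_subset)
  moreover have "{..<bead p i} \<inter> beta p = bead p ` {i<..<length p}"
  proof (intro equalityI subsetI)
    fix b assume "b \<in> {..<bead p i} \<inter> beta p"
    then obtain k where k: "k < length p" "b = bead p k" "bead p k < bead p i" by (auto simp: beta_def)
    have "i < k"
    proof (rule ccontr)
      assume "\<not> i < k"
      then have "k = i \<or> k < i" by auto
      then show False using bead_less[OF p, of k i] i k by auto
    qed
    then show "b \<in> bead p ` {i<..<length p}" using k by auto
  next
    fix b assume "b \<in> bead p ` {i<..<length p}"
    then show "b \<in> {..<bead p i} \<inter> beta p" using bead_less[OF p] by (auto simp: beta_def)
  qed
  moreover have "card (bead p ` {i<..<length p}) = length p - 1 - i"
    by (subst card_image) (auto intro: inj_on_subset[OF bead_inj[OF p]])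
  moreover have "card ({..<bead p i} - beta p) = bead p i - card ({..<bead p i} \<inter> beta p)"
    by (simp add: card_Diff_subset_Int)
  ultimately show "card (gap p ` {..<p ! i}) = card ({..<bead p i} - beta p)"
    by (simp add: bead_def)
qed

text \<open>If b - t is not a bead, it is a gap below b and yields a hook of length exactly t.
  Conversely, closure under subtracting t iterates, so a hook length divisible by t would make a gap
  a bead.\<close>

lemma t_core_iff:
  assumes p: "is_partition p" and t: "0 < t"
  shows "t_core t p \<longleftrightarrow> (\<forall>b\<in>beta p. t \<le> b \<longrightarrow> b - t \<in> beta p)"
proof
  assume core: "t_core t p"
  show "\<forall>b\<in>beta p. t \<le> b \<longrightarrow> b - t \<in> beta p"
  proof (intro ballI impI, rule ccontr)
    fix b assume b: "b \<in> beta p" "t \<le> b" "b - t \<notin> beta p"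
    then obtain i where i: "i < length p" "b = bead p i" by (auto simp: beta_def)
    then have "b - t \<in> gap p ` {..<p ! i}" using gaps_below_bead[OF p i(1)] b t by auto
    then obtain j where j: "j < p ! i" "b - t = gap p j" by auto
    then have "hook_length p i j = t" using hook_length_eq[OF p i(1) j(1)] i b by simp
    moreover have "\<not> t dvd hook_length p i j" using core i j by (auto simp: t_core_def young_diagram_def)
    ultimately show False by simp
  qed
next
  assume closed: "\<forall>b\<in>beta p. t \<le> b \<longrightarrow> b - t \<in> beta p"
  have down: "b - t * k \<in> beta p" if "b \<in> beta p" "t * k \<le> b" for b k
    using that
  proof (induction k)
    case (Suc k)
    then have "b - t * k \<in> beta p" "t \<le> b - t * k" by simp_all
    then have "b - t * k - t \<in> beta p" using closed by blast
    then show ?case by (simp add: algebra_simps)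
  qed simp
  show "t_core t p"
    unfolding t_core_def
  proof (intro ballI, clarify)
    fix i j assume ij: "(i, j) \<in> young_diagram p" and "t dvd hook_length p i j"
    then have i: "i < length p" and j: "j < p ! i" by (auto simp: young_diagram_def)
    from \<open>t dvd hook_length p i j\<close> obtain k where "hook_length p i j = t * k" by (elim dvdE)
    then have k: "bead p i - gap p j = t * k" "gap p j < bead p i" using hook_length_eq[OF p i j] by simp_all
    then have "bead p i - t * k \<in> beta p" using i by (intro down) (auto simp: beta_def)
    moreover have "bead p i - t * k = gap p j" using k by simp
    ultimately show False using gap_notin_beta[OF p] by simp
  qed
qed

lemma beta_props:
  assumes "is_partition p"
  shows "finite (beta p)" "0 \<notin> beta p" "card (beta p) = length p"
    "2 * \<Sum>(beta p) = 2 * sum_list p + card (beta p) * (card (beta p) - 1)"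
proof -
  have "bead p i \<noteq> 0" if "i < length p" for i
  proof -
    have "p ! i \<in> set p" using that by simp
    then have "p ! i \<noteq> 0" using assms unfolding is_partition_def by metis
    then show ?thesis by (simp add: bead_def)
  qed
  note bead_pos = this
  show "0 \<notin> beta p"
  proof
    assume "0 \<in> beta p"
    then obtain i where "i < length p" "0 = bead p i" unfolding beta_def by blast
    then show False using bead_pos[of i] by simp
  qed
  show "finite (beta p)" by (simp add: beta_def)
  show card: "card (beta p) = length p"
    unfolding beta_def using bead_inj[OF assms] by (simp add: card_image)
  have "\<Sum>(beta p) = (\<Sum>i<length p. bead p i)"
    unfolding beta_def using bead_inj[OF assms] by (simp add: sum.reindex)
  also have "\<dots> = sum_list p + (\<Sum>i<length p. length p - 1 - i)"
    unfolding bead_def sum.distrib by (simp add: sum_list_sum_nth atLeast0LessThan)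
  also have "(\<Sum>i<length p. length p - 1 - i) = (\<Sum>i<length p. i)"
    using sum.nat_diff_reindex[of "\<lambda>i. i" "length p"] by simp
  finally have "2 * \<Sum>(beta p) = 2 * sum_list p + 2 * (\<Sum>i<length p. i)" by simp
  moreover have "2 * (\<Sum>i<n. i) = n * (n - 1)" for n :: nat
  proof (induction n)
    case (Suc n)
    then show ?case by (cases n) auto
  qed simp
  ultimately show "2 * \<Sum>(beta p) = 2 * sum_list p + card (beta p) * (card (beta p) - 1)"
    using card by simp
qed

lemma beta_inj: "inj_on beta {p. is_partition p}"
proof (rule inj_onI)
  fix p p' assume "p \<in> {p. is_partition p}" "p' \<in> {p. is_partition p}" and eq: "beta p = beta p'"
  then have P: "is_partition p" "is_partition p'" by simp_all
  have len: "length p = length p'" using beta_props(3)[OF P(1)] beta_props(3)[OF P(2)] eq by simp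
  let ?l = "\<lambda>p. rev (map (bead p) [0..<length p])"
  have sorted: "sorted (?l p)" "distinct (?l p)" "set (?l p) = beta p" if "is_partition p" for p
  proof -
    have "sorted_wrt (\<lambda>x y. y \<le> x) (map (bead p) [0..<length p])"
      using bead_less[OF that] by (auto simp: sorted_wrt_iff_nth_less intro: less_imp_le)
    then show "sorted (?l p)" by (simp add: sorted_wrt_rev)
    show "distinct (?l p)" using bead_inj[OF that] by (simp add: distinct_map atLeast0LessThan)
    show "set (?l p) = beta p" by (simp add: beta_def atLeast0LessThan)
  qed
  have "?l p = ?l p'"
    using sorted_distinct_set_unique[OF sorted(1,2)[OF P(1)] sorted(1,2)[OF P(2)]] sorted(3)[OF P(1)] sorted(3)[OF P(2)] eq by simp
  then have "map (bead p) [0..<length p] = map (bead p') [0..<length p]"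
    using len by simp
  then have "bead p i = bead p' i" if "i < length p" for i using that by simp
  then have "p ! i = p' ! i" if "i < length p" for i using that len by (fastforce simp: bead_def)
  then show "p = p'" using len by (simp add: nth_equalityI)
qed

text \<open>Sort \<open>B\<close> decreasingly and subtract the staircase n - 1, ..., 0. As 0 is
  excluded, the k-th element from the bottom, counted from 0, is at least k + 1, so all parts are
  positive.\<close>

lemma beta_surj:
  assumes B: "finite B" "0 \<notin> B" obtains p where "is_partition p" "beta p = B"
proof -
  define xs where "xs = rev (sorted_list_of_set B)"
  define n where "n = length xs"
  have set: "set xs = B" using B by (simp add: xs_def)
  have dec: "xs ! j < xs ! i" if "i < j" "j < n" for i j
  proof -
    have "sorted_wrt (>) xs" unfolding xs_def sorted_wrt_rev using strict_sorted_list_of_set by auto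
    then show ?thesis using that by (simp add: sorted_wrt_iff_nth_less n_def)
  qed
  have pos: "0 < xs ! i" if "i < n" for i using that B(2) set n_def by (metis nth_mem gr0I)
  have low: "k + 1 \<le> xs ! (n - 1 - k)" if "k < n" for k
    using that
  proof (induction k)
    case 0
    then show ?case using pos[of "n - 1"] by simp
  next
    case (Suc k)
    then have "xs ! (n - 1 - k) < xs ! (n - 1 - Suc k)" by (intro dec) auto
    then show ?case using Suc by simp
  qed
  define p where "p = map (\<lambda>i. xs ! i - (n - 1 - i)) [0..<n]"
  have len: "length p = n" by (simp add: p_def)
  have nth: "p ! i = xs ! i - (n - 1 - i)" "n - 1 - i < xs ! i" if "i < n" for i
    using that low[of "n - 1 - i"] by (simp_all add: p_def)
  have step: "p ! Suc i \<le> p ! i" if "Suc i < n" for i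
    using nth[of i] nth[of "Suc i"] dec[of i "Suc i"] that by simp
  have "p ! j \<le> p ! i" if "i < j" "j < n" for i j
    using that
  proof (induction j)
    case (Suc j)
    then show ?case using step[of j] by (cases "i = j") auto
  qed simp
  then have "sorted_wrt (\<ge>) p" by (simp add: sorted_wrt_iff_nth_less len)
  moreover have "0 \<notin> set p" using nth by (fastforce simp: in_set_conv_nth len)
  ultimately have "is_partition p" by (simp add: is_partition_def)
  moreover have "bead p i = xs ! i" if "i < n" for i using that nth[OF that] by (simp add: bead_def len)
  then have "beta p = B" unfolding beta_def len set[symmetric] by (auto simp: n_def in_set_conv_nth image_iff)
  ultimately show thesis by (rule that)
qed

text \<open>An abacus with three runners: runner 0 empty, c and d beads pushed down on runners 1 and
  2.\<close>

definition beads3 :: "nat \<Rightarrow> nat \<Rightarrow> nat set" where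
  "beads3 c d = (\<lambda>k. 3 * k + 1) ` {..<c} \<union> (\<lambda>k. 3 * k + 2) ` {..<d}"

lemma mem_beads3: "b \<in> beads3 c d \<longleftrightarrow> (b mod 3 = 1 \<and> b div 3 < c) \<or> (b mod 3 = 2 \<and> b div 3 < d)"
proof -
  have "b \<in> (\<lambda>k. 3 * k + r) ` {..<c} \<longleftrightarrow> b mod 3 = r \<and> b div 3 < c" if "r < 3" for r c :: nat
  proof
    assume "b mod 3 = r \<and> b div 3 < c"
    then show "b \<in> (\<lambda>k. 3 * k + r) ` {..<c}" by (intro image_eqI[of _ _ "b div 3"]) auto
  qed (use that in auto)
  from this[of 1] this[of 2] show ?thesis by (simp add: beads3_def)
qed

lemma Suc_3_div_mod: "Suc (3 * k) div 3 = k" "Suc (3 * k) mod 3 = Suc 0"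
  "Suc (Suc (3 * k)) div 3 = k" "Suc (Suc (3 * k)) mod 3 = 2"
  by presburger+

lemma beads3_props:
  "finite (beads3 c d)" "0 \<notin> beads3 c d" "b \<in> beads3 c d \<Longrightarrow> 3 \<le> b \<Longrightarrow> b - 3 \<in> beads3 c d"
  "card (beads3 c d) = c + d" "2 * \<Sum>(beads3 c d) + c = 3 * c * c + 3 * d * d + d"
proof -
  show "finite (beads3 c d)" "0 \<notin> beads3 c d" by (auto simp: beads3_def)
  show "b - 3 \<in> beads3 c d" if b: "b \<in> beads3 c d" "3 \<le> b"
  proof -
    define e where "e = b - 3"
    have e: "b = e + 3" using b(2) by (simp add: e_def)
    show ?thesis using b(1) by (auto simp: mem_beads3 e)
  qed
  have disj: "(\<lambda>k. 3 * k + 1) ` {..<c} \<inter> (\<lambda>k. 3 * k + 2) ` {..<d} = {}"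
    by (auto, presburger)
  show "card (beads3 c d) = c + d"
    unfolding beads3_def by (subst card_Un_disjoint) (use disj in \<open>auto simp: card_image inj_on_def\<close>)
  have "\<Sum>(beads3 c d) = (\<Sum>k<c. 3 * k + 1) + (\<Sum>k<d. 3 * k + 2)"
    unfolding beads3_def by (subst sum.union_disjoint) (use disj in \<open>auto simp: sum.reindex inj_on_def\<close>)
  moreover have "2 * (\<Sum>k<c. 3 * k + 1) + c = 3 * c * c" by (induction c) (auto simp: algebra_simps)
  moreover have "2 * (\<Sum>k<d. 3 * k + 2) = 3 * d * d + d" by (induction d) (auto simp: algebra_simps)
  ultimately show "2 * \<Sum>(beads3 c d) + c = 3 * c * c + 3 * d * d + d" by simp
qed

lemma beads3_inj: "beads3 c d = beads3 c' d' \<Longrightarrow> c = c' \<and> d = d'"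
proof -
  assume eq: "beads3 c d = beads3 c' d'"
  have mem: "3 * k + 1 \<in> beads3 c d \<longleftrightarrow> k < c" "3 * k + 2 \<in> beads3 c d \<longleftrightarrow> k < d" for k c d
    by (simp_all add: mem_beads3 Suc_3_div_mod)
  have "k < c \<longleftrightarrow> k < c'" "k < d \<longleftrightarrow> k < d'" for k
    using mem[of k c d] mem[of k c' d'] unfolding eq by simp_all
  from this[of c] this[of c'] this[of d] this[of d'] show ?thesis by linarith
qed

text \<open>On each runner the beads form an initial segment, and a bead on runner 0 would force 0
  into the set.\<close>

lemma closed_beads3:
  assumes fin: "finite B" and 0: "0 \<notin> B" and closed: "\<And>b. b \<in> B \<Longrightarrow> 3 \<le> b \<Longrightarrow> b - 3 \<in> B"
  obtains c d where "B = beads3 c d"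
proof -
  have down: "3 * k' + r \<in> B" if "3 * k + r \<in> B" "k' \<le> k" for k k' r
    using that
  proof (induction k)
    case (Suc k)
    show ?case
    proof (cases "k' = Suc k")
      case False
      have "3 * k + r \<in> B" using closed[of "3 * Suc k + r"] Suc.prems(1) by simp
      then show ?thesis using Suc.IH Suc.prems(2) False by simp
    qed (use Suc in simp)
  qed simp
  have bound: "\<exists>c. \<forall>k. 3 * k + r \<in> B \<longleftrightarrow> k < c" for r
  proof -
    let ?S = "{k. 3 * k + r \<in> B}"
    have finS: "finite ?S"
      using finite_vimageI[OF fin, of "\<lambda>k. 3 * k + r"] by (simp add: vimage_def inj_def)
    show ?thesis
    proof (cases "?S = {}")
      case False
      have "3 * k + r \<in> B \<longleftrightarrow> k < Suc (Max ?S)" for k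
        using Max_in[OF finS False] Max_ge[OF finS, of k] down[of "Max ?S" r k] by auto
      then show ?thesis by blast
    qed auto
  qed
  obtain c where c: "\<And>k. 3 * k + 1 \<in> B \<longleftrightarrow> k < c" using bound[of 1] by blast
  obtain d where d: "\<And>k. 3 * k + 2 \<in> B \<longleftrightarrow> k < d" using bound[of 2] by blast
  have z: "3 * k \<notin> B" for k using down[of k 0 0] 0 by auto
  have "b \<in> B \<longleftrightarrow> b \<in> beads3 c d" for b
  proof -
    have "b = 3 * (b div 3) \<or> b = 3 * (b div 3) + 1 \<or> b = 3 * (b div 3) + 2" by presburger
    then consider k where "b = 3 * k" | k where "b = 3 * k + 1" | k where "b = 3 * k + 2" by blast
    then show ?thesis using z c d by cases (simp_all add: mem_beads3 Suc_3_div_mod)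
  qed
  then show thesis using that by blast
qed

definition cores :: "nat \<Rightarrow> nat list set" where
  "cores n = {p. is_partition p \<and> t_core 3 p \<and> sum_list p = n}"

lemma core_size_iff:
  assumes p: "is_partition p" and b: "beta p = beads3 c d"
  shows "sum_list p = n \<longleftrightarrow> c * c + d * d + d = n + c * d"
proof -
  have x: "x * (x - 1) + x = x * x" for x :: nat by (cases x) auto
  have "2 * \<Sum>(beads3 c d) = 2 * sum_list p + (c + d) * (c + d - 1)"
    using beta_props(4)[OF p] unfolding b beads3_props(4) .
  then have "2 * sum_list p + (c + d) * (c + d) + c = 3 * c * c + 3 * d * d + d + (c + d)"
    using beads3_props(5)[of c d] x[of "c + d"] by linarith
  moreover have "(c + d) * (c + d) = c * c + 2 * (c * d) + d * d" by (simp add: algebra_simps)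
  ultimately have "sum_list p + c * d = c * c + d * d + d" by linarith
  then show ?thesis by auto
qed

lemma bij_cores:
  "bij_betw (\<lambda>(c, d). the_inv_into {p. is_partition p} beta (beads3 c d))
     {(c, d). c * c + d * d + d = n + c * d} (cores n)"
proof -
  let ?f = "\<lambda>c d. the_inv_into {p. is_partition p} beta (beads3 c d)"
  have f: "is_partition (?f c d)" "beta (?f c d) = beads3 c d" for c d
  proof -
    obtain p where p: "is_partition p" "beta p = beads3 c d"
      using beta_surj[OF beads3_props(1)[of c d] beads3_props(2)[of c d]] by blast
    then have "the_inv_into {p. is_partition p} beta (beta p) = p"
      by (intro the_inv_into_f_f[OF beta_inj]) blast
    then have "?f c d = p" unfolding p(2) .
    then show "is_partition (?f c d)" "beta (?f c d) = beads3 c d" by (simp_all only: p)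
  qed
  have core: "t_core 3 (?f c d)" for c d
    unfolding t_core_iff[OF f(1) zero_less_numeral] f(2)
    by (intro ballI impI beads3_props(3))
  show ?thesis
    unfolding bij_betw_def
  proof
    show "inj_on (\<lambda>(c, d). ?f c d) {(c, d). c * c + d * d + d = n + c * d}"
    proof (intro inj_onI, clarify)
      fix c d c' d' assume "?f c d = ?f c' d'"
      then have "beta (?f c d) = beta (?f c' d')" by (rule arg_cong)
      then have "beads3 c d = beads3 c' d'" unfolding f(2) .
      then show "c = c' \<and> d = d'" by (rule beads3_inj)
    qed
    show "(\<lambda>(c, d). ?f c d) ` {(c, d). c * c + d * d + d = n + c * d} = cores n"
    proof (intro equalityI subsetI)
      fix p assume "p \<in> cores n"
      then have p: "is_partition p" "t_core 3 p" "sum_list p = n" by (auto simp: cores_def)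
      have "b - 3 \<in> beta p" if "b \<in> beta p" "3 \<le> b" for b
        using p(2) that unfolding t_core_iff[OF p(1) zero_less_numeral] by blast
      from closed_beads3[OF beta_props(1,2)[OF p(1)] this] obtain c d where cd: "beta p = beads3 c d"
        by blast
      have "the_inv_into {p. is_partition p} beta (beta p) = p"
        using p(1) by (intro the_inv_into_f_f[OF beta_inj]) blast
      then have "?f c d = p" unfolding cd .
      moreover have "c * c + d * d + d = n + c * d" using core_size_iff[OF p(1) cd] p(3) by blast
      ultimately show "p \<in> (\<lambda>(c, d). ?f c d) ` {(c, d). c * c + d * d + d = n + c * d}"
        by (intro image_eqI[of _ _ "(c, d)"]) simp_all
    next
      fix p assume "p \<in> (\<lambda>(c, d). ?f c d) ` {(c, d). c * c + d * d + d = n + c * d}"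
      then obtain c d where p: "p = ?f c d" and cd: "c * c + d * d + d = n + c * d" by auto
      have "sum_list (?f c d) = n" using core_size_iff[OF f] cd by blast
      then show "p \<in> cores n"
        unfolding cores_def p mem_Collect_eq using f(1) core by blast
    qed
  qed
qed

section \<open>Fourier coefficients of the eta power\<close>

lemma cores_core_fps: "finite (cores n)" "fps_nth core_fps n = of_nat (card (cores n))"
  using bij_betw_finite[OF bij_cores[of n]] bij_betw_same_card[OF bij_cores[of n]] core_fps_nth_pairs[where N = n]
  by auto

section \<open>Tuples of cores and powers of their generating function\<close>

definition core_tuples :: "nat \<Rightarrow> nat \<Rightarrow> nat list list set" where
  "core_tuples k n = {ps. length ps = k \<and> (\<forall>p\<in>set ps. is_partition p \<and> t_core 3 p) \<and> (\<Sum>p\<leftarrow>ps. sum_list p) = n}"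

lemma core_tuples_Suc:
  "core_tuples (Suc k) n = (\<Union>m\<in>{0..n}. (\<lambda>(p, ps). p # ps) ` (cores m \<times> core_tuples k (n - m)))"
proof (intro equalityI subsetI)
  fix qs assume "qs \<in> core_tuples (Suc k) n"
  then obtain p ps where qs: "qs = p # ps" "length ps = k" "\<forall>p\<in>set (p # ps). is_partition p \<and> t_core 3 p"
    "sum_list p + (\<Sum>p\<leftarrow>ps. sum_list p) = n"
    by (auto simp: core_tuples_def length_Suc_conv)
  then have "p \<in> cores (sum_list p)" "ps \<in> core_tuples k (n - sum_list p)" "sum_list p \<in> {0..n}"
    by (auto simp: cores_def core_tuples_def)
  then show "qs \<in> (\<Union>m\<in>{0..n}. (\<lambda>(p, ps). p # ps) ` (cores m \<times> core_tuples k (n - m)))"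
    using qs(1) by blast
qed (auto simp: cores_def core_tuples_def)

lemma core_tuples_core_fps:
  "finite (core_tuples k n) \<and> fps_nth (core_fps ^ k) n = of_nat (card (core_tuples k n))"
proof (induction k arbitrary: n)
  case 0
  have "core_tuples 0 n = (if n = 0 then {[]} else {})" by (auto simp: core_tuples_def)
  then show ?case by simp
next
  case (Suc k)
  let ?A = "\<lambda>m. (\<lambda>(p, ps). p # ps) ` (cores m \<times> core_tuples k (n - m))"
  have fin: "finite (?A m)" for m using Suc cores_core_fps(1) by blast
  have card: "card (?A m) = card (cores m) * card (core_tuples k (n - m))" for m
    by (subst card_image) (auto simp: inj_on_def card_cartesian_product)
  have "card (core_tuples (Suc k) n) = (\<Sum>m=0..n. card (?A m))"
    unfolding core_tuples_Suc by (rule card_UN_disjoint) (use fin in \<open>auto simp: cores_def\<close>)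
  then have "of_nat (card (core_tuples (Suc k) n)) = fps_nth (core_fps ^ Suc k) n"
    using Suc by (simp add: card fps_mult_nth cores_core_fps(2))
  moreover have "finite (core_tuples (Suc k) n)" unfolding core_tuples_Suc using fin by blast
  ultimately show ?case by simp
qed

lemma core_tuple_count_core_fps: "of_nat (core_tuple_count 3 k n) = fps_nth (core_fps ^ k) n"
proof -
  have "{ps \<in> partition_tuples k n. \<forall>p\<in>set ps. t_core 3 p} = core_tuples k n"
    by (auto simp: partition_tuples_def core_tuples_def)
  then show ?thesis using core_tuples_core_fps[of k n] by (simp add: core_tuple_count_def)
qed

text \<open>At most 2N + 3 indices can reach degree N, so crude geometric bounds suffice; any
  neighbourhood of 0 is enough for comparing coefficients.\<close>

lemma euler_fps_radius: "fps_conv_radius euler_fps \<ge> ereal (1 / 4)"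
proof -
  have le: "norm (fps_nth euler_fps N) \<le> 3 * 2 ^ N" for N
  proof -
    have "fps_nth euler_fps N = (\<Sum>k\<in>{- (int N + 1)..int N + 1}. (if even k then 1 else -1) * (if theta_exp 3 2 k = int N then 1 else 0))"
      by (rule euler_fps_nth) (auto dest: theta_exp_abs_le)
    also have "norm \<dots> \<le> (\<Sum>k\<in>{- (int N + 1)..int N + 1}. 1)"
      by (rule sum_norm_le) auto
    also have "\<dots> = 2 * real N + 3" by simp
    also have "\<dots> \<le> 3 * 2 ^ N" by (induction N) auto
    finally show ?thesis .
  qed
  have "summable (\<lambda>N. fps_nth euler_fps N * (1 / 4) ^ N)"
  proof (rule summable_comparison_test')
    show "summable (\<lambda>N. 3 * (1 / 2) ^ N :: real)" by (intro summable_mult summable_geometric) simp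
    show "norm (fps_nth euler_fps N * (1 / 4) ^ N) \<le> 3 * (1 / 2) ^ N" for N
    proof -
      have "norm (fps_nth euler_fps N * (1 / 4) ^ N) = norm (fps_nth euler_fps N) * (1 / 4) ^ N"
        by (simp add: norm_mult norm_power norm_divide)
      also have "\<dots> \<le> (3 * 2 ^ N) * (1 / 4) ^ N" using le by (intro mult_right_mono) auto
      also have "\<dots> = 3 * (2 * (1 / 4)) ^ N" unfolding power_mult_distrib by simp
      finally show ?thesis by simp
    qed
  qed
  from conv_radius_geI[OF this] show ?thesis by (simp add: fps_conv_radius_def norm_divide)
qed

text \<open>Among the indices outside -n..n the smallest exponent occurs at -(n+1), and it exceeds
  all exponents inside. The symmetric sum is therefore a genuine truncation of the power
  series.\<close>

lemma euler_fps_partial_sum: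
  "euler_fps_partial x n = (\<Sum>N<nat (theta_exp 3 2 (- int (Suc n))). fps_nth euler_fps N * (x :: complex) ^ N)"
proof -
  define Q where "Q = theta_exp 3 2 (- int (Suc n))"
  let ?M = "nat Q" and ?K = "{- int n..int n}"
  have E: "2 * theta_exp 3 2 k = 3 * (k * k) + k" for k
    using triangular_2[of k] by (simp add: theta_exp_def algebra_simps)
  have EM: "2 * Q = 3 * (int n * int n) + 5 * int n + 2"
    unfolding Q_def E by (simp add: algebra_simps)
  have in_range: "theta_exp 3 2 k < Q \<longleftrightarrow> k \<in> ?K" for k
  proof
    assume k: "k \<in> ?K"
    have "\<bar>k\<bar> * \<bar>k\<bar> \<le> int n * int n" using k by (intro mult_mono) auto
    then have "k * k \<le> int n * int n" by simp
    moreover have "k \<le> int n" using k by simp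
    ultimately show "theta_exp 3 2 k < Q" using E[of k] EM by linarith
  next
    assume lt: "theta_exp 3 2 k < Q"
    show "k \<in> ?K"
    proof (rule ccontr)
      assume "k \<notin> ?K"
      then have k: "int n + 1 \<le> \<bar>k\<bar>" by (simp only: atLeastAtMost_iff) linarith
      have k1: "0 \<le> \<bar>k\<bar> - (int n + 1)" using k by linarith
      have k2: "0 \<le> 3 * (\<bar>k\<bar> + int n + 1) - 1" using k by arith
      from mult_nonneg_nonneg[OF k1 k2] have "0 \<le> (\<bar>k\<bar> - (int n + 1)) * (3 * (\<bar>k\<bar> + int n + 1) - 1)" .
      also have "\<dots> = 3 * (\<bar>k\<bar> * \<bar>k\<bar>) - \<bar>k\<bar> - 3 * (int n * int n) - 5 * int n - 2"
        by (simp only: algebra_simps)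
      also have "\<bar>k\<bar> * \<bar>k\<bar> = k * k" by simp
      finally show False using lt E[of k] EM by linarith
    qed
  qed
  have "(\<Sum>N<?M. fps_nth euler_fps N * x ^ N) =
     (\<Sum>N<?M. \<Sum>k\<in>?K. ((if even k then 1 else -1) * (if theta_exp 3 2 k = int N then 1 else 0)) * x ^ N)"
  proof (intro sum.cong refl)
    fix N assume N: "N \<in> {..<?M}"
    have "fps_nth euler_fps N = (\<Sum>k\<in>?K. (if even k then 1 else -1) * (if theta_exp 3 2 k = int N then 1 else 0))"
    proof (rule euler_fps_nth)
      fix k assume "theta_exp 3 2 k = int N"
      with N have "theta_exp 3 2 k < Q" by simp
      then show "k \<in> ?K" using in_range by blast
    qed simp
    then show "fps_nth euler_fps N * x ^ N =
      (\<Sum>k\<in>?K. ((if even k then 1 else -1) * (if theta_exp 3 2 k = int N then 1 else 0)) * x ^ N)"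
      by (simp add: sum_distrib_right)
  qed
  also have "\<dots> = (\<Sum>k\<in>?K. \<Sum>N<?M. ((if even k then 1 else -1) * (if theta_exp 3 2 k = int N then 1 else 0)) * x ^ N)"
    by (rule sum.swap)
  also have "\<dots> = (\<Sum>k\<in>?K. (if even k then 1 else -1) * x ^ nat (theta_exp 3 2 k))"
  proof (intro sum.cong refl)
    fix k assume k: "k \<in> ?K"
    have nn: "0 \<le> theta_exp 3 2 k" using theta_exp_ge(2)[of 3 2 k] by simp
    have "theta_exp 3 2 k < Q" using in_range k by blast
    then have "nat (theta_exp 3 2 k) \<in> {..<?M}" using nn by simp
    moreover have "(\<Sum>N<?M. ((if even k then 1 else -1) * (if theta_exp 3 2 k = int N then 1 else 0)) * x ^ N)
        = (\<Sum>N<?M. if N = nat (theta_exp 3 2 k) then (if even k then 1 else -1) * x ^ N else 0)"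
      using nn by (intro sum.cong refl) auto
    ultimately show "(\<Sum>N<?M. ((if even k then 1 else -1) * (if theta_exp 3 2 k = int N then 1 else 0)) * x ^ N)
        = (if even k then 1 else -1) * x ^ nat (theta_exp 3 2 k)"
      by (simp only: sum.delta finite_lessThan if_True)
  qed
  finally show ?thesis unfolding euler_fps_partial_def Q_def ..
qed

text \<open>The factors 1 - x^i are bounded by 2 and the power of x by (1/4)^n, so each of the n
  summands is at most (1/2)^n.\<close>

lemma shanks_tail:
  assumes x: "norm (x :: complex) \<le> 1 / 4"
  shows "(\<lambda>n. \<Sum>k=1..n. shanks x n k) \<longlonglongrightarrow> 0"
proof (rule Lim_null_comparison)
  show "(\<lambda>n. real n * (1 / 2) ^ n) \<longlonglongrightarrow> 0" by real_asymp
  show "\<forall>\<^sub>F n in sequentially. norm (\<Sum>k=1..n. shanks x n k) \<le> real n * (1 / 2) ^ n"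
  proof (rule always_eventually, rule allI)
    fix n
    have "norm (shanks x n k) \<le> (1 / 2) ^ n" if k: "k \<in> {1..n}" for k
    proof -
      have "norm (\<Prod>i=k+1..n. 1 - x ^ i) \<le> (\<Prod>i=k+1..n. 2)"
        unfolding prod_norm[symmetric]
      proof (rule prod_mono, intro conjI)
        fix i
        have "norm (x ^ i) \<le> 1" unfolding norm_power using x by (intro power_le_one) auto
        then show "norm (1 - x ^ i) \<le> 2" using norm_triangle_ineq4[of 1 "x ^ i"] by simp
      qed auto
      also have "\<dots> = 2 ^ (n - k)" by simp
      also have "\<dots> \<le> (2 :: real) ^ n" by (rule power_increasing) auto
      finally have 1: "norm (\<Prod>i=k+1..n. 1 - x ^ i) \<le> 2 ^ n" .
      have "n * 1 \<le> n * k" using k by (intro mult_le_mono) auto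
      then have "n \<le> n * k + \<Sum>{..k}" by linarith
      then have "norm x ^ (n * k + \<Sum>{..k}) \<le> norm x ^ n" using x by (intro power_decreasing) auto
      also have "\<dots> \<le> (1 / 4) ^ n" using x by (intro power_mono) auto
      finally have "norm (\<Prod>i=k+1..n. 1 - x ^ i) * norm x ^ (n * k + \<Sum>{..k}) \<le> 2 ^ n * (1 / 4) ^ n"
        using 1 by (intro mult_mono) auto
      also have "(2::real) ^ n * (1 / 4) ^ n = (1 / 2) ^ n" unfolding power_mult_distrib[symmetric] by simp
      finally show ?thesis by (simp add: shanks_def norm_mult norm_power)
    qed
    then show "norm (\<Sum>k=1..n. shanks x n k) \<le> real n * (1 / 2) ^ n"
      using sum_norm_le[of "{1..n}" "shanks x n" "\<lambda>_. (1 / 2) ^ n"] by simp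
  qed
qed

text \<open>By \<open>eprod_shanks\<close> the finite products and the pentagonal partial sums
  differ by a null sequence. The latter are a subsequence of the partial sums of the power
  series.\<close>

lemma eval_euler_fps:
  assumes x: "norm (x :: complex) < 1 / 4"
  shows "eval_fps euler_fps x = (\<Prod>m. 1 - x ^ Suc m)"
proof -
  define M where "M = (\<lambda>n. nat (theta_exp 3 2 (- int (Suc n))))"
  have "ereal (norm x) < fps_conv_radius euler_fps"
    using x by (intro less_le_trans[OF _ euler_fps_radius]) simp
  then have "(\<lambda>N. fps_nth euler_fps N * x ^ N) sums eval_fps euler_fps x" by (rule sums_eval_fps)
  then have lim: "(\<lambda>n. \<Sum>N<n. fps_nth euler_fps N * x ^ N) \<longlonglongrightarrow> eval_fps euler_fps x" by (simp add: sums_def)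
  have "strict_mono M"
    unfolding M_def theta_exp_neg nat_int strict_mono_Suc_iff by simp
  from LIMSEQ_subseq_LIMSEQ[OF lim this]
  have "(\<lambda>n. \<Sum>N<M n. fps_nth euler_fps N * x ^ N) \<longlonglongrightarrow> eval_fps euler_fps x"
    unfolding comp_def .
  then have "euler_fps_partial x \<longlonglongrightarrow> eval_fps euler_fps x" by (simp add: euler_fps_partial_sum[abs_def] M_def)
  from tendsto_diff[OF this shanks_tail[of x]] have lim1: "eprod x \<longlonglongrightarrow> eval_fps euler_fps x"
    using x by (simp add: eprod_shanks[abs_def])
  have "summable (\<lambda>i. norm ((1 - x ^ Suc i) - 1))"
  proof -
    have "summable (\<lambda>i. norm x * norm x ^ i)" using x by (intro summable_mult summable_geometric) simp
    then show ?thesis by (simp add: norm_mult norm_power)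
  qed
  then have "convergent_prod (\<lambda>i. 1 - x ^ Suc i)"
    by (intro abs_convergent_prod_imp_convergent_prod summable_imp_abs_convergent_prod)
  then have "(\<lambda>n. \<Prod>i\<le>n. 1 - x ^ Suc i) \<longlonglongrightarrow> (\<Prod>m. 1 - x ^ Suc m)"
    by (rule convergent_prod_LIMSEQ)
  also have "(\<lambda>n. \<Prod>i\<le>n. 1 - x ^ Suc i) = (\<lambda>n. eprod x (Suc n))"
    unfolding eprod_def
    by (intro ext prod.reindex_bij_witness[of _ "\<lambda>i. i - 1" Suc]) auto
  finally have "(\<lambda>n. eprod x (Suc n)) \<longlonglongrightarrow> (\<Prod>m. 1 - x ^ Suc m)" .
  then have "eprod x \<longlonglongrightarrow> (\<Prod>m. 1 - x ^ Suc m)" by (rule LIMSEQ_imp_Suc)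
  then show ?thesis using lim1 LIMSEQ_unique by blast
qed

section \<open>The eta power as a function of q and its coefficients\<close>

lemma qexp_surj:
  assumes "x \<noteq> 0" "norm x < 1" obtains \<tau> where "Im \<tau> > 0" "qexp \<tau> = x"
proof
  define \<tau> where "\<tau> = Ln x / (2 * of_real pi * \<i>)"
  have t: "2 * of_real pi * \<i> * \<tau> = Ln x" by (simp add: \<tau>_def)
  then show "qexp \<tau> = x" using assms(1) by (simp add: qexp_def)
  have "Re (Ln x) = - (2 * pi * Im \<tau>)" unfolding t[symmetric] by simp
  moreover have "Re (Ln x) < 0" using assms by (simp add: ln_less_zero_iff)
  ultimately show "Im \<tau> > 0" by (simp add: zero_less_mult_iff)
qed

lemma qexp_mult_nat: "qexp (of_nat n * \<tau>) = qexp \<tau> ^ n"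
  unfolding qexp_def exp_of_nat_mult[symmetric] by (simp add: mult_ac)

lemma eta_power_8: "dedekind_eta (3 * \<tau>) ^ 8 = qexp \<tau> * (\<Prod>m. 1 - (qexp \<tau> ^ 3) ^ Suc m) ^ 8"
proof -
  have "qexp (3 * \<tau> / 24) ^ 8 = qexp \<tau>"
    using qexp_mult_nat[of 8 "3 * \<tau> / 24"] by simp
  moreover have "qexp (3 * \<tau>) = qexp \<tau> ^ 3"
    using qexp_mult_nat[of 3 \<tau>] by simp
  ultimately show ?thesis by (simp add: dedekind_eta_def power_mult_distrib)
qed

lemma fourier_coeff:
  fixes a :: "nat \<Rightarrow> complex"
  assumes fourier: "\<And>\<tau>. Im \<tau> > 0 \<Longrightarrow>
      ((\<lambda>m. a m * qexp \<tau> ^ m) has_sum (dedekind_eta (3 * \<tau>)) ^ 8) {1..}"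
  shows "a (3 * k + 1) = fps_nth (euler_fps ^ 8) k"
proof -
  \<comment> \<open>The Fourier series starts at 1 and says nothing about \<open>a 0\<close>, so the
    constant term is set to 0.\<close>
  define F where "F = Abs_fps (\<lambda>m. if m = 0 then 0 else a m)"
  define f where "f = (\<lambda>x. x * eval_fps euler_fps (x ^ 3) ^ 8)"
  have sums: "(\<lambda>m. fps_nth F m * x ^ m) sums f x" if x: "norm x < 1 / 4" for x
  proof (cases "x = 0")
    \<comment> \<open>No \<open>\<tau>\<close> maps to x = 0, so this point is treated by hand;
      every other x of the disc is some \<open>qexp \<tau>\<close>.\<close>
    case True
    then show ?thesis using sums_0[of "\<lambda>m. fps_nth F m * x ^ m"] by (simp add: F_def f_def)
  next
    case False
    have "norm x < 1" using x by linarith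
    from qexp_surj[OF False this] obtain \<tau> where t: "Im \<tau> > 0" "qexp \<tau> = x" by blast
    have "norm (x ^ 3) \<le> norm x"
      unfolding norm_power using x power_decreasing[of 1 3 "norm x"] by simp
    then have "eval_fps euler_fps (x ^ 3) = (\<Prod>m. 1 - (x ^ 3) ^ Suc m)" using x by (intro eval_euler_fps) simp
    then have "dedekind_eta (3 * \<tau>) ^ 8 = f x" by (simp only: eta_power_8 t f_def)
    then have "((\<lambda>m. a m * x ^ m) has_sum f x) {1..}" using fourier[OF t(1)] by (simp add: t(2))
    then have "((\<lambda>m. fps_nth F m * x ^ m) has_sum f x) UNIV"
    proof (rule has_sum_cong_neutral[THEN iffD1, rotated -1])
      fix m assume "m \<in> UNIV - {1 :: nat..}"
      then have "m = 0" by auto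
      then show "fps_nth F m * x ^ m = 0" by (simp add: F_def)
    qed (auto simp: F_def)
    then show ?thesis by (rule has_sum_imp_sums)
  qed
  have "norm (1 / 8 :: complex) < 1 / 4" by (simp add: norm_divide)
  from conv_radius_geI[OF sums_summable[OF sums[OF this]]]
  have "fps_conv_radius F \<ge> ereal (1 / 8)" by (simp add: fps_conv_radius_def norm_divide)
  moreover have "0 < ereal (1 / 8)" by simp
  ultimately have "fps_conv_radius F > 0" by (metis less_le_trans)
  moreover have "eventually (\<lambda>x. eval_fps F x = f x) (nhds 0)"
  proof -
    have "eventually (\<lambda>x :: complex. x \<in> ball 0 (1 / 4)) (nhds 0)"
      by (rule eventually_nhds_in_open) auto
    then show ?thesis
    proof eventually_elim
      case (elim x)
      then have "norm x < 1 / 4" by simp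
      from sums_unique[OF sums[OF this]] show ?case by (simp add: eval_fps_def)
    qed
  qed
  ultimately have F: "f has_fps_expansion F" by (simp add: has_fps_expansion_def)
  have "0 < ereal (1 / 4)" by simp
  from less_le_trans[OF this euler_fps_radius] have "fps_conv_radius euler_fps > 0" .
  then have E: "eval_fps euler_fps has_fps_expansion euler_fps" by (simp add: has_fps_expansion_def)
  have X0: "fps_nth (fps_X ^ 3 :: complex fps) 0 = 0" by (subst fps_X_power_nth) simp
  have "(eval_fps euler_fps \<circ> (\<lambda>x. x ^ 3)) has_fps_expansion expand3 euler_fps"
    unfolding expand3_def by (rule has_fps_expansion_compose[OF E has_fps_expansion_fps_X_power X0])
  then have "(\<lambda>x. eval_fps euler_fps (x ^ 3)) has_fps_expansion expand3 euler_fps" unfolding comp_def .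
  then have "f has_fps_expansion (fps_X * expand3 euler_fps ^ 8)"
    unfolding f_def by (intro has_fps_expansion_mult has_fps_expansion_power has_fps_expansion_fps_X)
  then have "f has_fps_expansion (fps_X * expand3 (euler_fps ^ 8))"
    unfolding expand3_power .
  then have eq: "F = fps_X * expand3 (euler_fps ^ 8)" by (rule fps_expansion_unique_complex[OF F])
  have m: "(3 * k + 1) mod 3 = 1" "(3 * k + 1) div 3 = k" by presburger+
  have "a (3 * k + 1) = fps_nth F (3 * k + 1)" by (simp add: F_def)
  also have "\<dots> = fps_nth (euler_fps ^ 8) k"
    unfolding eq X_expand3_nth m by (simp only: refl if_True)
  finally show ?thesis .
qed

theorem theorem3p4:
  fixes a :: "nat \<Rightarrow> complex" and n :: nat
  assumes fourier: "\<And>\<tau> :: complex. Im \<tau> > 0 \<Longrightarrow>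
      ((\<lambda>m. a m * qexp \<tau> ^ m) has_sum (dedekind_eta (3 * \<tau>)) ^ 8) {1..}"
  shows "of_nat (core_tuple_count 3 4 n) =
      1 / 81 * (of_nat (divisor_sigma 3 (3 * n + 4)) - a (3 * n + 4))"
proof -
  \<comment> \<open>The factor \<open>fps_X\<close> in \<open>sigma_3_identity\<close> pairs
    coefficient n of P^4 with coefficient n + 1 of the other two series.\<close>
  have n: "3 * (n + 1) + 1 = 3 * n + 4" by simp
  have "fps_nth (sigma_res 3 1) (n + 1) = fps_nth (euler_fps ^ 8) (n + 1) + 81 * fps_nth (core_fps ^ 4) n"
    unfolding sigma_3_identity by (simp add: numeral_fps_const mult.assoc)
  moreover have "fps_nth (sigma_res 3 1) (n + 1) = of_nat (divisor_sigma 3 (3 * n + 4))"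
    unfolding sigma_res_def fps_nth_Abs_fps n ..
  moreover have "a (3 * n + 4) = fps_nth (euler_fps ^ 8) (n + 1)"
    using fourier_coeff[OF fourier, of "n + 1"] unfolding n .
  ultimately have "of_nat (divisor_sigma 3 (3 * n + 4)) = a (3 * n + 4) + 81 * fps_nth (core_fps ^ 4) n"
    by simp
  then show ?thesis by (simp add: core_tuple_count_core_fps)
qed

end
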